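(* Let $(\eta^{ij})$ be a nondegenerate symmetric constant $N\times N$ matrix with inverse $(\eta_{ij})$, let $\varepsilon_\alpha$, $1\le\alpha\le L$, be constants, and let $F^i(u)$, $1\le i\le N$, and $\psi^\alpha(u)$, $1\le\alpha\le L$, be an arbitrary solution of the system $$\frac{\partial^2Q_1}{\partial u^i\partial u^s}\eta^{sp}\frac{\partial^2Q_2}{\partial u^p\partial u^j}=\frac{\partial^2Q_2}{\partial u^i\partial u^s}\eta^{sp}\frac{\partial^2Q_1}{\partial u^p\partial u^j},\qquad g^{is}_{\mathrm{can}}\eta^{jr}\frac{\partial^2Q}{\partial u^r\partial u^s}=g^{js}_{\mathrm{can}}\eta^{ir}\frac{\partial^2Q}{\partial u^r\partial u^s},$$ where $Q,Q_1,Q_2$ are arbitrary functions from among the $F^i$ and $\psi^\alpha$, and $$g^{ij}_{\mathrm{can}}(u)=\eta^{is}\frac{\partial F^j}{\partial u^s}+\eta^{js}\frac{\partial F^i}{\partial u^s}-\eta^{is}\eta^{jk}\sum_{\alpha=1}^L\varepsilon_\alpha\frac{\partial\psi^\alpha}{\partial u^s}\frac{\partial\psi^\alpha}{\partial u^k}.$$ Then the system of hydrodynamic type $$u^i_{t_1}=\Big(F^i(u)+\eta^{is}\eta_{jr}\frac{\partial F^j}{\partial u^s}u^r-\eta^{is}\sum_{\alpha=1}^L\varepsilon_\alpha\frac{\partial\psi^\alpha}{\partial u^s}\psi^\alpha\Big)_x$$ is bi-Hamiltonian with the pair of compatible Hamiltonian operators $$P_2^{ij}=\eta^{ij}\frac{d}{dx},$$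 $$P_1^{ij}=g^{ij}_{\mathrm{can}}\frac{d}{dx}+\Big(\eta^{is}\frac{\partial^2F^j}{\partial u^s\partial u^k}-\eta^{is}\eta^{jp}\sum_{\alpha=1}^L\varepsilon_\alpha\frac{\partial^2\psi^\alpha}{\partial u^s\partial u^k}\frac{\partial\psi^\alpha}{\partial u^p}\Big)u^k_x+\eta^{ip}\eta^{jr}\sum_{\alpha=1}^L\varepsilon_\alpha\frac{\partial^2\psi^\alpha}{\partial u^p\partial u^k}u^k_x\Big(\frac{d}{dx}\Big)^{-1}\frac{\partial^2\psi^\alpha}{\partial u^r\partial u^s}u^s_x,$$ namely $$u^i_{t_1}=P_1^{ij}\frac{\delta H_1}{\delta u^j(x)},\qquad H_1=\frac12\int\eta_{jl}u^j(x)u^l(x)\,dx,$$ $$u^i_{t_1}=P_2^{ij}\frac{\delta H_2}{\delta u^j(x)},\qquad H_2=\int\Big(\eta_{jk}F^k(u(x))u^j(x)-\frac12\sum_{\alpha=1}^L\varepsilon_\alpha(\psi^\alpha(u))^2\Big)dx.$$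
   Context: Here $u=(u^1,\dots,u^N)$ are local coordinates on a smooth $N$-dimensional manifold, $u^i(x)$ are fields depending on one independent variable $x$, and the $F^i$, $\psi^\alpha$ are smooth functions on a domain of the coordinates. Summation over repeated coordinate indices is understood; sums over $\alpha$ are written explicitly. The operator $(d/dx)^{-1}$ is the formal inverse of $d/dx$, so that $(d/dx)^{-1}(f(u)_x)=f(u)$ (here, when applied to $\frac{\partial^2\psi^\alpha}{\partial u^r\partial u^s}u^s_xu^r$, it gives $u^r\frac{\partial\psi^\alpha}{\partial u^r}-\psi^\alpha$). An operator $P^{ij}$ is Hamiltonian if $\{I,J\}=\int\frac{\delta I}{\delta u^i(x)}P^{ij}\frac{\delta J}{\delta u^j(x)}dx$ is a Poisson bracket, i.e. skew-symmetric and satisfying the Jacobi identity for arbitrary functionals. Two Hamiltonian operators are compatible if every linear combination of them with constant coefficients is Hamiltonian. A system is bi-Hamiltonian if it has two Hamiltonian representations with compatible Hamiltonian operators. Known criterion (Ferapontov) used by the paper: a bracket given by an operator $g^{ij}\frac{d}{dx}+b^{ij}_ku^k_x+\sum_{\alpha}\varepsilon_\alpha (w^\alpha)^i_ku^k_x(\frac{d}{dx})^{-1}(w^\alpha)^j_su^s_x$ with $\det(g^{ij})\not\equiv0$ is Poisson if and only if: $g^{ij}=g^{ji}$; $\partial g^{ij}/\partial u^k=b^{ij}_k+b^{ji}_k$; $g^{is}b^{jk}_s=g^{js}b^{ik}_s$; $g^{is}(w^\alpha)^j_s=g^{js}(w^\alpha)^i_s$; $(w^\alpha)^i_s(w^\beta)^s_j=(w^\beta)^i_s(w^\alpha)^s_j$;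 $g^{is}g^{jr}\frac{\partial (w^\alpha)^k_r}{\partial u^s}-g^{jr}b^{ik}_s(w^\alpha)^s_r=g^{js}g^{ir}\frac{\partial (w^\alpha)^k_r}{\partial u^s}-g^{ir}b^{jk}_s(w^\alpha)^s_r$; and $g^{is}\big(\frac{\partial b^{jk}_r}{\partial u^s}-\frac{\partial b^{jk}_s}{\partial u^r}\big)+b^{ik}_sb^{sj}_r-b^{ij}_sb^{sk}_r=\sum_{\alpha}\varepsilon_\alpha g^{is}\big((w^\alpha)^j_s(w^\alpha)^k_r-(w^\alpha)^j_r(w^\alpha)^k_s\big)$. *)

theory Defs
  imports "HOL-Analysis.Analysis"
begin

subsection \<open>Smooth functions and partial derivatives\<close>

text \<open>Meant for open \<open>S\<close> only.\<close>

primrec Ck_on :: "nat \<Rightarrow> 'a::real_normed_vector set \<Rightarrow> ('a \<Rightarrow> 'b::real_normed_vector) \<Rightarrow> bool" where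
  "Ck_on 0 S f = continuous_on S f"
| "Ck_on (Suc k) S f =
     (f differentiable_on S \<and> (\<forall>v. Ck_on k S (\<lambda>x. frechet_derivative f (at x) v)))"

definition smooth_on :: "'a::real_normed_vector set \<Rightarrow> ('a \<Rightarrow> 'b::real_normed_vector) \<Rightarrow> bool" where
  "smooth_on S f \<longleftrightarrow> (\<forall>k. Ck_on k S f)"

definition partial :: "'n \<Rightarrow> (real^'n::finite \<Rightarrow> real) \<Rightarrow> real^'n \<Rightarrow> real" where
  "partial i f u = frechet_derivative f (at u) (axis i 1)"

subsection \<open>Fields, functionals and variational derivatives\<close>

text \<open>A field is a smooth curve with values in the coordinate domain \<open>U\<close>; no behaviour at
  infinity is imposed. Variations of a field have compact support, so that
  \<open>u + \<epsilon> \<xi>\<close> is again a field for small \<open>\<epsilon>\<close>.\<close>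

type_synonym 'n field = "real \<Rightarrow> real^'n"
type_synonym 'n functional = "'n field \<Rightarrow> real"

definition field_space :: "(real^'n::finite) set \<Rightarrow> 'n field set" where
  "field_space U = {u. smooth_on UNIV u \<and> (\<forall>x. u x \<in> U)}"

definition variations :: "('n::finite) field set" where
  "variations = {\<xi>. smooth_on UNIV \<xi> \<and> (\<exists>R. \<forall>x. \<bar>x\<bar> > R \<longrightarrow> \<xi> x = 0)}"

definition Dx :: "('n::finite) field \<Rightarrow> 'n field" where
  "Dx u x = vector_derivative u (at x)"

definition has_variational_derivative ::
    "('n::finite) functional \<Rightarrow> 'n field \<Rightarrow> 'n field \<Rightarrow> bool" where
  "has_variational_derivative I u p \<longleftrightarrow> continuous_on UNIV p \<and>
     (\<forall>\<xi>\<in>variations. ((\<lambda>\<epsilon>. I (\<lambda>x. u x + \<epsilon> *\<^sub>R \<xi> x))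
        has_real_derivative integral UNIV (\<lambda>x. p x \<bullet> \<xi> x)) (at 0))"

text \<open>Unique when it exists, because a continuous \<open>p\<close> is determined by its integrals against
  variations.\<close>

definition variational_derivative :: "('n::finite) functional \<Rightarrow> 'n field \<Rightarrow> 'n field" where
  "variational_derivative I u = (THE p. has_variational_derivative I u p)"

text \<open>The functionals on which Poisson brackets are tested: those whose variational derivative
  exists, is supported in a fixed bounded interval, and is smooth jointly in \<open>x\<close> and in the
  parameters of any two-parameter affine family of fields. They include all
  \<open>\<integral> h(x, u, u\<^sub>x, u\<^sub>x\<^sub>x, \<dots>) dx\<close> with smooth \<open>h\<close> of bounded support in \<open>x\<close>, in particular the
  smeared coordinates \<open>\<integral> p\<^sub>i(x) u\<^sup>i(x) dx\<close>, and smooth functions of finitely many such integrals.\<close>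

definition smooth_functional :: "(real^'n::finite) set \<Rightarrow> 'n functional \<Rightarrow> bool" where
  "smooth_functional U I \<longleftrightarrow> (\<exists>G R.
     (\<forall>u\<in>field_space U. has_variational_derivative I u (G u) \<and> (\<forall>x. \<bar>x\<bar> > R \<longrightarrow> G u x = 0)) \<and>
     (\<forall>u\<in>field_space U. \<forall>\<xi>\<in>variations. \<forall>\<zeta>\<in>variations.
        smooth_on {(s::real, t::real, x::real). (\<lambda>y. u y + s *\<^sub>R \<xi> y + t *\<^sub>R \<zeta> y) \<in> field_space U}
          (\<lambda>(s, t, x). G (\<lambda>y. u y + s *\<^sub>R \<xi> y + t *\<^sub>R \<zeta> y) x)))"

subsection \<open>Hamiltonian operators\<close>

text \<open>An operator \<open>P\<close> sends a field \<open>u\<close> and a covector field \<open>q\<close> to \<open>P\<^sup>i\<^sup>j[u] q\<^sub>j\<close>.\<close>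

type_synonym 'n operator = "'n field \<Rightarrow> 'n field \<Rightarrow> 'n field"

definition bracket :: "('n::finite) operator \<Rightarrow> 'n functional \<Rightarrow> 'n functional \<Rightarrow> 'n functional" where
  "bracket P I J u =
     integral UNIV (\<lambda>x. variational_derivative I u x \<bullet> P u (variational_derivative J u) x)"

definition hamiltonian :: "(real^'n::finite) set \<Rightarrow> 'n operator \<Rightarrow> bool" where
  "hamiltonian U P \<longleftrightarrow>
     (\<forall>I J u. smooth_functional U I \<and> smooth_functional U J \<and> u \<in> field_space U \<longrightarrow>
        bracket P I J u = - bracket P J I u \<and>
        (\<exists>p. has_variational_derivative (bracket P I J) u p)) \<and>
     (\<forall>I J K u. smooth_functional U I \<and> smooth_functional U J \<and> smooth_functional U K \<and>
        u \<in> field_space U \<longrightarrow>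
        bracket P (bracket P I J) K u + bracket P (bracket P J K) I u
          + bracket P (bracket P K I) J u = 0)"

definition compatible :: "(real^'n::finite) set \<Rightarrow> 'n operator \<Rightarrow> 'n operator \<Rightarrow> bool" where
  "compatible U P Q \<longleftrightarrow>
     (\<forall>a b. hamiltonian U (\<lambda>u q x. a *\<^sub>R P u q x + b *\<^sub>R Q u q x))"

subsection \<open>Nonlocal operators of hydrodynamic type\<close>

text \<open>The coefficients of
  \<open>g\<^sup>i\<^sup>j d/dx + b\<^sup>i\<^sup>j\<^sub>k u\<^sup>k\<^sub>x + \<Sum>\<^sub>\<alpha> \<epsilon>\<^sub>\<alpha> (w\<^sup>\<alpha>)\<^sup>i\<^sub>k u\<^sup>k\<^sub>x (d/dx)\<^sup>-\<^sup>1 (w\<^sup>\<alpha>)\<^sup>j\<^sub>s u\<^sup>s\<^sub>x\<close>, \<open>1 \<le> \<alpha> \<le> L\<close>, as functions of \<open>u\<close>;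
  \<open>connection u i j k\<close> is \<open>b\<^sup>i\<^sup>j\<^sub>k\<close> and \<open>affinor \<alpha> u $ i $ k\<close> is \<open>(w\<^sup>\<alpha>)\<^sup>i\<^sub>k\<close>.\<close>

record 'n hydro_operator =
  metric :: "real^'n \<Rightarrow> real^'n^'n"
  connection :: "real^'n \<Rightarrow> 'n \<Rightarrow> 'n \<Rightarrow> 'n \<Rightarrow> real"
  tails :: nat
  tail_sign :: "nat \<Rightarrow> real"
  affinor :: "nat \<Rightarrow> real^'n \<Rightarrow> real^'n^'n"

text \<open>The function \<open>(w\<^sup>\<alpha>)\<^sup>j\<^sub>s u\<^sup>s\<^sub>x q\<^sub>j\<close> to which \<open>(d/dx)\<^sup>-\<^sup>1\<close> is applied.\<close>

definition tail_integrand ::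
    "('n::finite) hydro_operator \<Rightarrow> nat \<Rightarrow> 'n field \<Rightarrow> 'n field \<Rightarrow> real \<Rightarrow> real" where
  "tail_integrand A \<alpha> u q x =
     (\<Sum>j\<in>UNIV. \<Sum>s\<in>UNIV. affinor A \<alpha> (u x) $ j $ s * Dx u x $ s * q x $ j)"

text \<open>The value of the operator when \<open>v \<alpha>\<close> is taken for \<open>(d/dx)\<^sup>-\<^sup>1\<close> of the tail integrand.\<close>

definition apply_with ::
    "('n::finite) hydro_operator \<Rightarrow> (nat \<Rightarrow> real \<Rightarrow> real) \<Rightarrow> 'n operator" where
  "apply_with A v u q x = (\<chi> i.
     (\<Sum>j\<in>UNIV. metric A (u x) $ i $ j * Dx q x $ j)
     + (\<Sum>j\<in>UNIV. \<Sum>k\<in>UNIV. connection A (u x) i j k * Dx u x $ k * q x $ j)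
     + (\<Sum>\<alpha>=1..tails A. tail_sign A \<alpha> *
          (\<Sum>k\<in>UNIV. affinor A \<alpha> (u x) $ i $ k * Dx u x $ k) * v \<alpha> x))"

text \<open>On functions of bounded support the formal inverse \<open>(d/dx)\<^sup>-\<^sup>1\<close> is the skew-adjoint
  antiderivative. It is the only choice of the integration constant that makes the nonlocal
  term of the bracket skew-symmetric.\<close>

definition Dinv :: "(real \<Rightarrow> real) \<Rightarrow> real \<Rightarrow> real" where
  "Dinv f x = (integral {..x} f - integral {x..} f) / 2"

definition operator_of :: "('n::finite) hydro_operator \<Rightarrow> 'n operator" where
  "operator_of A u q = apply_with A (\<lambda>\<alpha>. Dinv (tail_integrand A \<alpha> u q)) u q"

subsection \<open>Bi-Hamiltonian systems of hydrodynamic type\<close>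

text \<open>The formal functional \<open>H = \<integral> h(u) dx\<close>. The integral need not converge, so it is
  represented by its increment \<open>H[v] - H[u]\<close> from a base field \<open>u\<close>, which converges when
  \<open>v - u\<close> is a variation; only variational derivatives of \<open>H\<close> are used.\<close>

definition density_functional :: "(real^'n::finite \<Rightarrow> real) \<Rightarrow> 'n field \<Rightarrow> 'n functional" where
  "density_functional h u v = integral UNIV (\<lambda>x. h (v x) - h (u x))"

text \<open>The system \<open>u\<^sup>i\<^sub>t = (V\<^sup>i(u))\<^sub>x\<close> has the form \<open>u\<^sup>i\<^sub>t = A\<^sup>i\<^sup>j \<delta>H/\<delta>u\<^sup>j\<close> with \<open>H = \<integral> h(u) dx\<close>. Here
  \<open>\<delta>H/\<delta>u\<close> does not have bounded support and \<open>(d/dx)\<^sup>-\<^sup>1\<close> is formal, with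
  \<open>(d/dx)\<^sup>-\<^sup>1(f(u)\<^sub>x) = f(u)\<close>: the tail integrands are required to be \<open>(f \<alpha> (u))\<^sub>x\<close>, and \<open>f\<close>
  records the choice of the integration constants.\<close>

definition hamiltonian_representation ::
    "(real^'n::finite) set \<Rightarrow> (real^'n \<Rightarrow> real^'n) \<Rightarrow> 'n hydro_operator \<Rightarrow>
     (real^'n \<Rightarrow> real) \<Rightarrow> (nat \<Rightarrow> real^'n \<Rightarrow> real) \<Rightarrow> bool" where
  "hamiltonian_representation U V A h f \<longleftrightarrow>
     (\<forall>u\<in>field_space U. \<exists>q. has_variational_derivative (density_functional h u) u q \<and>
        (\<forall>x. q differentiable (at x)) \<and>
        (\<forall>\<alpha>\<in>{1..tails A}. \<forall>x.
           ((\<lambda>y. f \<alpha> (u y)) has_real_derivative tail_integrand A \<alpha> u q x) (at x)) \<and>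
        (\<forall>x. ((\<lambda>y. V (u y)) has_vector_derivative
               apply_with A (\<lambda>\<alpha> y. f \<alpha> (u y)) u q x) (at x)))"

definition bi_hamiltonian ::
    "(real^'n::finite) set \<Rightarrow> (real^'n \<Rightarrow> real^'n) \<Rightarrow>
     'n hydro_operator \<Rightarrow> (real^'n \<Rightarrow> real) \<Rightarrow> (nat \<Rightarrow> real^'n \<Rightarrow> real) \<Rightarrow>
     'n hydro_operator \<Rightarrow> (real^'n \<Rightarrow> real) \<Rightarrow> (nat \<Rightarrow> real^'n \<Rightarrow> real) \<Rightarrow> bool" where
  "bi_hamiltonian U V A1 h1 f1 A2 h2 f2 \<longleftrightarrow>
     hamiltonian U (operator_of A1) \<and> hamiltonian U (operator_of A2) \<and>
     compatible U (operator_of A1) (operator_of A2) \<and>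
     hamiltonian_representation U V A1 h1 f1 \<and> hamiltonian_representation U V A2 h2 f2"

subsection \<open>The canonical pair of operators\<close>

text \<open>\<open>\<eta> $ i $ j\<close> is \<open>\<eta>\<^sup>i\<^sup>j\<close>, and \<open>matrix_inv \<eta> $ i $ j\<close> is \<open>\<eta>\<^sub>i\<^sub>j\<close>.\<close>

definition g_can ::
    "real^'n^'n \<Rightarrow> nat \<Rightarrow> (nat \<Rightarrow> real) \<Rightarrow> ('n \<Rightarrow> real^'n \<Rightarrow> real) \<Rightarrow>
     (nat \<Rightarrow> real^'n \<Rightarrow> real) \<Rightarrow> real^'n::finite \<Rightarrow> real^'n^'n" where
  "g_can \<eta> L \<epsilon> F \<psi> u = (\<chi> i j.
     (\<Sum>s\<in>UNIV. \<eta> $ i $ s * partial s (F j) u) + (\<Sum>s\<in>UNIV. \<eta> $ j $ s * partial s (F i) u)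
     - (\<Sum>s\<in>UNIV. \<Sum>k\<in>UNIV. \<eta> $ i $ s * \<eta> $ j $ k *
          (\<Sum>\<alpha>=1..L. \<epsilon> \<alpha> * partial s (\<psi> \<alpha>) u * partial k (\<psi> \<alpha>) u)))"

definition P1_can ::
    "real^'n^'n \<Rightarrow> nat \<Rightarrow> (nat \<Rightarrow> real) \<Rightarrow> ('n \<Rightarrow> real^'n \<Rightarrow> real) \<Rightarrow>
     (nat \<Rightarrow> real^'n \<Rightarrow> real) \<Rightarrow> ('n::finite) hydro_operator" where
  "P1_can \<eta> L \<epsilon> F \<psi> = \<lparr>
     metric = g_can \<eta> L \<epsilon> F \<psi>,
     connection = (\<lambda>u i j k.
       (\<Sum>s\<in>UNIV. \<eta> $ i $ s * partial s (partial k (F j)) u)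
       - (\<Sum>s\<in>UNIV. \<Sum>p\<in>UNIV. \<eta> $ i $ s * \<eta> $ j $ p *
            (\<Sum>\<alpha>=1..L. \<epsilon> \<alpha> * partial s (partial k (\<psi> \<alpha>)) u * partial p (\<psi> \<alpha>) u))),
     tails = L,
     tail_sign = \<epsilon>,
     affinor = (\<lambda>\<alpha> u. \<chi> i k. \<Sum>p\<in>UNIV. \<eta> $ i $ p * partial p (partial k (\<psi> \<alpha>)) u) \<rparr>"

definition P2_can :: "real^'n^'n \<Rightarrow> ('n::finite) hydro_operator" where
  "P2_can \<eta> = \<lparr> metric = (\<lambda>_. \<eta>), connection = (\<lambda>_ _ _ _. 0),
     tails = 0, tail_sign = (\<lambda>_. 0), affinor = (\<lambda>_ _. 0) \<rparr>"

end

theory Submission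
  imports Defs
begin

text \<open>Write \<open>y = \<eta>q\<^sub>x\<close> and \<open>W\<^sup>\<alpha> = (d/dx)\<^sup>-\<^sup>1(\<partial>\<psi>\<^sup>\<alpha> \<cdot> y)\<close>. Integrating by parts in the
  nonlocal term, \<open>P\<^sub>1 q = \<eta> S u\<^sub>x + g q\<^sub>x\<close>, where \<open>S = q\<^sub>i \<partial>\<^sup>2F\<^sup>i - \<Sum>\<^sub>\<alpha> \<epsilon>\<^sub>\<alpha> W\<^sup>\<alpha> \<partial>\<^sup>2\<psi>\<^sup>\<alpha>\<close> is a combination of
  Hessians, and the bracket of two covector fields becomes
  \<open>\<integral> q\<^sub>i (\<partial>F\<^sup>i \<cdot> y') - q'\<^sub>i (\<partial>F\<^sup>i \<cdot> y) + \<Sum>\<^sub>\<alpha> \<epsilon>\<^sub>\<alpha> (\<partial>\<psi>\<^sup>\<alpha> \<cdot> y) W'\<^sup>\<alpha> dx\<close>, in which \<open>u\<^sub>x\<close> does not occur. Its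
  derivative along \<open>\<xi>\<close> with \<open>q\<close>, \<open>q'\<close> fixed is \<open>\<integral> \<xi> \<cdot> (S y' - S' y) dx\<close>. In the Jacobi identity the
  second variations of the functionals cancel because they are symmetric. What remains is the
  cyclic sum of \<open>(S\<^sub>I y\<^sub>J - S\<^sub>J y\<^sub>I) \<cdot> (\<eta> S\<^sub>K u\<^sub>x + g (q\<^sub>K)\<^sub>x)\<close>, which vanishes at every point: the first system of
  equations says that the \<open>S\<close> commute with respect to \<open>\<eta>\<close>, the second that \<open>\<eta> S g\<close> is symmetric. No
  nondegeneracy of \<open>g\<close> is needed, so the argument applies to the whole pencil \<open>a P\<^sub>1 + b P\<^sub>2\<close>, which is
  the canonical operator of \<open>a F\<^sup>i + b u\<^sup>i / 2\<close>, \<open>\<psi>\<^sup>\<alpha>\<close>, \<open>a \<epsilon>\<^sub>\<alpha>\<close>.\<close>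

section \<open>Calculus of smooth functions\<close>

text \<open>Removing \<open>u_x\<close> from the bracket matters because its derivative along \<xi>
  then contains no derivative of \<xi>: the gradient is read off at once, and the one nonlocal
  leftover integrates to zero because \<open>Dinv\<close> is skew-adjoint. The first obstacle is
  that a Hamiltonian vector field \<open>P q\<close> is in general no variation: beyond the support
  of its argument \<open>Dinv\<close> equals plus or minus half the integral, so \<open>P q\<close>
  does not vanish there. Symmetry of the second variation is therefore applied to vector fields
  multiplied by a cut-off that is 1 on a common support of all gradients involved, and no pairing
  with such a gradient sees the cut-off. The second is that the bracket of two smooth functionals is
  not shown to be a smooth functional again. In the Jacobi identity its gradient is only paired with
  \<open>P\<close> applied to the gradient of a third functional, so an explicit continuous gradient
  suffices. Symmetry of the second variation is Schwarz's theorem for I(u + s \<xi> + t \<zeta>);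
  this is what the two-parameter families in \<open>smooth_functional\<close> are for.\<close>

lemma Ck_on_imp_continuous_on: "Ck_on k S f \<Longrightarrow> continuous_on S f"
  by (cases k) (auto intro: differentiable_imp_continuous_on)

lemma Ck_on_Suc_imp_Ck_on: "Ck_on (Suc k) S f \<Longrightarrow> Ck_on k S f"
proof (induction k arbitrary: f)
  case 0
  then show ?case by (auto intro: differentiable_imp_continuous_on)
next
  case (Suc k)
  show ?case
    unfolding Ck_on.simps(2)[of k]
  proof (intro conjI allI)
    show "f differentiable_on S" using Suc.prems by simp
    fix v
    have "Ck_on (Suc k) S (\<lambda>x. frechet_derivative f (at x) v)"
      using Suc.prems unfolding Ck_on.simps(2)[of "Suc k"] by blast
    then show "Ck_on k S (\<lambda>x. frechet_derivative f (at x) v)" by (rule Suc.IH)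
  qed
qed

lemma Ck_on_subset: "Ck_on k S f \<Longrightarrow> T \<subseteq> S \<Longrightarrow> Ck_on k T f"
  by (induction k arbitrary: f) (auto intro: continuous_on_subset differentiable_on_subset)

lemma Ck_on_has_derivative:
  assumes "open S" "Ck_on (Suc k) S f" "x \<in> S"
  shows "(f has_derivative frechet_derivative f (at x)) (at x)"
  using assms frechet_derivative_works differentiable_on_eq_differentiable_at by fastforce

text \<open>On an open set a derivative depends only on nearby values, so agreement on S passes to
  derivatives of every order.\<close>

lemma Ck_on_cong_imp:
  assumes "open S" "\<And>x. x \<in> S \<Longrightarrow> f x = g x" "Ck_on k S f"
  shows "Ck_on k S g"
  using assms(2,3)
proof (induction k arbitrary: f g)
  case 0
  then show ?case by (simp cong: continuous_on_cong)
next
  case (Suc k)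
  have d: "(g has_derivative frechet_derivative f (at x)) (at x)" if "x \<in> S" for x
    using Ck_on_has_derivative[OF assms(1) Suc.prems(2) that] Suc.prems(1) that assms(1)
    by (metis has_derivative_transform_within_open)
  then have eq: "frechet_derivative f (at x) = frechet_derivative g (at x)" if "x \<in> S" for x
    using that frechet_derivative_at by blast
  show ?case
    unfolding Ck_on.simps
  proof (intro conjI allI)
    show "g differentiable_on S"
      using d assms(1) differentiable_on_eq_differentiable_at differentiable_def by blast
    fix v
    show "Ck_on k S (\<lambda>x. frechet_derivative g (at x) v)"
      using Suc.IH[of "\<lambda>x. frechet_derivative f (at x) v" "\<lambda>x. frechet_derivative g (at x) v"]
        Suc.prems(2) eq by simp
  qed
qed

text \<open>Replaces the chosen \<open>frechet_derivative\<close> by any explicit derivative; the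
  closure properties below are inductions that go through this rule.\<close>

lemma Ck_on_SucI:
  assumes "open S" and d: "\<And>x. x \<in> S \<Longrightarrow> (f has_derivative f' x) (at x)"
    and "\<And>v. Ck_on k S (\<lambda>x. f' x v)"
  shows "Ck_on (Suc k) S f"
  unfolding Ck_on.simps
proof (intro conjI allI)
  show "f differentiable_on S"
    using d assms(1) differentiable_on_eq_differentiable_at differentiable_def by blast
  fix v
  show "Ck_on k S (\<lambda>x. frechet_derivative f (at x) v)"
    by (rule Ck_on_cong_imp[OF assms(1) _ assms(3)[of v]]) (simp add: frechet_derivative_at[OF d, symmetric])
qed

lemma Ck_on_const: "Ck_on k S (\<lambda>x. c)"
  by (induction k arbitrary: c) auto

lemma Ck_on_bounded_linear_compose:
  assumes h: "bounded_linear h" and S: "open S" and "Ck_on k S f"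
  shows "Ck_on k S (\<lambda>x. h (f x))"
  using assms(3)
proof (induction k arbitrary: f)
  case 0
  then show ?case using h by (simp add: bounded_linear.continuous_on)
next
  case (Suc k)
  show ?case
  proof (rule Ck_on_SucI[OF S])
    show "((\<lambda>x. h (f x)) has_derivative (\<lambda>v. h (frechet_derivative f (at x) v))) (at x)" if "x \<in> S" for x
      by (rule bounded_linear.has_derivative[OF h Ck_on_has_derivative[OF S Suc.prems that]])
    show "Ck_on k S (\<lambda>x. h (frechet_derivative f (at x) v))" for v
      by (rule Suc.IH) (use Suc.prems in simp)
  qed
qed

lemma Ck_on_add:
  assumes S: "open S" and "Ck_on k S f" "Ck_on k S g"
  shows "Ck_on k S (\<lambda>x. f x + g x)"
  using assms(2,3)
proof (induction k arbitrary: f g)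
  case 0
  then show ?case by (simp add: continuous_on_add)
next
  case (Suc k)
  show ?case
  proof (rule Ck_on_SucI[OF S])
    show "((\<lambda>x. f x + g x) has_derivative
        (\<lambda>v. frechet_derivative f (at x) v + frechet_derivative g (at x) v)) (at x)" if "x \<in> S" for x
      by (intro has_derivative_add Ck_on_has_derivative[OF S Suc.prems(1) that]
          Ck_on_has_derivative[OF S Suc.prems(2) that])
    show "Ck_on k S (\<lambda>x. frechet_derivative f (at x) v + frechet_derivative g (at x) v)" for v
      by (rule Suc.IH) (use Suc.prems in simp_all)
  qed
qed

lemma Ck_on_sum:
  assumes "open S" "\<And>i. i \<in> I \<Longrightarrow> Ck_on k S (f i)"
  shows "Ck_on k S (\<lambda>x. \<Sum>i\<in>I. f i x)"
  using assms(2) by (induction I rule: infinite_finite_induct) (auto intro: Ck_on_add assms(1) Ck_on_const)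

lemma Ck_on_bounded_bilinear:
  assumes h: "bounded_bilinear h" and S: "open S" and "Ck_on k S f" "Ck_on k S g"
  shows "Ck_on k S (\<lambda>x. h (f x) (g x))"
  using assms(3,4)
proof (induction k arbitrary: f g)
  case 0
  then show ?case using h by (simp add: bounded_bilinear.continuous_on)
next
  case (Suc k)
  show ?case
  proof (rule Ck_on_SucI[OF S])
    show "((\<lambda>x. h (f x) (g x)) has_derivative
        (\<lambda>v. h (f x) (frechet_derivative g (at x) v) + h (frechet_derivative f (at x) v) (g x))) (at x)"
      if "x \<in> S" for x
      by (rule bounded_bilinear.FDERIV[OF h]; rule Ck_on_has_derivative[OF S _ that]; rule Suc.prems)
    show "Ck_on k S (\<lambda>x. h (f x) (frechet_derivative g (at x) v) + h (frechet_derivative f (at x) v) (g x))" for v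
      by (intro Ck_on_add[OF S] Suc.IH Ck_on_Suc_imp_Ck_on[OF Suc.prems(1)] Ck_on_Suc_imp_Ck_on[OF Suc.prems(2)])
        (use Suc.prems in simp_all)
  qed
qed

lemma Ck_on_compose:
  fixes f :: "'a::real_normed_vector \<Rightarrow> 'b::euclidean_space"
    and g :: "'b \<Rightarrow> 'c::real_normed_vector"
  assumes S: "open S" and T: "open T" and "f ` S \<subseteq> T" and "Ck_on k S f" "Ck_on k T g"
  shows "Ck_on k S (\<lambda>x. g (f x))"
  using assms(4-)
proof (induction k arbitrary: g)
  case 0
  then show ?case using assms(3) by (auto intro: continuous_on_compose2)
next
  case (Suc k)
  \<comment> \<open>The chain rule applies g' in the direction f'(x) v, which moves with x, whereas
    \<open>Ck_on\<close> controls derivatives in fixed directions only. Expanding along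
    \<open>Basis\<close> makes the directions constant and puts the dependence on x into scalar
    coefficients.\<close>
  let ?D = "\<lambda>x v. \<Sum>b\<in>Basis. (frechet_derivative f (at x) v \<bullet> b) *\<^sub>R frechet_derivative g (at (f x)) b"
  show ?case
  proof (rule Ck_on_SucI[OF S])
    show "((\<lambda>x. g (f x)) has_derivative ?D x) (at x)" if x: "x \<in> S" for x
    proof -
      have f: "(f has_derivative frechet_derivative f (at x)) (at x)"
        by (rule Ck_on_has_derivative[OF S Suc.prems(1) x])
      have g: "(g has_derivative frechet_derivative g (at (f x))) (at (f x))"
        by (rule Ck_on_has_derivative[OF T Suc.prems(2)]) (use x assms(3) in auto)
      have lin: "linear (frechet_derivative g (at (f x)))"
        using g has_derivative_linear by blast
      have "frechet_derivative g (at (f x)) (frechet_derivative f (at x) v) = ?D x v" for v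
      proof -
        have "frechet_derivative g (at (f x)) (frechet_derivative f (at x) v)
          = frechet_derivative g (at (f x)) (\<Sum>b\<in>Basis. (frechet_derivative f (at x) v \<bullet> b) *\<^sub>R b)"
          by (simp only: euclidean_representation)
        also have "\<dots> = ?D x v"
          by (simp only: linear_sum[OF lin] linear_scale[OF lin])
        finally show ?thesis .
      qed
      then show ?thesis
        using has_derivative_compose[OF f g] by simp
    qed
    show "Ck_on k S (\<lambda>x. ?D x v)" for v
    proof (intro Ck_on_sum[OF S] Ck_on_bounded_bilinear[OF bounded_bilinear_scaleR S])
      fix b :: 'b
      show "Ck_on k S (\<lambda>x. frechet_derivative f (at x) v \<bullet> b)"
        by (rule Ck_on_bounded_linear_compose[OF bounded_linear_inner_left S]) (use Suc.prems in simp)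
      show "Ck_on k S (\<lambda>x. frechet_derivative g (at (f x)) b)"
        by (rule Suc.IH[OF Ck_on_Suc_imp_Ck_on[OF Suc.prems(1)]]) (use Suc.prems in simp)
    qed
  qed
qed

lemma Ck_on_id: "Ck_on k S (\<lambda>x. x)"
proof (cases k)
  case (Suc m)
  then show ?thesis
    by (simp add: Ck_on_const differentiable_on_def)
qed simp

section \<open>Closure properties of smooth functions\<close>

lemma smooth_on_subset: "smooth_on S f \<Longrightarrow> T \<subseteq> S \<Longrightarrow> smooth_on T f"
  unfolding smooth_on_def by (blast intro: Ck_on_subset)

lemma smooth_on_cong_imp:
  "open S \<Longrightarrow> (\<And>x. x \<in> S \<Longrightarrow> f x = g x) \<Longrightarrow> smooth_on S f \<Longrightarrow> smooth_on S g"
  unfolding smooth_on_def by (blast intro: Ck_on_cong_imp)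

lemma smooth_on_imp_continuous_on: "smooth_on S f \<Longrightarrow> continuous_on S f"
  unfolding smooth_on_def by (blast intro: Ck_on_imp_continuous_on)

lemma smooth_on_has_derivative:
  "open S \<Longrightarrow> smooth_on S f \<Longrightarrow> x \<in> S \<Longrightarrow> (f has_derivative frechet_derivative f (at x)) (at x)"
  unfolding smooth_on_def by (blast intro: Ck_on_has_derivative)

lemma smooth_on_frechet_derivative:
  "smooth_on S f \<Longrightarrow> smooth_on S (\<lambda>x. frechet_derivative f (at x) v)"
  unfolding smooth_on_def by (metis Ck_on.simps(2))

lemma smooth_onI:
  assumes "open S" "\<And>x. x \<in> S \<Longrightarrow> (f has_derivative f' x) (at x)" "\<And>v. smooth_on S (\<lambda>x. f' x v)"
  shows "smooth_on S f"
  unfolding smooth_on_def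
proof
  \<comment> \<open>Proving order \<open>Suc k\<close> and dropping one covers k = 0 without a case
    distinction.\<close>
  fix k show "Ck_on k S f"
    by (rule Ck_on_Suc_imp_Ck_on, rule Ck_on_SucI[OF assms(1,2)]) (use assms(3) in \<open>auto simp: smooth_on_def\<close>)
qed

lemma smooth_on_const [intro]: "smooth_on S (\<lambda>x. c)"
  by (simp add: smooth_on_def Ck_on_const)

lemma smooth_on_id [intro]: "smooth_on S (\<lambda>x. x)"
  by (simp add: smooth_on_def Ck_on_id)

lemma smooth_on_Ck_on: "smooth_on S f \<Longrightarrow> Ck_on k S f"
  by (simp add: smooth_on_def)

lemma smooth_on_bounded_linear_compose:
  assumes "bounded_linear h" "open S" "smooth_on S f"
  shows "smooth_on S (\<lambda>x. h (f x))"
  unfolding smooth_on_def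
  by (rule allI, rule Ck_on_bounded_linear_compose[OF assms(1,2)], rule smooth_on_Ck_on[OF assms(3)])

lemma smooth_on_bounded_linear: "bounded_linear h \<Longrightarrow> open S \<Longrightarrow> smooth_on S h"
  by (rule smooth_on_bounded_linear_compose[of h S "\<lambda>x. x"]) (auto simp only: smooth_on_id)

lemma smooth_on_bounded_bilinear:
  assumes "bounded_bilinear h" "open S" "smooth_on S f" "smooth_on S g"
  shows "smooth_on S (\<lambda>x. h (f x) (g x))"
  unfolding smooth_on_def
  by (rule allI, rule Ck_on_bounded_bilinear[OF assms(1,2)])
    (rule smooth_on_Ck_on[OF assms(3)], rule smooth_on_Ck_on[OF assms(4)])

lemmas smooth_on_scaleR = smooth_on_bounded_bilinear[OF bounded_bilinear_scaleR]
  and smooth_on_mult = smooth_on_bounded_bilinear[OF bounded_bilinear_mult]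
  and smooth_on_inner = smooth_on_bounded_bilinear[OF bounded_bilinear_inner]

lemma smooth_on_add:
  assumes "open S" "smooth_on S f" "smooth_on S g"
  shows "smooth_on S (\<lambda>x. f x + g x)"
  unfolding smooth_on_def
  by (rule allI, rule Ck_on_add[OF assms(1)])
    (rule smooth_on_Ck_on[OF assms(2)], rule smooth_on_Ck_on[OF assms(3)])

lemma smooth_on_minus: "open S \<Longrightarrow> smooth_on S f \<Longrightarrow> smooth_on S (\<lambda>x. - f x)"
  by (rule smooth_on_bounded_linear_compose[OF bounded_linear_minus[OF bounded_linear_ident]])

lemma smooth_on_diff:
  "open S \<Longrightarrow> smooth_on S f \<Longrightarrow> smooth_on S g \<Longrightarrow> smooth_on S (\<lambda>x. f x - g x)"
  using smooth_on_add[of S f "\<lambda>x. - g x"] smooth_on_minus[of S g] by simp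

lemma smooth_on_sum:
  assumes "open S" "\<And>i. i \<in> I \<Longrightarrow> smooth_on S (f i)"
  shows "smooth_on S (\<lambda>x. \<Sum>i\<in>I. f i x)"
  unfolding smooth_on_def
  by (rule allI, rule Ck_on_sum[OF assms(1)], rule smooth_on_Ck_on[OF assms(2)])

lemma smooth_on_compose:
  fixes f :: "'a::real_normed_vector \<Rightarrow> 'b::euclidean_space"
  assumes "open S" "open T" "f ` S \<subseteq> T" "smooth_on S f" "smooth_on T g"
  shows "smooth_on S (\<lambda>x. g (f x))"
  unfolding smooth_on_def
proof
  fix k show "Ck_on k S (\<lambda>x. g (f x))"
    by (rule Ck_on_compose[OF assms(1-3)]) (use assms(4,5) in \<open>auto simp only: smooth_on_def\<close>)
qed

lemma smooth_on_vec_nth: "open S \<Longrightarrow> smooth_on S f \<Longrightarrow> smooth_on S (\<lambda>x. f x $ i)"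
  by (rule smooth_on_bounded_linear_compose[OF bounded_linear_vec_nth])

lemma smooth_on_vec_lambda:
  fixes f :: "'a::real_normed_vector \<Rightarrow> 'n::finite \<Rightarrow> real"
  assumes "open S" "\<And>i. smooth_on S (\<lambda>x. f x i)"
  shows "smooth_on S (\<lambda>x. \<chi> i. f x i)"
proof -
  have "(\<chi> i. f x i) = (\<Sum>i\<in>UNIV. f x i *\<^sub>R axis i 1)" for x
    by (simp add: vec_eq_iff axis_def if_distrib cong: if_cong)
  then show ?thesis
    using assms by (auto intro!: smooth_on_sum smooth_on_scaleR)
qed

lemma smooth_on_has_vector_derivative:
  fixes f :: "real \<Rightarrow> 'a::real_normed_vector"
  assumes "open S" "smooth_on S f" "x \<in> S"
  shows "(f has_vector_derivative vector_derivative f (at x)) (at x)"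
  using smooth_on_has_derivative[OF assms] vector_derivative_works differentiable_def by blast

lemma smooth_on_vector_derivative:
  fixes f :: "real \<Rightarrow> 'a::real_normed_vector"
  assumes "open S" "smooth_on S f"
  shows "smooth_on S (\<lambda>x. vector_derivative f (at x))"
proof (rule smooth_on_cong_imp[OF assms(1) _ smooth_on_frechet_derivative[OF assms(2), of 1]])
  fix x assume "x \<in> S"
  then show "frechet_derivative f (at x) 1 = vector_derivative f (at x)"
    using smooth_on_has_derivative[OF assms]
    by (subst frechet_derivative_eq_vector_derivative) (auto simp: differentiable_def)
qed

lemma smooth_on_realI:
  fixes f :: "real \<Rightarrow> 'a::real_normed_vector"
  assumes "open S" "\<And>x. x \<in> S \<Longrightarrow> (f has_vector_derivative f' x) (at x)" "smooth_on S f'"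
  shows "smooth_on S f"
proof (rule smooth_onI[OF assms(1)])
  show "(f has_derivative (\<lambda>v. v *\<^sub>R f' x)) (at x)" if "x \<in> S" for x
    using assms(2)[OF that] by (simp add: has_vector_derivative_def)
  show "smooth_on S (\<lambda>x. v *\<^sub>R f' x)" for v
    by (rule smooth_on_scaleR[OF assms(1) smooth_on_const assms(3)])
qed

lemma smooth_on_Dx: "smooth_on UNIV u \<Longrightarrow> smooth_on UNIV (Dx u)"
  unfolding Dx_def[abs_def] by (rule smooth_on_vector_derivative) auto

lemma has_vector_derivative_Dx: "smooth_on UNIV u \<Longrightarrow> (u has_vector_derivative Dx u x) (at x)"
  unfolding Dx_def by (rule smooth_on_has_vector_derivative) auto

lemma smooth_on_partial: "smooth_on S f \<Longrightarrow> smooth_on S (partial i f)"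
  unfolding partial_def[abs_def] by (rule smooth_on_frechet_derivative)

section \<open>Cut-off functions and the fundamental lemma\<close>

text \<open>The derivative of 1/f is a product of f' with two copies of 1/f, so order k of 1/f
  itself gives order k + 1; f stays fixed in the induction.\<close>

lemma smooth_on_inverse:
  fixes f :: "'a::real_normed_vector \<Rightarrow> real"
  assumes S: "open S" and f: "smooth_on S f" and nz: "\<And>x. x \<in> S \<Longrightarrow> f x \<noteq> 0"
  shows "smooth_on S (\<lambda>x. inverse (f x))"
  unfolding smooth_on_def
proof
  fix k show "Ck_on k S (\<lambda>x. inverse (f x))"
  proof (induction k)
    case 0
    show ?case using nz smooth_on_imp_continuous_on[OF f] by (auto intro!: continuous_intros)
  next
    case (Suc k)
    show ?case
    proof (rule Ck_on_SucI[OF S])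
      show "((\<lambda>x. inverse (f x)) has_derivative
          (\<lambda>v. - (inverse (f x) * frechet_derivative f (at x) v * inverse (f x)))) (at x)" if "x \<in> S" for x
        by (rule Deriv.has_derivative_inverse[OF nz[OF that] smooth_on_has_derivative[OF S f that]])
      show "Ck_on k S (\<lambda>x. - (inverse (f x) * frechet_derivative f (at x) v * inverse (f x)))" for v
        by (rule Ck_on_bounded_linear_compose[OF bounded_linear_minus[OF bounded_linear_ident] S],
            rule Ck_on_bounded_bilinear[OF bounded_bilinear_mult S
              Ck_on_bounded_bilinear[OF bounded_bilinear_mult S Suc.IH
                smooth_on_Ck_on[OF smooth_on_frechet_derivative[OF f]]] Suc.IH])
    qed
  qed
qed

section \<open>Flat functions at the origin and smooth steps\<close>

definition flat :: "nat \<Rightarrow> real \<Rightarrow> real" where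
  "flat k x = (if x > 0 then inverse x ^ k * exp (- inverse x) else 0)"

lemma flat_tendsto_0: "(flat k \<longlongrightarrow> 0) (at_right 0)"
proof -
  have "((\<lambda>x::real. inverse x ^ k / exp (inverse x)) \<longlongrightarrow> 0) (at_right 0)"
    by (rule filterlim_compose[OF tendsto_power_div_exp_0 filterlim_inverse_at_top_right])
  moreover have "\<forall>\<^sub>F x in at_right (0::real). inverse x ^ k / exp (inverse x) = flat k x"
    by (rule eventually_at_rightI[of 0 1]) (auto simp: flat_def exp_minus divide_inverse)
  ultimately show ?thesis by (rule Lim_transform_eventually)
qed

text \<open>The powers of 1/x are included in \<open>flat\<close> so that the family is closed under
  differentiation; smoothness then follows by one induction over all k at once.\<close>

lemma flat_has_real_derivative:
  "(flat k has_real_derivative flat (k + 2) x - k * flat (k + 1) x) (at x)"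
proof (cases x "0::real" rule: linorder_cases)
  case less
  have "((\<lambda>x. 0) has_real_derivative 0) (at x)" by simp
  then have "(flat k has_real_derivative 0) (at x)"
    by (rule has_field_derivative_transform_within_open[of _ _ _ "{..<0}"]) (use less in \<open>auto simp: flat_def\<close>)
  then show ?thesis using less by (simp add: flat_def)
next
  case greater
  have "((\<lambda>x. inverse x ^ k * exp (- inverse x)) has_real_derivative
      flat (k + 2) x - k * flat (k + 1) x) (at x)"
    by (rule DERIV_cong[OF DERIV_mult[OF DERIV_power[OF DERIV_inverse] DERIV_chain2[OF DERIV_exp DERIV_minus[OF DERIV_inverse]]]])
      (use greater in \<open>cases k; simp add: flat_def algebra_simps\<close>)+
  then show ?thesis
    by (rule has_field_derivative_transform_within_open[of _ _ _ "{0<..}"]) (use greater in \<open>auto simp: flat_def\<close>)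
next
  case equal
  \<comment> \<open>To the right of 0 the difference quotient is \<open>flat (Suc k)\<close>; to the
    left it is identically 0.\<close>
  have "((\<lambda>h. (flat k (0 + h) - flat k 0) / h) \<longlongrightarrow> 0) (at_right 0)"
  proof (rule Lim_transform_eventually[OF flat_tendsto_0[of "Suc k"]])
    show "\<forall>\<^sub>F h in at_right 0. flat (Suc k) h = (flat k (0 + h) - flat k 0) / h"
      by (rule eventually_at_rightI[of 0 1]) (auto simp: flat_def field_simps)
  qed
  moreover have "((\<lambda>h. (flat k (0 + h) - flat k 0) / h) \<longlongrightarrow> 0) (at_left 0)"
  proof (rule Lim_transform_eventually[OF tendsto_const[of 0]])
    show "\<forall>\<^sub>F h in at_left 0. 0 = (flat k (0 + h) - flat k 0) / h"
      by (rule eventually_at_leftI[of "-1" 0]) (auto simp: flat_def)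
  qed
  ultimately have "((\<lambda>h. (flat k (0 + h) - flat k 0) / h) \<longlongrightarrow> 0) (at 0)"
    by (simp add: filterlim_at_split)
  then show ?thesis unfolding equal by (simp add: DERIV_def flat_def)
qed

lemma smooth_on_flat: "smooth_on UNIV (flat k)"
  unfolding smooth_on_def
proof
  fix n show "Ck_on n UNIV (flat k)"
  proof (induction n arbitrary: k)
    case 0
    show ?case
      using DERIV_isCont[OF flat_has_real_derivative] by (auto intro!: continuous_at_imp_continuous_on)
  next
    case (Suc n)
    show ?case
    proof (rule Ck_on_SucI[OF open_UNIV])
      show "(flat k has_derivative (\<lambda>v. (flat (k + 2) x + (- real k) * flat (k + 1) x) * v)) (at x)" for x
        using flat_has_real_derivative[of k x] by (simp add: has_field_derivative_def)
      have "Ck_on n UNIV (\<lambda>x. flat (k + 2) x + (- real k) * flat (k + 1) x)"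
        by (rule Ck_on_add[OF open_UNIV Suc.IH],
            rule Ck_on_bounded_bilinear[OF bounded_bilinear_mult open_UNIV Ck_on_const Suc.IH])
      then show "Ck_on n UNIV (\<lambda>x. (flat (k + 2) x + (- real k) * flat (k + 1) x) * v)" for v
        by (rule Ck_on_bounded_bilinear[OF bounded_bilinear_mult open_UNIV _ Ck_on_const])
    qed
  qed
qed

lemma flat_pos: "x > 0 \<Longrightarrow> flat 0 x > 0" and flat_zero: "x \<le> 0 \<Longrightarrow> flat k x = 0"
  and flat_nonneg: "flat 0 x \<ge> 0"
  by (auto simp: flat_def)

lemma smooth_on_flat_affine: "smooth_on UNIV (\<lambda>x. flat k (a + c * x))"
  by (rule smooth_on_compose[OF open_UNIV open_UNIV _ _ smooth_on_flat])
    (auto intro!: smooth_on_add smooth_on_mult)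

lemma exists_cutoff:
  fixes R :: real
  obtains cut :: "real \<Rightarrow> real" where "smooth_on UNIV cut" "\<And>x. \<bar>x\<bar> \<le> R \<Longrightarrow> cut x = 1" "\<And>x. \<bar>x\<bar> > R + 1 \<Longrightarrow> cut x = 0"
proof
  \<comment> \<open>A smooth step: \<open>s c x\<close> is 1 where R + c x \<ge> 0 and 0 where R + 1
    + c x \<le> 0. The product of the steps for c = 1 and c = -1 is the cut-off.\<close>
  define s :: "real \<Rightarrow> real \<Rightarrow> real" where
    "s = (\<lambda>c x. flat 0 (R + 1 + c * x) * inverse (flat 0 (R + 1 + c * x) + flat 0 (- R + (- c) * x)))"
  \<comment> \<open>The two arguments add up to 1, so at least one of them is positive.\<close>
  have pos: "flat 0 (R + 1 + c * x) + flat 0 (- R + (- c) * x) > 0" for c x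
  proof (cases "R + 1 + c * x > 0")
    case True
    then show ?thesis using flat_pos[OF True] flat_nonneg[of "- R + (- c) * x"] by linarith
  next
    case False
    then have *: "- R + (- c) * x > 0" by simp
    show ?thesis using flat_pos[OF *] flat_nonneg[of "R + 1 + c * x"] by linarith
  qed
  have s_smooth: "smooth_on UNIV (s c)" for c
    unfolding s_def
    by (rule smooth_on_mult[OF open_UNIV smooth_on_flat_affine
          smooth_on_inverse[OF open_UNIV smooth_on_add[OF open_UNIV smooth_on_flat_affine smooth_on_flat_affine]
          pos[THEN less_imp_neq, symmetric]]])
  let ?cut = "\<lambda>x. s 1 x * s (- 1) x"
  show "smooth_on UNIV ?cut" by (rule smooth_on_mult[OF open_UNIV s_smooth s_smooth])
  have s1: "s c x = 1" if "R + c * x \<ge> 0" for c x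
    using that pos[of c x] by (simp add: s_def flat_zero)
  show "?cut x = 1" if "\<bar>x\<bar> \<le> R" for x using that by (simp add: s1)
  show "?cut x = 0" if "\<bar>x\<bar> > R + 1" for x
    using that by (cases "x > 0") (auto simp: s_def flat_zero)
qed

section \<open>Integrals of functions of bounded support\<close>

definition supported :: "real \<Rightarrow> (real \<Rightarrow> 'a::zero) \<Rightarrow> bool" where
  "supported R f \<longleftrightarrow> (\<forall>x. R < \<bar>x\<bar> \<longrightarrow> f x = 0)"

lemma supportedD: "supported R f \<Longrightarrow> R < \<bar>x\<bar> \<Longrightarrow> f x = 0"
  by (simp add: supported_def)

lemma supported_mono: "supported R f \<Longrightarrow> R \<le> R' \<Longrightarrow> supported R' f"
  by (auto simp: supported_def)

lemma integral_supported:
  fixes f :: "real \<Rightarrow> 'a::banach"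
  assumes "supported R f"
  shows "integral UNIV f = integral {-R..R} f"
proof -
  have "f = (\<lambda>x. if x \<in> {-R..R} then f x else 0)"
    using supportedD[OF assms] by fastforce
  then show ?thesis using integral_restrict_UNIV[of "{-R..R}" f] by simp
qed

lemma integrable_supported:
  fixes f :: "real \<Rightarrow> 'a::banach"
  assumes "supported R f" "continuous_on UNIV f"
  shows "f integrable_on UNIV"
proof -
  have "f integrable_on {-R..R}"
    using assms(2) by (intro integrable_continuous_real) (blast intro: continuous_on_subset)
  moreover have "(\<lambda>x. if x \<in> {-R..R} then f x else 0) = f"
    using supportedD[OF assms(1)] by fastforce
  ultimately show ?thesis using integrable_restrict_UNIV[of "{-R..R}" f] by simp
qed

lemma integral_derivative_supported:
  fixes h :: "real \<Rightarrow> real"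
  assumes "supported R h" "\<And>x. (h has_real_derivative h' x) (at x)"
  shows "integral UNIV h' = 0"
proof -
  \<comment> \<open>R may be negative, and \<open>supported R\<close> speaks only about points
    strictly beyond R; the enlarged interval is nonempty and h vanishes at both of its ends.\<close>
  let ?R = "\<bar>R\<bar> + 1"
  have "h' x = 0" if "R < \<bar>x\<bar>" for x
  proof -
    have "open {y. R < \<bar>y\<bar>}" by (intro open_Collect_less continuous_intros)
    then have "((\<lambda>_. 0) has_real_derivative h' x) (at x)"
      using that supportedD[OF assms(1)]
      by (intro has_field_derivative_transform_within_open[OF assms(2), where S = "{y. R < \<bar>y\<bar>}"]) auto
    then show ?thesis using DERIV_const DERIV_unique by blast
  qed
  then have "supported ?R h'" by (auto simp: supported_def)
  then have "integral UNIV h' = integral {-?R..?R} h'" by (rule integral_supported)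
  also have "(h' has_integral (h ?R - h (- ?R))) {-?R..?R}"
    by (rule fundamental_theorem_of_calculus)
      (use assms(2) in \<open>auto simp: has_real_derivative_iff_has_vector_derivative intro: has_vector_derivative_at_within\<close>)
  then have "integral {-?R..?R} h' = h ?R - h (- ?R)" by (rule integral_unique)
  also have "\<dots> = 0" using supportedD[OF assms(1)] by simp
  finally show ?thesis .
qed

section \<open>Test variations and uniqueness of the variational derivative\<close>

lemma variations_supportedE:
  assumes "\<xi> \<in> variations"
  obtains R where "R > 0" "supported R \<xi>"
proof -
  obtain R where R: "\<And>x. \<bar>x\<bar> > R \<Longrightarrow> \<xi> x = 0" using assms unfolding variations_def by blast
  show ?thesis by (rule that[of "\<bar>R\<bar> + 1"]) (use R in \<open>auto simp: supported_def\<close>)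
qed

lemma variationsI: "smooth_on UNIV \<xi> \<Longrightarrow> supported R \<xi> \<Longrightarrow> \<xi> \<in> variations"
  unfolding variations_def supported_def by blast

lemma variations_smooth: "\<xi> \<in> variations \<Longrightarrow> smooth_on UNIV \<xi>"
  unfolding variations_def by blast

text \<open>If p x were nonzero, p would be tested against b(y) p(x), with b a bump on a
  neighbourhood of x in which p(y) has positive inner product with p(x).\<close>

lemma fundamental_lemma_variations:
  fixes p :: "real \<Rightarrow> real^'n::finite"
  assumes p: "continuous_on UNIV p" and z: "\<And>\<xi>. \<xi> \<in> variations \<Longrightarrow> integral UNIV (\<lambda>x. p x \<bullet> \<xi> x) = 0"
  shows "p x = 0"
proof (rule ccontr)
  assume nz: "p x \<noteq> 0"
  define \<phi> where "\<phi> y = p y \<bullet> p x" for y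
  have c: "continuous_on UNIV \<phi>" unfolding \<phi>_def by (intro continuous_intros p)
  have pos: "\<phi> x > 0" using nz by (simp add: \<phi>_def)
  have "isCont \<phi> x" using c by (simp add: continuous_on_eq_continuous_at)
  then obtain d where d: "d > 0" "\<And>y. \<bar>y - x\<bar> < d \<Longrightarrow> \<bar>\<phi> y - \<phi> x\<bar> < \<phi> x"
    using pos unfolding continuous_at_eps_delta dist_real_def by blast
  have phi: "\<phi> y > 0" if "\<bar>y - x\<bar> < d" for y using d(2)[OF that] by linarith
  \<comment> \<open>Positive exactly for \<bar>y - x\<bar> < d: each factor cuts off one
    side.\<close>
  define b where "b y = flat 0 ((d - x) + 1 * y) * flat 0 ((d + x) + (- 1) * y)" for y
  have b: "smooth_on UNIV b" unfolding b_def by (intro smooth_on_mult smooth_on_flat_affine open_UNIV)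
  have b0: "b y = 0" if "\<bar>y - x\<bar> \<ge> d" for y
    using that by (cases "y \<ge> x") (auto simp: b_def flat_zero)
  have bnn: "b y \<ge> 0" for y by (simp add: b_def flat_nonneg)
  let ?\<xi> = "\<lambda>y. b y *\<^sub>R p x"
  let ?R = "\<bar>x\<bar> + d"
  have "supported ?R ?\<xi>" by (auto simp: supported_def intro!: b0)
  moreover have "smooth_on UNIV ?\<xi>" by (rule smooth_on_scaleR[OF open_UNIV b smooth_on_const])
  ultimately have "integral UNIV (\<lambda>y. p y \<bullet> ?\<xi> y) = 0" by (intro z variationsI)
  then have "integral UNIV (\<lambda>y. b y * \<phi> y) = 0" by (simp add: \<phi>_def)
  moreover have "supported ?R (\<lambda>y. b y * \<phi> y)" by (auto simp: supported_def intro!: b0)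
  ultimately have "integral {-?R..?R} (\<lambda>y. b y * \<phi> y) = 0" by (simp add: integral_supported)
  moreover have "b y * \<phi> y \<ge> 0" for y
  proof (cases "\<bar>y - x\<bar> < d")
    case True then show ?thesis using bnn[of y] phi[OF True] by simp
  qed (simp add: b0)
  moreover have "continuous_on {-?R..?R} (\<lambda>y. b y * \<phi> y)"
    by (rule continuous_on_subset[OF continuous_on_mult[OF smooth_on_imp_continuous_on[OF b] c]]) simp
  ultimately have "\<forall>y\<in>{-?R..?R}. b y * \<phi> y = 0"
    using integral_eq_0_iff[of "-?R" ?R "\<lambda>y. b y * \<phi> y"] d(1) by auto
  moreover have "x \<in> {-?R..?R}" using d(1) by auto
  ultimately have "b x * \<phi> x = 0" by blast
  then have "b x = 0" using pos by simp
  moreover have "b x > 0" using d(1) by (simp add: b_def flat_pos)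
  ultimately show False by simp
qed

text \<open>This gives the \<open>THE\<close> in \<open>variational_derivative\<close> its value:
  any gradient that can be exhibited is the gradient.\<close>

lemma has_variational_derivative_unique:
  assumes "has_variational_derivative I u p" "has_variational_derivative I u q"
  shows "p = q"
proof
  fix x
  have cp: "continuous_on UNIV p" and cq: "continuous_on UNIV q"
    using assms by (auto simp: has_variational_derivative_def)
  have "p x - q x = 0"
  proof (rule fundamental_lemma_variations[of "\<lambda>x. p x - q x"])
    show "continuous_on UNIV (\<lambda>x. p x - q x)" by (intro continuous_intros cp cq)
    fix \<xi> :: "real \<Rightarrow> real^'a" assume \<xi>: "\<xi> \<in> variations"
    obtain R where R: "supported R \<xi>" using variations_supportedE[OF \<xi>] .
    have c\<xi>: "continuous_on UNIV \<xi>" by (rule smooth_on_imp_continuous_on[OF variations_smooth[OF \<xi>]])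
    have "integral UNIV (\<lambda>x. p x \<bullet> \<xi> x) = integral UNIV (\<lambda>x. q x \<bullet> \<xi> x)"
      using assms \<xi> DERIV_unique unfolding has_variational_derivative_def by blast
    moreover have "(\<lambda>x. r x \<bullet> \<xi> x) integrable_on UNIV" if "continuous_on UNIV r" for r
      by (rule integrable_supported[of R]) (use R in \<open>auto simp: supported_def intro!: continuous_intros that c\<xi>\<close>)
    ultimately show "integral UNIV (\<lambda>x. (p x - q x) \<bullet> \<xi> x) = 0"
      using cp cq by (simp add: inner_diff_left integral_diff)
  qed
  then show "p x = q x" by simp
qed

lemma variational_derivative_eq:
  "has_variational_derivative I u p \<Longrightarrow> variational_derivative I u = p"
  unfolding variational_derivative_def by (blast intro: has_variational_derivative_unique)

section \<open>Mixed partial derivatives, parameter integrals and the skew-adjoint antiderivative\<close>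

text \<open>Schwarz's theorem with all partial derivatives named explicitly, so that it serves both
  functions on a normed space and functionals on a two-parameter family of fields. The double
  difference over a small square is evaluated by the mean value theorem twice, in either
  order.\<close>

lemma mixed_partials_eq:
  fixes \<phi> a b c d :: "real \<Rightarrow> real \<Rightarrow> real"
  assumes \<delta>: "\<delta> > 0"
    and a: "\<And>s t. \<bar>s\<bar> < \<delta> \<Longrightarrow> \<bar>t\<bar> < \<delta> \<Longrightarrow> ((\<lambda>s. \<phi> s t) has_real_derivative a s t) (at s)"
    and b: "\<And>s t. \<bar>s\<bar> < \<delta> \<Longrightarrow> \<bar>t\<bar> < \<delta> \<Longrightarrow> ((\<lambda>t. \<phi> s t) has_real_derivative b s t) (at t)"
    and c: "\<And>s t. \<bar>s\<bar> < \<delta> \<Longrightarrow> \<bar>t\<bar> < \<delta> \<Longrightarrow> ((\<lambda>t. a s t) has_real_derivative c s t) (at t)"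
    and d: "\<And>s t. \<bar>s\<bar> < \<delta> \<Longrightarrow> \<bar>t\<bar> < \<delta> \<Longrightarrow> ((\<lambda>s. b s t) has_real_derivative d s t) (at s)"
    and cc: "isCont (\<lambda>(s, t). c s t) (0, 0)" and dc: "isCont (\<lambda>(s, t). d s t) (0, 0)"
  shows "c 0 0 = d 0 0"
proof (rule ccontr)
  assume ne: "c 0 0 \<noteq> d 0 0"
  \<comment> \<open>Half the gap: two equal numbers cannot lie within e of \<open>c 0 0\<close> and
    of \<open>d 0 0\<close> respectively.\<close>
  define e where "e = \<bar>c 0 0 - d 0 0\<bar> / 2"
  have e: "e > 0" using ne by (simp add: e_def)
  obtain r1 where r1: "r1 > 0" "\<And>p. dist p (0, 0) < r1 \<Longrightarrow> dist ((\<lambda>(s, t). c s t) p) (c 0 0) < e"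
    using cc e unfolding continuous_at_eps_delta by (metis case_prod_conv)
  obtain r2 where r2: "r2 > 0" "\<And>p. dist p (0, 0) < r2 \<Longrightarrow> dist ((\<lambda>(s, t). d s t) p) (d 0 0) < e"
    using dc e unfolding continuous_at_eps_delta by (metis case_prod_conv)
  \<comment> \<open>The square of side h stays in the domain, and its interior points have distance
    less than 2 h from the origin, hence lie in both continuity balls.\<close>
  define h where "h = min (\<delta> / 2) (min (r1 / 2) (r2 / 2))"
  have h: "h > 0" "h < \<delta>" "2 * h \<le> r1" "2 * h \<le> r2"
    using \<delta> r1(1) r2(1) by (auto simp: h_def)
  have near: "dist (s, t) (0, 0::real) < 2 * h" if "0 < s" "s < h" "0 < t" "t < h" for s t :: real
  proof -
    have "dist (s, t) (0, 0) \<le> \<bar>s\<bar> + \<bar>t\<bar>"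
      using norm_Pair_le[of s t] by (simp add: dist_norm)
    then show ?thesis using that by linarith
  qed
  obtain \<sigma> where \<sigma>: "0 < \<sigma>" "\<sigma> < h"
    "(\<phi> h h - \<phi> h 0) - (\<phi> 0 h - \<phi> 0 0) = (h - 0) * (a \<sigma> h - a \<sigma> 0)"
  proof -
    have "\<exists>z>0. z < h \<and> (\<lambda>s. \<phi> s h - \<phi> s 0) h - (\<lambda>s. \<phi> s h - \<phi> s 0) 0 = (h - 0) * (a z h - a z 0)"
      using h by (intro MVT2) (auto intro!: DERIV_diff a)
    then show ?thesis using that by blast
  qed
  obtain \<tau> where \<tau>: "0 < \<tau>" "\<tau> < h" "a \<sigma> h - a \<sigma> 0 = (h - 0) * c \<sigma> \<tau>"
  proof -
    have "\<exists>z>0. z < h \<and> a \<sigma> h - a \<sigma> 0 = (h - 0) * c \<sigma> z"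
      using h \<sigma> by (intro MVT2) (auto intro!: c)
    then show ?thesis using that by blast
  qed
  obtain \<tau>' where \<tau>': "0 < \<tau>'" "\<tau>' < h"
    "(\<phi> h h - \<phi> 0 h) - (\<phi> h 0 - \<phi> 0 0) = (h - 0) * (b h \<tau>' - b 0 \<tau>')"
  proof -
    have "\<exists>z>0. z < h \<and> (\<lambda>t. \<phi> h t - \<phi> 0 t) h - (\<lambda>t. \<phi> h t - \<phi> 0 t) 0 = (h - 0) * (b h z - b 0 z)"
      using h by (intro MVT2) (auto intro!: DERIV_diff b)
    then show ?thesis using that by blast
  qed
  obtain \<sigma>' where \<sigma>': "0 < \<sigma>'" "\<sigma>' < h" "b h \<tau>' - b 0 \<tau>' = (h - 0) * d \<sigma>' \<tau>'"
  proof -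
    have "\<exists>z>0. z < h \<and> b h \<tau>' - b 0 \<tau>' = (h - 0) * d z \<tau>'"
      using h \<tau>' by (intro MVT2) (auto intro!: d)
    then show ?thesis using that by blast
  qed
  have "(\<phi> h h - \<phi> h 0) - (\<phi> 0 h - \<phi> 0 0) = h * (h * c \<sigma> \<tau>)"
    using \<sigma>(3) \<tau>(3) by simp
  moreover have "(\<phi> h h - \<phi> 0 h) - (\<phi> h 0 - \<phi> 0 0) = h * (h * d \<sigma>' \<tau>')"
    using \<tau>'(3) \<sigma>'(3) by simp
  ultimately have "h * (h * c \<sigma> \<tau>) = h * (h * d \<sigma>' \<tau>')" by linarith
  then have "c \<sigma> \<tau> = d \<sigma>' \<tau>'" using h(1) by simp
  moreover have "\<bar>c \<sigma> \<tau> - c 0 0\<bar> < e"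
    using r1(2)[of "(\<sigma>, \<tau>)"] near[OF \<sigma>(1,2) \<tau>(1,2)] h by (simp add: dist_real_def)
  moreover have "\<bar>d \<sigma>' \<tau>' - d 0 0\<bar> < e"
    using r2(2)[of "(\<sigma>', \<tau>')"] near[OF \<sigma>'(1,2) \<tau>'(1,2)] h by (simp add: dist_real_def)
  ultimately show False unfolding e_def by (simp add: abs_if field_simps split: if_splits)
qed

lemma second_derivative_symmetric_real:
  fixes f :: "'a::real_normed_vector \<Rightarrow> real"
  assumes S: "open S" and f: "smooth_on S f" and z: "z \<in> S"
  shows "frechet_derivative (\<lambda>x. frechet_derivative f (at x) v) (at z) w
       = frechet_derivative (\<lambda>x. frechet_derivative f (at x) w) (at z) v"
proof -
  obtain e where e: "e > 0" "ball z e \<subseteq> S" using S z openE by blast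
  \<comment> \<open>The summand 1 keeps the denominator positive when v = w = 0 and makes the
    estimate strict.\<close>
  define \<delta> where "\<delta> = e / (norm v + norm w + 1)"
  have pos: "norm v + norm w + 1 > 0" using norm_ge_zero[of v] norm_ge_zero[of w] by linarith
  have \<delta>: "\<delta> > 0" using e(1) pos by (simp add: \<delta>_def)
  have inS: "z + s *\<^sub>R v + t *\<^sub>R w \<in> S" if "\<bar>s\<bar> < \<delta>" "\<bar>t\<bar> < \<delta>" for s t
  proof -
    have "norm (s *\<^sub>R v + t *\<^sub>R w) \<le> \<bar>s\<bar> * norm v + \<bar>t\<bar> * norm w"
      by (metis norm_scaleR norm_triangle_ineq)
    also have "\<dots> \<le> \<delta> * norm v + \<delta> * norm w"
      using that by (intro add_mono mult_right_mono) auto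
    also have "\<dots> < \<delta> * (norm v + norm w + 1)" using \<delta> by (simp add: algebra_simps)
    also have "\<dots> = e" using pos by (simp add: \<delta>_def)
    finally have "dist (z + s *\<^sub>R v + t *\<^sub>R w) z < e" by (simp add: dist_norm add.assoc)
    then show ?thesis using e(2) by (auto simp: dist_commute)
  qed
  let ?D = "\<lambda>f v x. frechet_derivative f (at x) v"
  have ds: "((\<lambda>s. g (z + s *\<^sub>R v + t *\<^sub>R w)) has_real_derivative ?D g v (z + s *\<^sub>R v + t *\<^sub>R w)) (at s)"
    and dt: "((\<lambda>t. g (z + s *\<^sub>R v + t *\<^sub>R w)) has_real_derivative ?D g w (z + s *\<^sub>R v + t *\<^sub>R w)) (at t)"
    if g: "smooth_on S g" and st: "\<bar>s\<bar> < \<delta>" "\<bar>t\<bar> < \<delta>" for g :: "'a \<Rightarrow> real" and s t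
  proof -
    note D = smooth_on_has_derivative[OF S g inS[OF st]]
    have lin: "linear (frechet_derivative g (at (z + s *\<^sub>R v + t *\<^sub>R w)))"
      using D has_derivative_linear by blast
    have "((\<lambda>s. z + s *\<^sub>R v + t *\<^sub>R w) has_derivative (\<lambda>h. h *\<^sub>R v)) (at s)"
      by (auto intro!: derivative_eq_intros)
    from has_derivative_compose[OF this D]
    show "((\<lambda>s. g (z + s *\<^sub>R v + t *\<^sub>R w)) has_real_derivative ?D g v (z + s *\<^sub>R v + t *\<^sub>R w)) (at s)"
      by (simp add: has_field_derivative_def linear_scale[OF lin] mult_commute_abs)
    have "((\<lambda>t. z + s *\<^sub>R v + t *\<^sub>R w) has_derivative (\<lambda>h. h *\<^sub>R w)) (at t)"
      by (auto intro!: derivative_eq_intros)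
    from has_derivative_compose[OF this D]
    show "((\<lambda>t. g (z + s *\<^sub>R v + t *\<^sub>R w)) has_real_derivative ?D g w (z + s *\<^sub>R v + t *\<^sub>R w)) (at t)"
      by (simp add: has_field_derivative_def linear_scale[OF lin] mult_commute_abs)
  qed
  have cont: "isCont (\<lambda>(s, t). g (z + s *\<^sub>R v + t *\<^sub>R w)) (0, 0)" if g: "smooth_on S g" for g :: "'a \<Rightarrow> real"
  proof -
    have "isCont g z" using smooth_on_imp_continuous_on[OF g] S z continuous_on_eq_continuous_at by blast
    then have "isCont g (case (0, 0) of (s, t) \<Rightarrow> z + s *\<^sub>R v + t *\<^sub>R w)" by simp
    moreover have "isCont (\<lambda>(s, t). z + s *\<^sub>R v + t *\<^sub>R w) (0, 0)"
      unfolding split_beta by (intro continuous_intros)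
    ultimately show ?thesis using isCont_o2[of "(0,0)" "\<lambda>(s, t). z + s *\<^sub>R v + t *\<^sub>R w" g]
      by (simp add: case_prod_beta')
  qed
  have "?D (?D f v) w (z + 0 *\<^sub>R v + 0 *\<^sub>R w) = ?D (?D f w) v (z + 0 *\<^sub>R v + 0 *\<^sub>R w)"
  proof (rule mixed_partials_eq[OF \<delta>, where \<phi> = "\<lambda>s t. f (z + s *\<^sub>R v + t *\<^sub>R w)"
        and a = "\<lambda>s t. ?D f v (z + s *\<^sub>R v + t *\<^sub>R w)" and b = "\<lambda>s t. ?D f w (z + s *\<^sub>R v + t *\<^sub>R w)"
        and c = "\<lambda>s t. ?D (?D f v) w (z + s *\<^sub>R v + t *\<^sub>R w)" and d = "\<lambda>s t. ?D (?D f w) v (z + s *\<^sub>R v + t *\<^sub>R w)"])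
    fix s t :: real assume st: "\<bar>s\<bar> < \<delta>" "\<bar>t\<bar> < \<delta>"
    show "((\<lambda>s. f (z + s *\<^sub>R v + t *\<^sub>R w)) has_real_derivative ?D f v (z + s *\<^sub>R v + t *\<^sub>R w)) (at s)"
      by (rule ds[OF f st])
    show "((\<lambda>t. f (z + s *\<^sub>R v + t *\<^sub>R w)) has_real_derivative ?D f w (z + s *\<^sub>R v + t *\<^sub>R w)) (at t)"
      by (rule dt[OF f st])
    show "((\<lambda>t. ?D f v (z + s *\<^sub>R v + t *\<^sub>R w)) has_real_derivative ?D (?D f v) w (z + s *\<^sub>R v + t *\<^sub>R w)) (at t)"
      by (rule dt[OF smooth_on_frechet_derivative[OF f] st])
    show "((\<lambda>s. ?D f w (z + s *\<^sub>R v + t *\<^sub>R w)) has_real_derivative ?D (?D f w) v (z + s *\<^sub>R v + t *\<^sub>R w)) (at s)"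
      by (rule ds[OF smooth_on_frechet_derivative[OF f] st])
  next
    show "isCont (\<lambda>(s, t). ?D (?D f v) w (z + s *\<^sub>R v + t *\<^sub>R w)) (0, 0)"
      by (rule cont[OF smooth_on_frechet_derivative[OF smooth_on_frechet_derivative[OF f]]])
    show "isCont (\<lambda>(s, t). ?D (?D f w) v (z + s *\<^sub>R v + t *\<^sub>R w)) (0, 0)"
      by (rule cont[OF smooth_on_frechet_derivative[OF smooth_on_frechet_derivative[OF f]]])
  qed
  then show ?thesis by simp
qed

text \<open>Follows from the real case, because both derivatives commute with taking a component
  along a basis vector.\<close>

lemma second_derivative_symmetric:
  fixes f :: "'a::real_normed_vector \<Rightarrow> 'b::euclidean_space"
  assumes S: "open S" and f: "smooth_on S f" and z: "z \<in> S"
  shows "frechet_derivative (\<lambda>x. frechet_derivative f (at x) v) (at z) w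
       = frechet_derivative (\<lambda>x. frechet_derivative f (at x) w) (at z) v"
proof (rule euclidean_eqI)
  fix b :: 'b
  have D: "frechet_derivative (\<lambda>x. g x \<bullet> b) (at x) = (\<lambda>v. frechet_derivative g (at x) v \<bullet> b)"
    if "smooth_on S g" "x \<in> S" for g :: "'a \<Rightarrow> 'b" and x
    by (rule frechet_derivative_at[symmetric])
      (rule bounded_linear.has_derivative[OF bounded_linear_inner_left smooth_on_has_derivative[OF S that]])
  have D2: "frechet_derivative (\<lambda>x. frechet_derivative (\<lambda>x. f x \<bullet> b) (at x) v) (at z) w
      = frechet_derivative (\<lambda>x. frechet_derivative f (at x) v) (at z) w \<bullet> b" for v w
  proof -
    have eq: "frechet_derivative (\<lambda>x. frechet_derivative f (at x) v \<bullet> b) (at z)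
        = frechet_derivative (\<lambda>x. frechet_derivative (\<lambda>x. f x \<bullet> b) (at x) v) (at z)"
    proof (rule frechet_derivative_transform_within_open[OF _ S z])
      show "(\<lambda>x. frechet_derivative f (at x) v \<bullet> b) differentiable at z"
        using smooth_on_has_derivative[OF S smooth_on_inner[OF S smooth_on_frechet_derivative[OF f] smooth_on_const] z]
        by (rule differentiableI)
    qed (simp add: D[OF f])
    show ?thesis unfolding eq[symmetric] by (simp add: D[OF smooth_on_frechet_derivative[OF f] z])
  qed
  show "frechet_derivative (\<lambda>x. frechet_derivative f (at x) v) (at z) w \<bullet> b
       = frechet_derivative (\<lambda>x. frechet_derivative f (at x) w) (at z) v \<bullet> b"
    using second_derivative_symmetric_real[OF S smooth_on_inner[OF S f smooth_on_const[of S b]] z]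
    by (simp add: D2)
qed

lemma partial_commute:
  fixes f :: "real^'n::finite \<Rightarrow> real"
  assumes "open S" "smooth_on S f" "z \<in> S"
  shows "partial i (partial j f) z = partial j (partial i f) z"
  using second_derivative_symmetric[OF assms, of "axis j 1" "axis i 1"]
  by (simp add: partial_def[abs_def])

section \<open>Differentiation under the integral sign\<close>

lemma continuous_on_slice:
  assumes "continuous_on (S \<times> T) (\<lambda>(s, x). h s x)" "s \<in> S"
  shows "continuous_on T (h s)"
proof -
  have "continuous_on T (\<lambda>x. case (s, x) of (s, x) \<Rightarrow> h s x)"
    by (rule continuous_on_compose2[OF assms(1)]) (use assms(2) in \<open>auto intro!: continuous_intros\<close>)
  then show ?thesis by simp
qed

text \<open>A support radius R independent of s replaces the line by one compact interval, where
  continuity of the derivative in (s, x) is enough.\<close>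

lemma leibniz_rule_supported:
  fixes k k' :: "real \<Rightarrow> real \<Rightarrow> real"
  assumes s0: "\<bar>s0\<bar> < \<delta>"
    and d: "\<And>s x. \<bar>s\<bar> < \<delta> \<Longrightarrow> \<bar>x\<bar> \<le> R \<Longrightarrow> ((\<lambda>s. k s x) has_real_derivative k' s x) (at s)"
    and c: "\<And>s. \<bar>s\<bar> < \<delta> \<Longrightarrow> continuous_on {-R..R} (k s)"
    and c': "continuous_on ({-\<delta><..<\<delta>} \<times> {-R..R}) (\<lambda>(s, x). k' s x)"
    and s: "\<And>s. \<bar>s\<bar> < \<delta> \<Longrightarrow> supported R (k s)" and s': "supported R (k' s0)"
  shows "((\<lambda>s. integral UNIV (k s)) has_real_derivative integral UNIV (k' s0)) (at s0)"
proof -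
  let ?U = "{-\<delta><..<\<delta>}"
  have mem: "s \<in> ?U \<longleftrightarrow> \<bar>s\<bar> < \<delta>" for s
    unfolding greaterThanLessThan_iff abs_less_iff by linarith
  have "((\<lambda>s. integral (cbox (-R) R) (k s)) has_real_derivative integral (cbox (-R) R) (k' s0)) (at s0 within ?U)"
  proof (rule leibniz_rule_field_derivative[where fx = k'])
    show "((\<lambda>s. k s x) has_real_derivative k' s x) (at s within ?U)" if "s \<in> ?U" "x \<in> cbox (-R) R" for s x
      using that by (auto intro: has_field_derivative_at_within[OF d])
    show "k s integrable_on cbox (-R) R" if "s \<in> ?U" for s
      using c[of s] that mem by (intro integrable_continuous) simp
    show "continuous_on (?U \<times> cbox (-R) R) (\<lambda>(s, x). k' s x)" using c' by simp
    show "s0 \<in> ?U" using s0 mem by blast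
  qed (rule convex_real_interval)
  then have "((\<lambda>s. integral {-R..R} (k s)) has_real_derivative integral {-R..R} (k' s0)) (at s0)"
    using s0 mem at_within_open[of s0 ?U] by simp
  then have "((\<lambda>s. integral UNIV (k s)) has_real_derivative integral {-R..R} (k' s0)) (at s0)"
    by (rule has_field_derivative_transform_within_open[of _ _ _ ?U])
      (use s0 mem integral_supported[OF s] in auto)
  then show ?thesis by (simp add: integral_supported[OF s'])
qed

text \<open>With A the antiderivative that vanishes far to the left, \<open>Dinv f\<close> is A
  minus half of its total increment. Any window [-b, b] containing the support and x may be used, so
  several functions can share one.\<close>

lemma Dinv_eq:
  assumes s: "supported R f" and c: "continuous_on UNIV f" and x: "R \<le> b" "-b \<le> x" "x \<le> b"
  shows "Dinv f x = integral {-b..x} f - integral {-b..b} f / 2"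
proof -
  have z: "f y = 0" if "y < -b \<or> b < y" for y using that x(1) supportedD[OF s, of y] by linarith
  have "integral {..x} f = integral UNIV (\<lambda>y. if y \<in> {..x} then f y else 0)"
    by (rule integral_restrict_UNIV[symmetric])
  also have "(\<lambda>y. if y \<in> {..x} then f y else 0) = (\<lambda>y. if y \<in> {-b..x} then f y else 0)"
    using z by fastforce
  also have "integral UNIV \<dots> = integral {-b..x} f" by (rule integral_restrict_UNIV)
  finally have 1: "integral {..x} f = integral {-b..x} f" .
  have "integral {x..} f = integral UNIV (\<lambda>y. if y \<in> {x..} then f y else 0)"
    by (rule integral_restrict_UNIV[symmetric])
  also have "(\<lambda>y. if y \<in> {x..} then f y else 0) = (\<lambda>y. if y \<in> {x..b} then f y else 0)"
    using z by fastforce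
  also have "integral UNIV \<dots> = integral {x..b} f" by (rule integral_restrict_UNIV)
  finally have 2: "integral {x..} f = integral {x..b} f" .
  have "f integrable_on {-b..b}"
    by (rule integrable_continuous_real[OF continuous_on_subset[OF c]]) simp
  then have "integral {-b..x} f + integral {x..b} f = integral {-b..b} f"
    using x by (intro Henstock_Kurzweil_Integration.integral_combine) auto
  then show ?thesis unfolding Dinv_def 1 2 by simp
qed

lemma Dinv_has_real_derivative:
  assumes s: "supported R f" and c: "continuous_on UNIV f"
  shows "(Dinv f has_real_derivative f x) (at x)"
proof -
  define b where "b = max R (\<bar>x\<bar> + 1)"
  have b: "R \<le> b" "-b < x" "x < b" by (auto simp: b_def)
  have "((\<lambda>y. integral {-b..y} f) has_real_derivative f x) (at x within {-b..b})"
    by (rule integral_has_real_derivative[OF continuous_on_subset[OF c]]) (use b in auto)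
  then have "((\<lambda>y. integral {-b..y} f) has_real_derivative f x) (at x)"
    using b at_within_interior[of x "{-b..b}"] by (simp add: interior_atLeastAtMost_real)
  then have "((\<lambda>y. integral {-b..y} f - integral {-b..b} f / 2) has_real_derivative f x) (at x)"
    by (auto intro!: derivative_eq_intros)
  then show ?thesis
    by (rule has_field_derivative_transform_within_open[of _ _ _ "{-b<..<b}"])
      (use b Dinv_eq[OF s c b(1)] in auto)
qed

lemma continuous_on_Dinv: "supported R f \<Longrightarrow> continuous_on UNIV f \<Longrightarrow> continuous_on S (Dinv f)"
  using DERIV_isCont[OF Dinv_has_real_derivative] continuous_at_imp_continuous_on by blast

lemma smooth_on_Dinv:
  assumes "supported R f" "smooth_on UNIV f"
  shows "smooth_on UNIV (Dinv f)"
  by (rule smooth_on_realI[OF open_UNIV _ assms(2)])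
    (use Dinv_has_real_derivative[OF assms(1) smooth_on_imp_continuous_on[OF assms(2)]]
      in \<open>simp add: has_real_derivative_iff_has_vector_derivative\<close>)

text \<open>\<open>Dinv\<close> inverts d/dx exactly on functions of bounded support, since f' has
  total integral 0. This is the integration by parts in the nonlocal term.\<close>

lemma Dinv_derivative_diff:
  assumes f: "supported R f" "\<And>x. (f has_real_derivative f' x) (at x)" "continuous_on UNIV f'" "supported R f'"
    and g: "supported R g" "continuous_on UNIV g"
  shows "Dinv (\<lambda>x. f' x - g x) x = f x - Dinv g x"
proof -
  define b where "b = max R (\<bar>x\<bar> + 1)"
  have b: "R \<le> b" "-b \<le> x" "x \<le> b" by (auto simp: b_def)
  have c: "continuous_on UNIV (\<lambda>x. f' x - g x)" by (intro continuous_intros f g)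
  have s: "supported R (\<lambda>x. f' x - g x)" using f(4) g(1) by (auto simp: supported_def)
  have z: "f (-(b + 1)) = 0" "f (b + 1) = 0" using b by (auto intro!: supportedD[OF f(1)])
  have ftc: "integral {l..u} f' = f u - f l" if "l \<le> u" for l u
    by (rule integral_unique[OF fundamental_theorem_of_calculus[OF that]])
      (use f(2) in \<open>auto simp: has_real_derivative_iff_has_vector_derivative intro: has_vector_derivative_at_within\<close>)
  have i: "h integrable_on {l..u}" if "continuous_on UNIV h" for h :: "real \<Rightarrow> real" and l u
    by (rule integrable_continuous_real[OF continuous_on_subset[OF that]]) simp
  have "R \<le> b + 1" "-(b + 1) \<le> x" "x \<le> b + 1" using b by auto
  note e = Dinv_eq[OF s c this] Dinv_eq[OF g this]
  show ?thesis
    unfolding e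
    using b z ftc[of "-(b + 1)" x] ftc[of "-(b + 1)" "b + 1"]
    by (simp add: integral_diff[OF i[OF f(3)] i[OF g(2)]] field_simps)
qed

text \<open>The sum of the two integrands is the derivative of \<open>Dinv f * Dinv g\<close>. At b
  and -b each factor is plus or minus half of its integral, so the product takes the same value at
  both ends; this is where the symmetric choice of constant enters.\<close>

lemma Dinv_skew:
  assumes f: "supported R f" "continuous_on UNIV f" and g: "supported R g" "continuous_on UNIV g"
  shows "integral UNIV (\<lambda>x. f x * Dinv g x) = - integral UNIV (\<lambda>x. g x * Dinv f x)"
proof -
  define b where "b = max R 1"
  have b: "R \<le> b" "-b \<le> b" "R \<le> b" by (auto simp: b_def)
  have int: "(\<lambda>x. f x * Dinv g x) integrable_on UNIV"
    if "supported R f" "continuous_on UNIV f" "supported R g" "continuous_on UNIV g" for f g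
    by (rule integrable_supported[of R])
      (use that continuous_on_Dinv[of R] in \<open>auto simp: supported_def intro!: continuous_intros\<close>)
  have D: "((\<lambda>x. Dinv f x * Dinv g x) has_real_derivative f x * Dinv g x + g x * Dinv f x) (at x)" for x
    by (rule derivative_eq_intros Dinv_has_real_derivative f g)+ simp
  have "integral UNIV (\<lambda>x. f x * Dinv g x) + integral UNIV (\<lambda>x. g x * Dinv f x)
      = integral UNIV (\<lambda>x. f x * Dinv g x + g x * Dinv f x)"
    by (rule integral_add[symmetric]; rule int; rule f g)
  also have "\<dots> = integral {-b..b} (\<lambda>x. f x * Dinv g x + g x * Dinv f x)"
    by (rule integral_supported) (use f(1) g(1) b in \<open>auto simp: supported_def\<close>)
  also have "\<dots> = Dinv f b * Dinv g b - Dinv f (-b) * Dinv g (-b)"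
    by (rule integral_unique[OF fundamental_theorem_of_calculus[OF b(2)]])
      (use D in \<open>auto simp: has_real_derivative_iff_has_vector_derivative intro: has_vector_derivative_at_within\<close>)
  also have "\<dots> = 0"
  proof -
    have "Dinv h b = integral {-b..b} h / 2 \<and> Dinv h (-b) = - (integral {-b..b} h / 2)"
      if "supported R h" "continuous_on UNIV h" for h
      using Dinv_eq[OF that b(1), of b] Dinv_eq[OF that b(1), of "-b"] b(2) by simp
    note e = this
    show ?thesis by (simp only: e[OF f] e[OF g])
  qed
  finally show ?thesis by simp
qed

text \<open>Supplies the joint continuity required for differentiating integrals whose integrand
  contains \<open>Dinv\<close>.\<close>

lemma continuous_on_Dinv_param:
  fixes h :: "real \<Rightarrow> real \<Rightarrow> real"
  assumes s: "\<And>s. s \<in> S \<Longrightarrow> supported R (h s)" and c: "continuous_on (S \<times> UNIV) (\<lambda>(s, x). h s x)"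
  shows "continuous_on (S \<times> {-R..R}) (\<lambda>(s, x). Dinv (h s) x)"
proof -
  have c1: "continuous_on UNIV (h s)" if "s \<in> S" for s
    by (rule continuous_on_slice[OF c that])
  \<comment> \<open>The moving endpoint is removed by the substitution y = t (g p + R) - R, which
    carries [0, 1] to [-R, g p]; for g p = -R the scaling degenerates and both sides are 0.\<close>
  have c2: "continuous_on (S \<times> {-R..R}) (\<lambda>p. integral {-R..g p} (h (fst p)))"
    if g: "continuous_on (S \<times> {-R..R}) g" "\<And>p. p \<in> S \<times> {-R..R} \<Longrightarrow> -R \<le> g p" for g
  proof -
    have "continuous_on ((S \<times> {-R..R}) \<times> cbox 0 1) (\<lambda>(p, t). h (fst p) (t * (g p + R) - R))"
      unfolding split_beta
      by (rule continuous_on_compose2[OF c[unfolded split_beta], of _ "\<lambda>q. (fst (fst q), snd q * (g (fst q) + R) - R)", simplified])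
        (auto intro!: continuous_intros continuous_on_compose2[OF g(1)])
    then have "continuous_on (S \<times> {-R..R}) (\<lambda>p. integral (cbox 0 1) (\<lambda>t. h (fst p) (t * (g p + R) - R)))"
      by (rule integral_continuous_on_param)
    then have "continuous_on (S \<times> {-R..R}) (\<lambda>p. (g p + R) * integral {0..1} (\<lambda>t. h (fst p) (t * (g p + R) - R)))"
      by (intro continuous_intros g) simp
    moreover have "(g p + R) * integral {0..1} (\<lambda>t. h (fst p) (t * (g p + R) - R)) = integral {-R..g p} (h (fst p))"
      if p: "p \<in> S \<times> {-R..R}" for p
    proof (cases "g p = -R")
      case False
      with g(2)[OF p] have m: "g p + R > 0" by simp
      have "h (fst p) integrable_on cbox (-R) (g p)"
        by (rule integrable_continuous[OF continuous_on_subset[OF c1]]) (use p in auto)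
      then have "(h (fst p) has_integral integral {-R..g p} (h (fst p))) (cbox (-R) (g p))"
        using integrable_integral by fastforce
      from has_integral_affinity'[OF this m, of "-R"]
      have "((\<lambda>x. h (fst p) ((g p + R) * x - R)) has_integral integral {-R..g p} (h (fst p)) / (g p + R)) {0..1}"
        using m by (simp add: divide_simps)
      from integral_unique[OF this] show ?thesis using m by (simp add: mult.commute)
    qed simp
    ultimately show ?thesis by (simp cong: continuous_on_cong)
  qed
  have c3: "continuous_on (S \<times> {-R..R}) (\<lambda>p. integral {-R..snd p} (h (fst p)) - integral {-R..R} (h (fst p)) / 2)"
    by (intro continuous_intros c2 continuous_on_snd continuous_on_const) auto
  show ?thesis
    by (rule continuous_on_eq[OF c3]) (use Dinv_eq[OF s c1 order_refl] in auto)
qed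

text \<open>For \<bar>x\<bar> \<le> R, \<open>Dinv\<close> is a combination of integrals over two
  intervals that do not depend on s, and each can be differentiated under the integral sign.\<close>

lemma Dinv_param_has_real_derivative:
  fixes h h' :: "real \<Rightarrow> real \<Rightarrow> real"
  assumes s0: "\<bar>s0\<bar> < \<delta>" and x: "\<bar>x\<bar> \<le> R"
    and d: "\<And>s x. \<bar>s\<bar> < \<delta> \<Longrightarrow> ((\<lambda>s. h s x) has_real_derivative h' s x) (at s)"
    and c: "\<And>s. \<bar>s\<bar> < \<delta> \<Longrightarrow> continuous_on UNIV (h s)"
    and c': "continuous_on ({-\<delta><..<\<delta>} \<times> UNIV) (\<lambda>(s, x). h' s x)"
    and s: "\<And>s. \<bar>s\<bar> < \<delta> \<Longrightarrow> supported R (h s)" and s': "supported R (h' s0)"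
  shows "((\<lambda>s. Dinv (h s) x) has_real_derivative Dinv (h' s0) x) (at s0)"
proof -
  let ?U = "{-\<delta><..<\<delta>}"
  have mem: "s \<in> ?U \<longleftrightarrow> \<bar>s\<bar> < \<delta>" for s
    unfolding greaterThanLessThan_iff abs_less_iff by linarith
  have L: "((\<lambda>s. integral {l..u} (h s)) has_real_derivative integral {l..u} (h' s0)) (at s0)" for l u
  proof -
    have "((\<lambda>s. integral (cbox l u) (h s)) has_real_derivative integral (cbox l u) (h' s0)) (at s0 within ?U)"
    proof (rule leibniz_rule_field_derivative[where fx = h'])
      show "((\<lambda>s. h s x) has_real_derivative h' s x) (at s within ?U)" if "s \<in> ?U" for s x
        using that by (auto intro: has_field_derivative_at_within[OF d])
      show "h s integrable_on cbox l u" if "s \<in> ?U" for s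
        by (rule integrable_continuous[OF continuous_on_subset[OF c]]) (use that mem in auto)
      show "continuous_on (?U \<times> cbox l u) (\<lambda>(s, x). h' s x)"
        by (rule continuous_on_subset[OF c']) auto
      show "s0 \<in> ?U" using s0 mem by blast
    qed (rule convex_real_interval)
    then show ?thesis using s0 mem at_within_open[of s0 ?U] by simp
  qed
  have cs: "continuous_on UNIV (h' s0)"
    by (rule continuous_on_slice[OF c']) (use s0 mem in auto)
  have "((\<lambda>s. integral {-R..x} (h s) - integral {-R..R} (h s) / 2) has_real_derivative
      integral {-R..x} (h' s0) - integral {-R..R} (h' s0) / 2) (at s0)"
    by (intro DERIV_diff DERIV_cdivide L)
  also have "integral {-R..x} (h' s0) - integral {-R..R} (h' s0) / 2 = Dinv (h' s0) x"
    using Dinv_eq[OF s' cs, of R x] x by auto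
  finally show ?thesis
    by (rule has_field_derivative_transform_within_open[of _ _ _ ?U])
      (use s0 mem x Dinv_eq[OF s c, of _ R x] in auto)
qed

section \<open>Second variations of smooth functionals\<close>

lemma smooth_on_slice_has_vector_derivative:
  fixes G :: "real \<times> real \<Rightarrow> 'b::euclidean_space"
  assumes S: "open S" and G: "smooth_on S G" and z: "(s, x) \<in> S"
  shows "((\<lambda>s. G (s, x)) has_vector_derivative frechet_derivative G (at (s, x)) (1, 0)) (at s)"
    and "((\<lambda>x. G (s, x)) has_vector_derivative frechet_derivative G (at (s, x)) (0, 1)) (at x)"
proof -
  note D = smooth_on_has_derivative[OF S G z]
  have lin: "linear (frechet_derivative G (at (s, x)))"
    using D has_derivative_linear by blast
  have sc: "frechet_derivative G (at (s, x)) (h, 0) = h *\<^sub>R frechet_derivative G (at (s, x)) (1, 0)"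
    "frechet_derivative G (at (s, x)) (0, h) = h *\<^sub>R frechet_derivative G (at (s, x)) (0, 1)" for h
    using linear_scale[OF lin, of h "(1, 0)"] linear_scale[OF lin, of h "(0, 1)"] by simp_all
  have "((\<lambda>s. (s, x)) has_derivative (\<lambda>h. (h, 0))) (at s)"
    by (auto intro!: derivative_eq_intros)
  from has_derivative_compose[OF this D]
  show "((\<lambda>s. G (s, x)) has_vector_derivative frechet_derivative G (at (s, x)) (1, 0)) (at s)"
    unfolding has_vector_derivative_def sc(1)[symmetric] .
  have "((\<lambda>x. (s, x)) has_derivative (\<lambda>h. (0, h))) (at x)"
    by (auto intro!: derivative_eq_intros)
  from has_derivative_compose[OF this D]
  show "((\<lambda>x. G (s, x)) has_vector_derivative frechet_derivative G (at (s, x)) (0, 1)) (at x)"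
    unfolding has_vector_derivative_def sc(2)[symmetric] .
qed

text \<open>Models the gradients of a smooth functional along the fields u + s \<xi>. The support
  radius is uniform in s, as differentiation under the integral demands.\<close>

locale smooth_curve =
  fixes q :: "real \<Rightarrow> real \<Rightarrow> real^'n::finite" and \<delta> R :: real
  assumes smooth: "smooth_on ({-\<delta><..<\<delta>} \<times> UNIV) (\<lambda>(s, x). q s x)"
    and pos: "\<delta> > 0"
    and supp: "\<bar>s\<bar> < \<delta> \<Longrightarrow> supported R (q s)"
begin

definition "dq s x = vector_derivative (\<lambda>s. q s x) (at s)"

lemma open_strip: "open ({-\<delta><..<\<delta>} \<times> (UNIV :: real set))"
  by (intro open_Times open_greaterThanLessThan open_UNIV)

lemma mem_strip: "(s, x) \<in> {-\<delta><..<\<delta>} \<times> (UNIV :: real set) \<longleftrightarrow> \<bar>s\<bar> < \<delta>"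
  unfolding mem_Times_iff greaterThanLessThan_iff abs_less_iff by auto

abbreviation "D v z \<equiv> frechet_derivative (\<lambda>(s, x). q s x) (at z) v"

lemma slice_derivatives:
  fixes g :: "real \<Rightarrow> real \<Rightarrow> real^'n"
  assumes "\<bar>s\<bar> < \<delta>" and g: "smooth_on ({-\<delta><..<\<delta>} \<times> UNIV) (\<lambda>(s, x). g s x)"
  shows "((\<lambda>s. g s x) has_vector_derivative frechet_derivative (\<lambda>(s, x). g s x) (at (s, x)) (1, 0)) (at s)"
    and "((\<lambda>x. g s x) has_vector_derivative frechet_derivative (\<lambda>(s, x). g s x) (at (s, x)) (0, 1)) (at x)"
  using smooth_on_slice_has_vector_derivative[OF open_strip g assms(1)[folded mem_strip[of s x]]]
  by (simp_all only: case_prod_conv)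

lemma dq_eq: "\<bar>s\<bar> < \<delta> \<Longrightarrow> dq s x = D (1, 0) (s, x)"
  unfolding dq_def by (rule vector_derivative_at[OF slice_derivatives(1)[OF _ smooth]])

lemma Dx_eq: "\<bar>s\<bar> < \<delta> \<Longrightarrow> Dx (q s) x = D (0, 1) (s, x)"
  unfolding Dx_def by (rule vector_derivative_at[OF slice_derivatives(2)[OF _ smooth]])

lemma has_vector_derivative_param: "\<bar>s\<bar> < \<delta> \<Longrightarrow> ((\<lambda>s. q s x) has_vector_derivative dq s x) (at s)"
  using slice_derivatives(1)[OF _ smooth] by (simp only: dq_eq)

lemma smooth_dq: "smooth_on ({-\<delta><..<\<delta>} \<times> UNIV) (\<lambda>(s, x). dq s x)"
  by (rule smooth_on_cong_imp[OF open_strip _ smooth_on_frechet_derivative[OF smooth, of "(1, 0)"]])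
    (use dq_eq mem_strip in auto)

lemma smooth_Dx: "smooth_on ({-\<delta><..<\<delta>} \<times> UNIV) (\<lambda>(s, x). Dx (q s) x)"
  by (rule smooth_on_cong_imp[OF open_strip _ smooth_on_frechet_derivative[OF smooth, of "(0, 1)"]])
    (use Dx_eq mem_strip in auto)

lemma smooth_slice_of:
  fixes g :: "real \<Rightarrow> real \<Rightarrow> 'c::real_normed_vector"
  assumes "\<bar>s\<bar> < \<delta>" and g: "smooth_on ({-\<delta><..<\<delta>} \<times> UNIV) (\<lambda>(s, x). g s x)"
  shows "smooth_on UNIV (g s)"
proof -
  have 1: "smooth_on UNIV (\<lambda>x::real. (s, x))"
  proof (rule smooth_onI[OF open_UNIV])
    show "((\<lambda>x. (s, x)) has_derivative (\<lambda>h. (0, h))) (at x)" for x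
      by (auto intro!: derivative_eq_intros)
  qed (rule smooth_on_const)
  have 2: "(\<lambda>x. (s, x)) ` UNIV \<subseteq> {-\<delta><..<\<delta>} \<times> (UNIV :: real set)"
    using assms(1) by (auto simp: abs_less_iff)
  show ?thesis using smooth_on_compose[OF open_UNIV open_strip 2 1 g] by (simp only: case_prod_conv)
qed

lemma smooth_slice: "\<bar>s\<bar> < \<delta> \<Longrightarrow> smooth_on UNIV (q s)"
  by (rule smooth_slice_of[OF _ smooth])

lemma smooth_dq_slice: "\<bar>s\<bar> < \<delta> \<Longrightarrow> smooth_on UNIV (dq s)"
  by (rule smooth_slice_of[OF _ smooth_dq])

text \<open>Symmetry of the second derivative on the (s, x) strip: varying the parameter commutes
  with \<open>Dx\<close>.\<close>

lemma Dx_has_vector_derivative_param: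
  assumes s: "\<bar>s\<bar> < \<delta>"
  shows "((\<lambda>s. Dx (q s) x) has_vector_derivative Dx (dq s) x) (at s)"
proof -
  note z = s[folded mem_strip[of s x]]
  have "((\<lambda>s. D (0, 1) (s, x)) has_vector_derivative frechet_derivative (D (0, 1)) (at (s, x)) (1, 0)) (at s)"
    by (rule smooth_on_slice_has_vector_derivative(1)[OF open_strip smooth_on_frechet_derivative[OF smooth] z])
  also have "frechet_derivative (D (0, 1)) (at (s, x)) (1, 0) = frechet_derivative (D (1, 0)) (at (s, x)) (0, 1)"
    by (rule second_derivative_symmetric[OF open_strip smooth z])
  also have "\<dots> = Dx (\<lambda>x. D (1, 0) (s, x)) x"
    unfolding Dx_def
    by (rule vector_derivative_at[symmetric])
      (rule smooth_on_slice_has_vector_derivative(2)[OF open_strip smooth_on_frechet_derivative[OF smooth] z])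
  also have "(\<lambda>x. D (1, 0) (s, x)) = dq s" using dq_eq[OF s] by auto
  finally show ?thesis
    by (rule has_vector_derivative_transform_within_open[of _ _ _ "{-\<delta><..<\<delta>}"])
      (use s Dx_eq in \<open>auto simp: abs_less_iff\<close>)
qed

lemma smooth_Dx_dq: "smooth_on ({-\<delta><..<\<delta>} \<times> UNIV) (\<lambda>(s, x). Dx (dq s) x)"
proof (rule smooth_on_cong_imp[OF open_strip _ smooth_on_frechet_derivative[OF smooth_dq, of "(0, 1)"]])
  fix z assume z: "z \<in> {-\<delta><..<\<delta>} \<times> (UNIV :: real set)"
  obtain s x where sx: "z = (s, x)" by fastforce
  show "frechet_derivative (\<lambda>(s, x). dq s x) (at z) (0, 1) = (case z of (s, x) \<Rightarrow> Dx (dq s) x)"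
    using vector_derivative_at[OF slice_derivatives(2)[OF _ smooth_dq], of s x] z mem_strip[of s x]
    unfolding Dx_def sx by simp
qed

lemma supp_dq: assumes s: "\<bar>s\<bar> < \<delta>" shows "supported R (dq s)"
  unfolding supported_def
proof (intro allI impI)
  fix x assume x: "R < \<bar>x\<bar>"
  have "((\<lambda>s. 0) has_vector_derivative dq s x) (at s)"
    by (rule has_vector_derivative_transform_within_open[OF has_vector_derivative_param[OF s], of "{-\<delta><..<\<delta>}"])
      (use s x supportedD[OF supp] in \<open>auto simp: abs_less_iff\<close>)
  then show "dq s x = 0" using has_vector_derivative_const vector_derivative_unique_at by blast
qed

end

section \<open>Perturbed fields and gradients of smooth functionals\<close>

lemma supported_Dx:
  assumes "supported R q" shows "supported R (Dx q)"
  unfolding supported_def Dx_def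
proof (intro allI impI)
  fix x assume x: "R < \<bar>x\<bar>"
  have "open {y. R < \<bar>y\<bar>}" by (intro open_Collect_less continuous_intros)
  then have "(q has_vector_derivative 0) (at x)"
    by (rule has_vector_derivative_transform_within_open[OF has_vector_derivative_const])
      (use x supportedD[OF assms] in auto)
  then show "vector_derivative q (at x) = 0" by (rule vector_derivative_at)
qed

text \<open>On the compact interval carrying both variations, the values of u keep a uniform
  distance e from the complement of the open set U, and the variations are bounded by K1 and K2;
  elsewhere u is unchanged. This dictates \<delta> = e / (K1 + K2).\<close>

lemma field_space_perturb:
  assumes U: "open U" and u: "u \<in> field_space U" and \<xi>: "\<xi> \<in> variations" and \<zeta>: "\<zeta> \<in> variations"
  obtains \<delta> where "\<delta> > 0"
    "\<And>s t. \<bar>s\<bar> < \<delta> \<Longrightarrow> \<bar>t\<bar> < \<delta> \<Longrightarrow> (\<lambda>x. u x + s *\<^sub>R \<xi> x + t *\<^sub>R \<zeta> x) \<in> field_space U"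
proof -
  obtain R1 where R1: "supported R1 \<xi>" by (rule variations_supportedE[OF \<xi>])
  obtain R2 where R2: "supported R2 \<zeta>" by (rule variations_supportedE[OF \<zeta>])
  let ?R = "max R1 R2"
  have R: "supported ?R \<xi>" "supported ?R \<zeta>" using R1 R2 supported_mono max.cobounded1 max.cobounded2 by blast+
  have us: "smooth_on UNIV u" "\<And>x. u x \<in> U" using u by (auto simp: field_space_def)
  have c: "continuous_on {-?R..?R} f" if "smooth_on UNIV f" for f :: "real \<Rightarrow> real^'a"
    using continuous_on_subset[OF smooth_on_imp_continuous_on[OF that]] by blast
  have "compact (u ` {-?R..?R})" by (rule compact_continuous_image[OF c[OF us(1)] compact_Icc])
  then obtain e where e: "e > 0" "(\<Union>x\<in>u ` {-?R..?R}. ball x e) \<subseteq> U"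
    using compact_subset_open_imp_ball_epsilon_subset[of "u ` {-?R..?R}" U] U us(2) by blast
  have bnd: "\<exists>K>0. \<forall>x\<in>{-?R..?R}. norm (f x) \<le> K" if "f \<in> variations" for f :: "real \<Rightarrow> real^'a"
  proof -
    have "bounded (f ` {-?R..?R})"
      by (rule compact_imp_bounded[OF compact_continuous_image[OF c[OF variations_smooth[OF that]] compact_Icc]])
    then show ?thesis unfolding bounded_pos by auto
  qed
  obtain K1 where K1: "K1 > 0" "\<And>x. x \<in> {-?R..?R} \<Longrightarrow> norm (\<xi> x) \<le> K1" using bnd[OF \<xi>] by blast
  obtain K2 where K2: "K2 > 0" "\<And>x. x \<in> {-?R..?R} \<Longrightarrow> norm (\<zeta> x) \<le> K2" using bnd[OF \<zeta>] by blast
  define \<delta> where "\<delta> = e / (K1 + K2)"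
  show ?thesis
  proof (rule that)
    show "\<delta> > 0" using e(1) K1(1) K2(1) by (simp add: \<delta>_def)
    fix s t assume st: "\<bar>s\<bar> < \<delta>" "\<bar>t\<bar> < \<delta>"
    have "u x + s *\<^sub>R \<xi> x + t *\<^sub>R \<zeta> x \<in> U" for x
    proof (cases "x \<in> {-?R..?R}")
      case True
      have "norm (s *\<^sub>R \<xi> x + t *\<^sub>R \<zeta> x) \<le> \<bar>s\<bar> * norm (\<xi> x) + \<bar>t\<bar> * norm (\<zeta> x)"
        by (metis norm_scaleR norm_triangle_ineq)
      also have "\<dots> \<le> \<bar>s\<bar> * K1 + \<bar>t\<bar> * K2"
        using K1(2)[OF True] K2(2)[OF True] by (intro add_mono mult_left_mono) auto
      also have "\<dots> < \<delta> * K1 + \<delta> * K2"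
        using st K1(1) K2(1) by (intro add_strict_mono mult_strict_right_mono) auto
      also have "\<dots> = e" using K1(1) K2(1) 
        by (simp add: \<delta>_def add_divide_distrib[symmetric] distrib_left[symmetric])
      finally have "dist (u x + (s *\<^sub>R \<xi> x + t *\<^sub>R \<zeta> x)) (u x) < e"
        by (simp add: dist_norm)
      then have "u x + s *\<^sub>R \<xi> x + t *\<^sub>R \<zeta> x \<in> ball (u x) e"
        by (simp add: dist_commute add.assoc)
      then show ?thesis using e(2) True by blast
    next
      case False
      then have "?R < \<bar>x\<bar>" by auto
      then show ?thesis using us(2)[of x] supportedD[OF R(1)] supportedD[OF R(2)] by simp
    qed
    moreover have "smooth_on UNIV (\<lambda>x. u x + s *\<^sub>R \<xi> x + t *\<^sub>R \<zeta> x)"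
      by (intro smooth_on_add smooth_on_scaleR smooth_on_const open_UNIV us variations_smooth \<xi> \<zeta>)
    ultimately show "(\<lambda>x. u x + s *\<^sub>R \<xi> x + t *\<^sub>R \<zeta> x) \<in> field_space U" by (simp add: field_space_def)
  qed
qed

lemma smooth_functional_variational_derivative:
  assumes "smooth_functional U I" "u \<in> field_space U"
  shows "has_variational_derivative I u (variational_derivative I u)"
  using assms variational_derivative_eq unfolding smooth_functional_def by metis

lemma smooth_functional_supportedE:
  assumes "smooth_functional U I"
  obtains R where "\<And>u. u \<in> field_space U \<Longrightarrow> supported R (variational_derivative I u)"
  using assms variational_derivative_eq unfolding smooth_functional_def supported_def by metis

text \<open>The definition asserts smoothness of some witness G on a set given by membership in
  \<open>field_space\<close>. On an open box inside this set the witness agrees with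
  \<open>variational_derivative\<close>, so smoothness and its calculus transfer to the
  latter.\<close>

lemma smooth_functional_two_parameter:
  assumes U: "open U" and I: "smooth_functional U I" and u: "u \<in> field_space U"
    and \<xi>: "\<xi> \<in> variations" and \<zeta>: "\<zeta> \<in> variations"
  obtains \<delta> where "\<delta> > 0"
    "\<And>s t. \<bar>s\<bar> < \<delta> \<Longrightarrow> \<bar>t\<bar> < \<delta> \<Longrightarrow> (\<lambda>x. u x + s *\<^sub>R \<xi> x + t *\<^sub>R \<zeta> x) \<in> field_space U"
    "smooth_on ({-\<delta><..<\<delta>} \<times> {-\<delta><..<\<delta>} \<times> UNIV)
       (\<lambda>(s, t, x). variational_derivative I (\<lambda>y. u y + s *\<^sub>R \<xi> y + t *\<^sub>R \<zeta> y) x)"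
proof -
  obtain \<delta> where \<delta>: "\<delta> > 0" and f:
    "\<And>s t. \<bar>s\<bar> < \<delta> \<Longrightarrow> \<bar>t\<bar> < \<delta> \<Longrightarrow> (\<lambda>x. u x + s *\<^sub>R \<xi> x + t *\<^sub>R \<zeta> x) \<in> field_space U"
    using field_space_perturb[OF U u \<xi> \<zeta>] by blast
  obtain G R where G: "\<And>u. u \<in> field_space U \<Longrightarrow> has_variational_derivative I u (G u)"
    and sm: "smooth_on {(s::real, t::real, x::real). (\<lambda>y. u y + s *\<^sub>R \<xi> y + t *\<^sub>R \<zeta> y) \<in> field_space U}
          (\<lambda>(s, t, x). G (\<lambda>y. u y + s *\<^sub>R \<xi> y + t *\<^sub>R \<zeta> y) x)"
    using I u \<xi> \<zeta> unfolding smooth_functional_def by blast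
  let ?B = "{-\<delta><..<\<delta>} \<times> {-\<delta><..<\<delta>} \<times> (UNIV :: real set)"
  have mem: "\<bar>fst z\<bar> < \<delta>" "\<bar>fst (snd z)\<bar> < \<delta>" if "z \<in> ?B" for z using that by (auto simp: abs_less_iff)
  have "smooth_on ?B (\<lambda>(s, t, x). G (\<lambda>y. u y + s *\<^sub>R \<xi> y + t *\<^sub>R \<zeta> y) x)"
    by (rule smooth_on_subset[OF sm]) (use f in \<open>auto simp: abs_less_iff\<close>)
  then have "smooth_on ?B (\<lambda>(s, t, x). variational_derivative I (\<lambda>y. u y + s *\<^sub>R \<xi> y + t *\<^sub>R \<zeta> y) x)"
  proof (rule smooth_on_cong_imp[rotated -1])
    show "open ?B" by (intro open_Times open_greaterThanLessThan open_UNIV)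
    fix z assume "z \<in> ?B"
    then show "(case z of (s, t, x) \<Rightarrow> G (\<lambda>y. u y + s *\<^sub>R \<xi> y + t *\<^sub>R \<zeta> y) x)
        = (case z of (s, t, x) \<Rightarrow> variational_derivative I (\<lambda>y. u y + s *\<^sub>R \<xi> y + t *\<^sub>R \<zeta> y) x)"
      using variational_derivative_eq[OF G[OF f[OF mem(1) mem(2)]], of z z] by (cases z) auto
  qed
  then show ?thesis using that \<delta> f by blast
qed

lemma smooth_functional_curve:
  assumes U: "open U" and I: "smooth_functional U I" and u: "u \<in> field_space U" and \<xi>: "\<xi> \<in> variations"
    and R: "\<And>u. u \<in> field_space U \<Longrightarrow> supported R (variational_derivative I u)"
  obtains \<delta> where "\<And>s. \<bar>s\<bar> < \<delta> \<Longrightarrow> (\<lambda>x. u x + s *\<^sub>R \<xi> x) \<in> field_space U"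
    "smooth_curve (\<lambda>s. variational_derivative I (\<lambda>y. u y + s *\<^sub>R \<xi> y)) \<delta> R"
proof -
  \<comment> \<open>The second direction is a dummy: \<xi> is used twice and t is then frozen at
    0.\<close>
  obtain \<delta> where \<delta>: "\<delta> > 0"
    "\<And>s t. \<bar>s\<bar> < \<delta> \<Longrightarrow> \<bar>t\<bar> < \<delta> \<Longrightarrow> (\<lambda>x. u x + s *\<^sub>R \<xi> x + t *\<^sub>R \<xi> x) \<in> field_space U"
    "smooth_on ({-\<delta><..<\<delta>} \<times> {-\<delta><..<\<delta>} \<times> UNIV)
       (\<lambda>(s, t, x). variational_derivative I (\<lambda>y. u y + s *\<^sub>R \<xi> y + t *\<^sub>R \<xi> y) x)"
    using smooth_functional_two_parameter[OF U I u \<xi> \<xi>] by blast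
  have f: "(\<lambda>x. u x + s *\<^sub>R \<xi> x) \<in> field_space U" if "\<bar>s\<bar> < \<delta>" for s
    using \<delta>(2)[OF that, of 0] \<delta>(1) by simp
  let ?B = "{-\<delta><..<\<delta>} \<times> (UNIV :: real set)"
  have oB: "open ?B" "open ({-\<delta><..<\<delta>} \<times> {-\<delta><..<\<delta>} \<times> (UNIV :: real set))"
    by (intro open_Times open_greaterThanLessThan open_UNIV)+
  have 1: "smooth_on ?B (\<lambda>z. (fst z, 0::real, snd z))"
    by (rule smooth_on_bounded_linear[OF _ oB(1)])
      (intro bounded_linear_Pair bounded_linear_fst bounded_linear_snd bounded_linear_zero)
  have 2: "(\<lambda>z. (fst z, 0, snd z)) ` ?B \<subseteq> {-\<delta><..<\<delta>} \<times> {-\<delta><..<\<delta>} \<times> (UNIV :: real set)"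
    using \<delta>(1) by auto
  have "smooth_on ?B (\<lambda>(s, x). variational_derivative I (\<lambda>y. u y + s *\<^sub>R \<xi> y) x)"
    using smooth_on_compose[OF oB 2 1 \<delta>(3)] by (simp add: case_prod_beta')
  then have "smooth_curve (\<lambda>s. variational_derivative I (\<lambda>y. u y + s *\<^sub>R \<xi> y)) \<delta> R"
    by unfold_locales (use \<delta>(1) f R in auto)
  then show ?thesis using that f by blast
qed

text \<open>The Hessian operator of I at u applied to \<xi>, represented as the derivative of the
  gradient, so that it is again a covector field.\<close>

definition second_variation :: "('n::finite) functional \<Rightarrow> 'n field \<Rightarrow> 'n field \<Rightarrow> 'n field" where
  "second_variation I u \<xi> x = vector_derivative (\<lambda>s. variational_derivative I (\<lambda>y. u y + s *\<^sub>R \<xi> y) x) (at 0)"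

text \<open>Both integrals are mixed second derivatives at the origin of I(u + s \<xi> + t \<zeta>),
  taken in opposite orders.\<close>

lemma second_variation_symmetric:
  assumes U: "open U" and I: "smooth_functional U I" and u: "u \<in> field_space U"
    and \<xi>: "\<xi> \<in> variations" and \<zeta>: "\<zeta> \<in> variations"
  shows "integral UNIV (\<lambda>x. second_variation I u \<xi> x \<bullet> \<zeta> x)
       = integral UNIV (\<lambda>x. second_variation I u \<zeta> x \<bullet> \<xi> x)"
proof -
  obtain \<delta> where \<delta>: "\<delta> > 0"
    and f: "\<And>s t. \<bar>s\<bar> < \<delta> \<Longrightarrow> \<bar>t\<bar> < \<delta> \<Longrightarrow> (\<lambda>x. u x + s *\<^sub>R \<xi> x + t *\<^sub>R \<zeta> x) \<in> field_space U"
    and sm: "smooth_on ({-\<delta><..<\<delta>} \<times> {-\<delta><..<\<delta>} \<times> UNIV)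
       (\<lambda>(s, t, x). variational_derivative I (\<lambda>y. u y + s *\<^sub>R \<xi> y + t *\<^sub>R \<zeta> y) x)"
    using smooth_functional_two_parameter[OF U I u \<xi> \<zeta>] by blast
  obtain R1 where R1: "supported R1 \<xi>" by (rule variations_supportedE[OF \<xi>])
  obtain R2 where R2: "supported R2 \<zeta>" by (rule variations_supportedE[OF \<zeta>])
  let ?R = "max R1 R2"
  have R: "supported ?R \<xi>" "supported ?R \<zeta>" using R1 R2 supported_mono max.cobounded1 max.cobounded2 by blast+
  let ?B = "{-\<delta><..<\<delta>} \<times> {-\<delta><..<\<delta>} \<times> (UNIV :: real set)"
  have oB: "open ?B" by (intro open_Times open_greaterThanLessThan open_UNIV)
  define E where "E = (\<lambda>(s, t, x). variational_derivative I (\<lambda>y. u y + s *\<^sub>R \<xi> y + t *\<^sub>R \<zeta> y) x)"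
  define D where "D v z = frechet_derivative E (at z) v" for v z
  have smE: "smooth_on ?B E" using sm by (simp add: E_def)
  have smD: "smooth_on ?B (D v)" for v unfolding D_def by (rule smooth_on_frechet_derivative[OF smE])
  have mem: "(s, t, x) \<in> ?B \<longleftrightarrow> \<bar>s\<bar> < \<delta> \<and> \<bar>t\<bar> < \<delta>" for s t x
    unfolding mem_Times_iff greaterThanLessThan_iff abs_less_iff by auto
  have Es: "((\<lambda>s. E (s, t, x)) has_vector_derivative D (1, 0, 0) (s, t, x)) (at s)"
    and Et: "((\<lambda>t. E (s, t, x)) has_vector_derivative D (0, 1, 0) (s, t, x)) (at t)"
    if "\<bar>s\<bar> < \<delta>" "\<bar>t\<bar> < \<delta>" for s t x
  proof -
    have DE: "(E has_derivative frechet_derivative E (at (s, t, x))) (at (s, t, x))"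
      by (rule smooth_on_has_derivative[OF oB smE]) (use that mem in blast)
    have lin: "linear (frechet_derivative E (at (s, t, x)))" using DE has_derivative_linear by blast
    have sc: "frechet_derivative E (at (s, t, x)) (h, 0, 0) = h *\<^sub>R D (1, 0, 0) (s, t, x)"
      "frechet_derivative E (at (s, t, x)) (0, h, 0) = h *\<^sub>R D (0, 1, 0) (s, t, x)" for h
      using linear_scale[OF lin, of h "(1, 0, 0)"] linear_scale[OF lin, of h "(0, 1, 0)"] by (simp_all add: D_def)
    have "((\<lambda>s. (s, t, x)) has_derivative (\<lambda>h. (h, 0, 0))) (at s)"
      by (intro has_derivative_Pair has_derivative_ident has_derivative_const)
    from has_derivative_compose[OF this DE]
    show "((\<lambda>s. E (s, t, x)) has_vector_derivative D (1, 0, 0) (s, t, x)) (at s)"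
      unfolding has_vector_derivative_def sc(1)[symmetric] .
    have "((\<lambda>t. (s, t, x)) has_derivative (\<lambda>h. (0, h, 0))) (at t)"
      by (intro has_derivative_Pair has_derivative_ident has_derivative_const)
    from has_derivative_compose[OF this DE]
    show "((\<lambda>t. E (s, t, x)) has_vector_derivative D (0, 1, 0) (s, t, x)) (at t)"
      unfolding has_vector_derivative_def sc(2)[symmetric] .
  qed
  define \<phi> where "\<phi> s t = I (\<lambda>y. u y + s *\<^sub>R \<xi> y + t *\<^sub>R \<zeta> y)" for s t
  have c\<xi>: "continuous_on S \<xi>" and c\<zeta>: "continuous_on S \<zeta>" for S
    using smooth_on_imp_continuous_on[OF variations_smooth] \<xi> \<zeta> continuous_on_subset by blast+
  have compc: "continuous_on S (\<lambda>p. G (f p))"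
    if "smooth_on ?B G" "continuous_on S f" "f ` S \<subseteq> ?B" for G :: "real \<times> real \<times> real \<Rightarrow> real^'a" and S and f :: "'d::topological_space \<Rightarrow> _"
    using continuous_on_compose2[OF smooth_on_imp_continuous_on[OF that(1)] that(2,3)] .
  have contint: "isCont (\<lambda>(s, t). integral UNIV (\<lambda>x. D v (s, t, x) \<bullet> \<eta> x)) (0, 0)"
    if "supported ?R \<eta>" "continuous_on {-?R..?R} \<eta>" for v and \<eta> :: "real \<Rightarrow> real^'a"
  proof -
    let ?C = "{-\<delta><..<\<delta>} \<times> {-\<delta><..<\<delta>}"
    have "continuous_on (?C \<times> cbox (-?R) ?R) (\<lambda>(p, x). D v (fst p, snd p, x) \<bullet> \<eta> x)"
      unfolding split_beta
      by (intro continuous_on_inner compc[OF smD] continuous_on_compose2[OF that(2), of _ snd] continuous_intros) auto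
    then have "continuous_on ?C (\<lambda>p. integral (cbox (-?R) ?R) (\<lambda>x. D v (fst p, snd p, x) \<bullet> \<eta> x))"
      by (rule integral_continuous_on_param)
    moreover have "integral (cbox (-?R) ?R) (\<lambda>x. D v (fst p, snd p, x) \<bullet> \<eta> x)
        = integral UNIV (\<lambda>x. D v (fst p, snd p, x) \<bullet> \<eta> x)" for p
      unfolding cbox_interval
      by (rule integral_supported[symmetric]) (use that(1) in \<open>auto simp: supported_def\<close>)
    ultimately have "continuous_on ?C (\<lambda>p. integral UNIV (\<lambda>x. D v (fst p, snd p, x) \<bullet> \<eta> x))" by simp
    moreover have "open ?C" "(0, 0) \<in> ?C" using \<delta> by (auto intro: open_Times)
    ultimately show ?thesis
      unfolding case_prod_beta' using continuous_on_eq_continuous_at by blast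
  qed
  have "integral UNIV (\<lambda>x. D (0, 1, 0) (0, 0, x) \<bullet> \<xi> x) = integral UNIV (\<lambda>x. D (1, 0, 0) (0, 0, x) \<bullet> \<zeta> x)"
  proof (rule mixed_partials_eq[OF \<delta>, where \<phi> = \<phi>
        and a = "\<lambda>s t. integral UNIV (\<lambda>x. E (s, t, x) \<bullet> \<xi> x)"
        and b = "\<lambda>s t. integral UNIV (\<lambda>x. E (s, t, x) \<bullet> \<zeta> x)"
        and c = "\<lambda>s t. integral UNIV (\<lambda>x. D (0, 1, 0) (s, t, x) \<bullet> \<xi> x)"
        and d = "\<lambda>s t. integral UNIV (\<lambda>x. D (1, 0, 0) (s, t, x) \<bullet> \<zeta> x)"])
    fix s t :: real assume st: "\<bar>s\<bar> < \<delta>" "\<bar>t\<bar> < \<delta>"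
    note vd = smooth_functional_variational_derivative[OF I f[OF st], unfolded has_variational_derivative_def,
        THEN conjunct2]
    \<comment> \<open>A variational derivative only speaks about the parameter value 0; taken at the
      field perturbed by (s, t), it gives the derivative at s after a shift of the
      parameter.\<close>
    have "((\<lambda>h. \<phi> (h + s) t) has_real_derivative integral UNIV (\<lambda>x. E (s, t, x) \<bullet> \<xi> x)) (at 0)"
      using bspec[OF vd \<xi>] by (simp add: \<phi>_def E_def algebra_simps)
    then show "((\<lambda>s. \<phi> s t) has_real_derivative integral UNIV (\<lambda>x. E (s, t, x) \<bullet> \<xi> x)) (at s)"
      using DERIV_shift[of "\<lambda>s. \<phi> s t" _ 0 s] by simp
    have "((\<lambda>h. \<phi> s (h + t)) has_real_derivative integral UNIV (\<lambda>x. E (s, t, x) \<bullet> \<zeta> x)) (at 0)"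
      using bspec[OF vd \<zeta>] by (simp add: \<phi>_def E_def algebra_simps)
    then show "((\<lambda>t. \<phi> s t) has_real_derivative integral UNIV (\<lambda>x. E (s, t, x) \<bullet> \<zeta> x)) (at t)"
      using DERIV_shift[of "\<lambda>t. \<phi> s t" _ 0 t] by simp
    show "((\<lambda>t. integral UNIV (\<lambda>x. E (s, t, x) \<bullet> \<xi> x)) has_real_derivative
        integral UNIV (\<lambda>x. D (0, 1, 0) (s, t, x) \<bullet> \<xi> x)) (at t)"
    proof (rule leibniz_rule_supported[OF st(2), where R = ?R and k' = "\<lambda>t x. D (0, 1, 0) (s, t, x) \<bullet> \<xi> x"])
      show "((\<lambda>t. E (s, t, x) \<bullet> \<xi> x) has_real_derivative D (0, 1, 0) (s, t, x) \<bullet> \<xi> x) (at t)" if "\<bar>t\<bar> < \<delta>" for t x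
        using bounded_linear.has_vector_derivative[OF bounded_linear_inner_left Et[OF st(1) that]]
        by (simp add: has_real_derivative_iff_has_vector_derivative)
      show "continuous_on {-?R..?R} (\<lambda>x. E (s, t, x) \<bullet> \<xi> x)" if "\<bar>t\<bar> < \<delta>" for t
        by (intro continuous_on_inner compc[OF smE] c\<xi> continuous_intros) (use st that mem in blast)
      show "continuous_on ({-\<delta><..<\<delta>} \<times> {-?R..?R}) (\<lambda>(t, x). D (0, 1, 0) (s, t, x) \<bullet> \<xi> x)"
        unfolding split_beta
        by (intro continuous_on_inner compc[OF smD] continuous_on_compose2[OF c\<xi>, of _ snd] continuous_intros)
          (use st in \<open>auto simp: abs_less_iff\<close>)
    qed (use R(1) in \<open>auto simp: supported_def\<close>)
    show "((\<lambda>s. integral UNIV (\<lambda>x. E (s, t, x) \<bullet> \<zeta> x)) has_real_derivative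
        integral UNIV (\<lambda>x. D (1, 0, 0) (s, t, x) \<bullet> \<zeta> x)) (at s)"
    proof (rule leibniz_rule_supported[OF st(1), where R = ?R and k' = "\<lambda>s x. D (1, 0, 0) (s, t, x) \<bullet> \<zeta> x"])
      show "((\<lambda>s. E (s, t, x) \<bullet> \<zeta> x) has_real_derivative D (1, 0, 0) (s, t, x) \<bullet> \<zeta> x) (at s)" if "\<bar>s\<bar> < \<delta>" for s x
        using bounded_linear.has_vector_derivative[OF bounded_linear_inner_left Es[OF that st(2)]]
        by (simp add: has_real_derivative_iff_has_vector_derivative)
      show "continuous_on {-?R..?R} (\<lambda>x. E (s, t, x) \<bullet> \<zeta> x)" if "\<bar>s\<bar> < \<delta>" for s
        by (intro continuous_on_inner compc[OF smE] c\<zeta> continuous_intros) (use st that mem in blast)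
      show "continuous_on ({-\<delta><..<\<delta>} \<times> {-?R..?R}) (\<lambda>(s, x). D (1, 0, 0) (s, t, x) \<bullet> \<zeta> x)"
        unfolding split_beta
        by (intro continuous_on_inner compc[OF smD] continuous_on_compose2[OF c\<zeta>, of _ snd] continuous_intros)
          (use st in \<open>auto simp: abs_less_iff\<close>)
    qed (use R(2) in \<open>auto simp: supported_def\<close>)
  next
    show "isCont (\<lambda>(s, t). integral UNIV (\<lambda>x. D (0, 1, 0) (s, t, x) \<bullet> \<xi> x)) (0, 0)"
      by (rule contint[OF R(1) c\<xi>])
    show "isCont (\<lambda>(s, t). integral UNIV (\<lambda>x. D (1, 0, 0) (s, t, x) \<bullet> \<zeta> x)) (0, 0)"
      by (rule contint[OF R(2) c\<zeta>])
  qed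
  moreover have "D (0, 1, 0) (0, 0, x) = second_variation I u \<zeta> x" for x
    using vector_derivative_at[OF Et[of 0 0 x]] \<delta> by (simp add: second_variation_def E_def)
  moreover have "D (1, 0, 0) (0, 0, x) = second_variation I u \<xi> x" for x
    using vector_derivative_at[OF Es[of 0 0 x]] \<delta> by (simp add: second_variation_def E_def)
  ultimately show ?thesis by simp
qed

section \<open>Pointwise algebra of the canonical operator\<close>

definition grad :: "(real^'n::finite \<Rightarrow> real) \<Rightarrow> real^'n \<Rightarrow> real^'n" where
  "grad Q u = (\<chi> i. partial i Q u)"

definition hess :: "(real^'n::finite \<Rightarrow> real) \<Rightarrow> real^'n \<Rightarrow> real^'n^'n" where
  "hess Q u = (\<chi> i j. partial i (partial j Q) u)"

lemma grad_nth [simp]: "grad Q u $ i = partial i Q u"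
  and hess_nth [simp]: "hess Q u $ i $ j = partial i (partial j Q) u"
  by (simp_all add: grad_def hess_def)

lemma frechet_derivative_eq_grad:
  assumes "(Q has_derivative frechet_derivative Q (at u)) (at u)"
  shows "frechet_derivative Q (at u) v = grad Q u \<bullet> v"
proof -
  have lin: "linear (frechet_derivative Q (at u))" using assms has_derivative_linear by blast
  have "v = (\<Sum>i\<in>UNIV. v $ i *\<^sub>R axis i 1)"
    by (simp add: vec_eq_iff axis_def if_distrib cong: if_cong)
  then have "frechet_derivative Q (at u) v = (\<Sum>i\<in>UNIV. v $ i *\<^sub>R frechet_derivative Q (at u) (axis i 1))"
    by (metis (no_types, lifting) linear_sum[OF lin] linear_scale[OF lin] sum.cong)
  then show ?thesis by (simp add: inner_vec_def partial_def mult.commute)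
qed

lemma has_real_derivative_along:
  assumes "open U" "smooth_on U Q" "w s \<in> U" "(w has_vector_derivative w') (at s)"
  shows "((\<lambda>s. Q (w s)) has_real_derivative grad Q (w s) \<bullet> w') (at s)"
proof -
  note D = smooth_on_has_derivative[OF assms(1-3)]
  have eq: "frechet_derivative Q (at (w s)) v = grad Q (w s) \<bullet> v" for v
    by (rule frechet_derivative_eq_grad[OF D])
  show ?thesis
    using has_derivative_compose[OF assms(4)[unfolded has_vector_derivative_def] D]
    unfolding eq has_field_derivative_def by (simp add: mult_commute_abs)
qed

lemma has_vector_derivative_vecI:
  fixes f :: "real \<Rightarrow> real^'n::finite"
  assumes "\<And>i. ((\<lambda>s. f s $ i) has_real_derivative f' $ i) (at s)"
  shows "(f has_vector_derivative f') (at s)"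
  unfolding has_vector_derivative_def
  by (subst has_derivative_componentwise_within)
    (use assms in \<open>auto simp: Basis_vec_def inner_axis has_field_derivative_def mult_commute_abs\<close>)

lemma hess_symmetric:
  "open U \<Longrightarrow> smooth_on U Q \<Longrightarrow> u \<in> U \<Longrightarrow> hess Q u $ i $ j = hess Q u $ j $ i"
  by (simp add: partial_commute)

lemma grad_has_vector_derivative_along:
  assumes "open U" "smooth_on U Q" "w s \<in> U" "(w has_vector_derivative w') (at s)"
  shows "((\<lambda>s. grad Q (w s)) has_vector_derivative hess Q (w s) *v w') (at s)"
proof (rule has_vector_derivative_vecI)
  fix i
  have "((\<lambda>s. partial i Q (w s)) has_real_derivative grad (partial i Q) (w s) \<bullet> w') (at s)"
    by (rule has_real_derivative_along[OF assms(1) smooth_on_partial[OF assms(2)] assms(3,4)])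
  also have "grad (partial i Q) (w s) \<bullet> w' = (hess Q (w s) *v w') $ i"
    by (simp add: inner_vec_def matrix_vector_mult_def partial_commute[OF assms(1-3), of i])
  finally show "((\<lambda>s. grad Q (w s) $ i) has_real_derivative (hess Q (w s) *v w') $ i) (at s)" by simp
qed

lemma smooth_on_grad: "open U \<Longrightarrow> smooth_on U Q \<Longrightarrow> smooth_on U (grad Q)"
  unfolding grad_def[abs_def] by (intro smooth_on_vec_lambda smooth_on_partial)

section \<open>Matrix form of the canonical operator\<close>

lemma matrix_vector_inner_symmetric:
  fixes M :: "real^'n::finite^'n"
  assumes "transpose M = M"
  shows "(M *v a) \<bullet> b = a \<bullet> (M *v b)"
  by (metis assms dot_lmul_matrix transpose_matrix_vector)

text \<open>Turns the index form of the \<psi> terms in \<open>g_can\<close> and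
  \<open>P1_can\<close> into sums of rank one matrices.\<close>

lemma sum_bilinear_rank_one:
  fixes a b c :: "_ \<Rightarrow> real"
  shows "(\<Sum>s\<in>A. \<Sum>p\<in>B. a s * b p * (\<Sum>\<alpha>\<in>C. c \<alpha> * d \<alpha> s * e \<alpha> p))
    = (\<Sum>\<alpha>\<in>C. c \<alpha> * (\<Sum>s\<in>A. a s * d \<alpha> s) * (\<Sum>p\<in>B. b p * e \<alpha> p))"
proof -
  have "(\<Sum>s\<in>A. \<Sum>p\<in>B. a s * b p * (\<Sum>\<alpha>\<in>C. c \<alpha> * d \<alpha> s * e \<alpha> p))
      = (\<Sum>s\<in>A. \<Sum>p\<in>B. \<Sum>\<alpha>\<in>C. c \<alpha> * (a s * d \<alpha> s) * (b p * e \<alpha> p))"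
    by (simp add: sum_distrib_left mult_ac)
  also have "\<dots> = (\<Sum>s\<in>A. \<Sum>\<alpha>\<in>C. \<Sum>p\<in>B. c \<alpha> * (a s * d \<alpha> s) * (b p * e \<alpha> p))"
    by (intro sum.cong refl sum.swap)
  also have "\<dots> = (\<Sum>\<alpha>\<in>C. \<Sum>s\<in>A. \<Sum>p\<in>B. c \<alpha> * (a s * d \<alpha> s) * (b p * e \<alpha> p))"
    by (rule sum.swap)
  also have "\<dots> = (\<Sum>\<alpha>\<in>C. c \<alpha> * (\<Sum>s\<in>A. a s * d \<alpha> s) * (\<Sum>p\<in>B. b p * e \<alpha> p))"
    by (intro sum.cong refl) (simp add: sum_distrib_left sum_distrib_right mult_ac)
  finally show ?thesis .
qed

lemma matrix_vector_mult_sum_left: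
  fixes M :: "'i \<Rightarrow> real^'n::finite^'m::finite"
  shows "(\<Sum>i\<in>A. M i) *v a = (\<Sum>i\<in>A. M i *v a)"
  by (induction A rule: infinite_finite_induct) (simp_all add: matrix_vector_mult_add_rdistrib)

lemma matrix_vector_mult_sum_right:
  fixes M :: "real^'n::finite^'m::finite"
  shows "M *v (\<Sum>i\<in>A. a i) = (\<Sum>i\<in>A. M *v a i)"
  by (induction A rule: infinite_finite_induct) (simp_all add: matrix_vector_right_distrib)

text \<open>The differential equations on F and \<psi> are absent here: the form of the bracket, its
  skew-symmetry and its gradient hold for arbitrary smooth F and \<psi>. The equations enter in
  \<open>canonical_solution\<close>, through the pointwise Jacobi cancellation.\<close>

locale canonical_pair =
  fixes U :: "(real^'n::finite) set" and \<eta> :: "real^'n^'n" and L :: nat and \<epsilon> :: "nat \<Rightarrow> real"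
    and F :: "'n \<Rightarrow> real^'n \<Rightarrow> real" and \<psi> :: "nat \<Rightarrow> real^'n \<Rightarrow> real"
  assumes U: "open U" and eta: "transpose \<eta> = \<eta>"
    and F: "\<And>i. smooth_on U (F i)"
    and psi: "\<And>\<alpha>. \<alpha> \<in> {1..L} \<Longrightarrow> smooth_on U (\<psi> \<alpha>)"
begin

abbreviation "g \<equiv> g_can \<eta> L \<epsilon> F \<psi>"

text \<open>\<open>W \<alpha>\<close> stands for \<open>(d/dx)\<^sup>-\<^sup>1\<close> of \<open>\<eta>\<^sup>i\<^sup>j \<partial>\<^sub>i\<psi>\<^sup>\<alpha> (q\<^sub>j)\<^sub>x\<close>, not for the tail of the operator, which is
  \<open>(d/dx)\<^sup>-\<^sup>1\<close> of \<open>\<eta>\<^sup>i\<^sup>j (\<partial>\<^sub>i\<psi>\<^sup>\<alpha>)\<^sub>x q\<^sub>j\<close>.\<close>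

definition hess_form :: "real^'n \<Rightarrow> real^'n \<Rightarrow> (nat \<Rightarrow> real) \<Rightarrow> real^'n^'n" where
  "hess_form u q W = (\<Sum>i\<in>UNIV. q $ i *\<^sub>R hess (F i) u) - (\<Sum>\<alpha>=1..L. (\<epsilon> \<alpha> * W \<alpha>) *\<^sub>R hess (\<psi> \<alpha>) u)"

lemma eta_nth: "\<eta> $ i $ j = \<eta> $ j $ i"
  using eta by (metis transpose_def vec_lambda_beta)

lemma eta_inner: "(\<eta> *v a) \<bullet> b = a \<bullet> (\<eta> *v b)"
  by (rule matrix_vector_inner_symmetric[OF eta])

lemma hess_form_mult: "hess_form u q W *v a
  = (\<Sum>i\<in>UNIV. q $ i *\<^sub>R (hess (F i) u *v a)) - (\<Sum>\<alpha>=1..L. (\<epsilon> \<alpha> * W \<alpha>) *\<^sub>R (hess (\<psi> \<alpha>) u *v a))"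
  by (simp add: hess_form_def matrix_vector_mult_diff_rdistrib matrix_vector_mult_sum_left scaleR_matrix_vector_assoc)

text \<open>Reduces linear statements about \<open>hess_form\<close> to single Hessians, the only
  objects that the differential equations mention.\<close>

lemma hess_form_induct:
  assumes "P 0" "\<And>M N. P M \<Longrightarrow> P N \<Longrightarrow> P (M + N)" "\<And>c M. P M \<Longrightarrow> P (c *\<^sub>R M)"
    and Q: "\<And>Q. Q \<in> range F \<union> \<psi> ` {1..L} \<Longrightarrow> P (hess Q u)"
  shows "P (hess_form u q W)"
proof -
  have s: "P (\<Sum>i\<in>A. M i)" if "\<And>i. i \<in> A \<Longrightarrow> P (M i)" for A and M :: "'i \<Rightarrow> real^'n^'n"
    using that by (induction A rule: infinite_finite_induct) (auto intro: assms)
  have "P ((\<Sum>i\<in>UNIV. q $ i *\<^sub>R hess (F i) u) + (-1) *\<^sub>R (\<Sum>\<alpha>=1..L. (\<epsilon> \<alpha> * W \<alpha>) *\<^sub>R hess (\<psi> \<alpha>) u))"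
    by (intro assms(2) assms(3) s Q) auto
  then show ?thesis by (simp add: hess_form_def)
qed

lemma smooth_Q: "Q \<in> range F \<union> \<psi> ` {1..L} \<Longrightarrow> smooth_on U Q"
  using F psi by auto

lemma hess_form_symmetric:
  assumes "u \<in> U" shows "transpose (hess_form u q W) = hess_form u q W"
proof (rule hess_form_induct)
  fix Q assume "Q \<in> range F \<union> \<psi> ` {1..L}"
  then show "transpose (hess Q u) = hess Q u"
    using hess_symmetric[OF U smooth_Q assms, of Q] by (simp add: transpose_def vec_eq_iff)
qed (simp_all add: transpose_def vec_eq_iff)

lemma hess_form_inner: "u \<in> U \<Longrightarrow> (hess_form u q W *v a) \<bullet> b = a \<bullet> (hess_form u q W *v b)"
  by (rule matrix_vector_inner_symmetric[OF hess_form_symmetric])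

lemma hess_inner:
  assumes "Q \<in> range F \<union> \<psi> ` {1..L}" "u \<in> U"
  shows "(hess Q u *v a) \<bullet> b = a \<bullet> (hess Q u *v b)"
  by (rule matrix_vector_inner_symmetric)
    (use hess_symmetric[OF U smooth_Q[OF assms(1)] assms(2)] in \<open>simp add: transpose_def vec_eq_iff\<close>)

lemma eta_mult_nth: "(\<eta> *v a) $ i = (\<Sum>s\<in>UNIV. \<eta> $ i $ s * a $ s)"
  by (simp add: matrix_vector_mult_def)

lemma g_nth: "g u $ i $ j = (\<eta> *v grad (F j) u) $ i + (\<eta> *v grad (F i) u) $ j
  - (\<Sum>\<alpha>=1..L. \<epsilon> \<alpha> * (\<eta> *v grad (\<psi> \<alpha>) u) $ i * (\<eta> *v grad (\<psi> \<alpha>) u) $ j)"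
  unfolding g_can_def by (simp add: eta_mult_nth sum_bilinear_rank_one)

lemma g_symmetric: "transpose (g u) = g u"
  unfolding vec_eq_iff transpose_def by (simp add: g_nth mult_ac add_ac)

text \<open>Arranged for a = \<open>q_x\<close>: under the common factor \<eta> the gradients appear
  with coefficients that are x-derivatives of the coefficients of the Hessians in
  \<open>hess_form\<close>, so that together they form a total derivative.\<close>

lemma g_mult: "g u *v a
  = \<eta> *v ((\<Sum>i\<in>UNIV. a $ i *\<^sub>R grad (F i) u) - (\<Sum>\<alpha>=1..L. (\<epsilon> \<alpha> * (grad (\<psi> \<alpha>) u \<bullet> (\<eta> *v a))) *\<^sub>R grad (\<psi> \<alpha>) u))
    + (\<chi> i. grad (F i) u \<bullet> (\<eta> *v a))"
proof (rule vec_eq_iff[THEN iffD2], rule allI)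
  fix i
  have c: "b \<bullet> (\<eta> *v a) = (\<Sum>j\<in>UNIV. (\<eta> *v b) $ j * a $ j)" for b
    unfolding eta_inner[symmetric] by (simp add: inner_vec_def)
  have "(g u *v a) $ i = (\<Sum>j\<in>UNIV. g u $ i $ j * a $ j)"
    by (simp add: matrix_vector_mult_def)
  also have "\<dots> = (\<Sum>j\<in>UNIV. a $ j * (\<eta> *v grad (F j) u) $ i) + (\<Sum>j\<in>UNIV. (\<eta> *v grad (F i) u) $ j * a $ j)
      - (\<Sum>j\<in>UNIV. \<Sum>\<alpha>=1..L. \<epsilon> \<alpha> * (\<eta> *v grad (\<psi> \<alpha>) u) $ i * ((\<eta> *v grad (\<psi> \<alpha>) u) $ j * a $ j))"
    by (simp add: g_nth algebra_simps sum.distrib sum_subtractf sum_distrib_left)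
  also have "(\<Sum>j\<in>UNIV. \<Sum>\<alpha>=1..L. \<epsilon> \<alpha> * (\<eta> *v grad (\<psi> \<alpha>) u) $ i * ((\<eta> *v grad (\<psi> \<alpha>) u) $ j * a $ j))
      = (\<Sum>\<alpha>=1..L. (\<epsilon> \<alpha> * (grad (\<psi> \<alpha>) u \<bullet> (\<eta> *v a))) * (\<eta> *v grad (\<psi> \<alpha>) u) $ i)"
    by (subst sum.swap) (simp add: c sum_distrib_left sum_distrib_right mult_ac)
  also have "(\<Sum>j\<in>UNIV. (\<eta> *v grad (F i) u) $ j * a $ j) = grad (F i) u \<bullet> (\<eta> *v a)"
    by (simp add: c)
  finally show "(g u *v a) $ i = (\<eta> *v ((\<Sum>i\<in>UNIV. a $ i *\<^sub>R grad (F i) u)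
      - (\<Sum>\<alpha>=1..L. (\<epsilon> \<alpha> * (grad (\<psi> \<alpha>) u \<bullet> (\<eta> *v a))) *\<^sub>R grad (\<psi> \<alpha>) u))
      + (\<chi> i. grad (F i) u \<bullet> (\<eta> *v a))) $ i"
    by (simp add: matrix_vector_mult_diff_distrib matrix_vector_mult_sum_right matrix_vector_mult_scaleR)
qed

lemma eta_hess_nth: "(\<eta> *v (hess Q u *v d)) $ i = (\<Sum>k\<in>UNIV. (\<Sum>s\<in>UNIV. \<eta> $ i $ s * partial s (partial k Q) u) * d $ k)"
  by (simp add: matrix_vector_mul_assoc) (simp add: matrix_vector_mult_def matrix_matrix_mult_def)

text \<open>Since \<open>hess \<psi> *v u_x\<close> is the x-derivative of
  \<open>grad \<psi>\<close>, the tail integrand is one of the two product-rule terms in the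
  derivative of the pairing of \<open>grad \<psi>\<close> with \<eta> q; the other one is
  \<open>flux\<close>.\<close>

lemma tail_integrand_P1:
  "tail_integrand (P1_can \<eta> L \<epsilon> F \<psi>) \<alpha> w q x = (hess (\<psi> \<alpha>) (w x) *v Dx w x) \<bullet> (\<eta> *v q x)"
proof -
  have "tail_integrand (P1_can \<eta> L \<epsilon> F \<psi>) \<alpha> w q x
      = (\<Sum>j\<in>UNIV. (\<eta> *v (hess (\<psi> \<alpha>) (w x) *v Dx w x)) $ j * q x $ j)"
    by (simp add: tail_integrand_def P1_can_def eta_hess_nth sum_distrib_right)
  also have "\<dots> = (\<eta> *v (hess (\<psi> \<alpha>) (w x) *v Dx w x)) \<bullet> q x" by (simp add: inner_vec_def)
  finally show ?thesis by (simp only: eta_inner)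
qed

text \<open>The \<psi> part of the connection and the tail both multiply \<eta>
  \<open>hess \<psi>\<close> \<open>u_x\<close>, with opposite signs, and so merge into one
  coefficient. The antiderivative v stays arbitrary: it is \<open>Dinv\<close> in the brackets and
  an explicit function of u in the representation of the system.\<close>

lemma apply_with_P1:
  "apply_with (P1_can \<eta> L \<epsilon> F \<psi>) v w q x
   = \<eta> *v (hess_form (w x) (q x) (\<lambda>\<alpha>. grad (\<psi> \<alpha>) (w x) \<bullet> (\<eta> *v q x) - v \<alpha> x) *v Dx w x) + g (w x) *v Dx q x"
proof (rule vec_eq_iff[THEN iffD2], rule allI)
  fix i
  let ?h = "\<lambda>Q. (\<eta> *v (hess Q (w x) *v Dx w x)) $ i"
  let ?b = "\<lambda>j k. \<Sum>s\<in>UNIV. \<eta> $ i $ s * partial s (partial k (F j)) (w x)"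
  let ?c = "\<lambda>j k. \<Sum>s\<in>UNIV. \<Sum>p\<in>UNIV. \<eta> $ i $ s * \<eta> $ j $ p *
      (\<Sum>\<alpha>=1..L. \<epsilon> \<alpha> * partial s (partial k (\<psi> \<alpha>)) (w x) * partial p (\<psi> \<alpha>) (w x))"
  have c: "?c j k = (\<Sum>\<alpha>=1..L. \<epsilon> \<alpha> * (\<Sum>s\<in>UNIV. \<eta> $ i $ s * partial s (partial k (\<psi> \<alpha>)) (w x))
      * (\<eta> *v grad (\<psi> \<alpha>) (w x)) $ j)" for j k
    by (simp add: sum_bilinear_rank_one eta_mult_nth)
  have "(\<Sum>j\<in>UNIV. \<Sum>k\<in>UNIV. (?b j k - ?c j k) * Dx w x $ k * q x $ j)
      = (\<Sum>j\<in>UNIV. \<Sum>k\<in>UNIV. ?b j k * Dx w x $ k * q x $ j) - (\<Sum>j\<in>UNIV. \<Sum>k\<in>UNIV. ?c j k * Dx w x $ k * q x $ j)"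
    by (simp only: left_diff_distrib sum_subtractf)
  also have "(\<Sum>j\<in>UNIV. \<Sum>k\<in>UNIV. ?b j k * Dx w x $ k * q x $ j) = (\<Sum>j\<in>UNIV. q x $ j * ?h (F j))"
    by (simp add: eta_hess_nth sum_distrib_left mult_ac)
  also have "(\<Sum>j\<in>UNIV. \<Sum>k\<in>UNIV. ?c j k * Dx w x $ k * q x $ j)
      = (\<Sum>j\<in>UNIV. \<Sum>k\<in>UNIV. q x $ j * Dx w x $ k * (\<Sum>\<alpha>=1..L. \<epsilon> \<alpha> * (\<eta> *v grad (\<psi> \<alpha>) (w x)) $ j
          * (\<Sum>s\<in>UNIV. \<eta> $ i $ s * partial s (partial k (\<psi> \<alpha>)) (w x))))"
    unfolding c by (intro sum.cong refl) (simp only: mult_ac)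
  also have "\<dots> = (\<Sum>\<alpha>=1..L. \<epsilon> \<alpha> * (\<Sum>j\<in>UNIV. q x $ j * (\<eta> *v grad (\<psi> \<alpha>) (w x)) $ j)
      * (\<Sum>k\<in>UNIV. Dx w x $ k * (\<Sum>s\<in>UNIV. \<eta> $ i $ s * partial s (partial k (\<psi> \<alpha>)) (w x))))"
    by (rule sum_bilinear_rank_one)
  also have "\<dots> = (\<Sum>\<alpha>=1..L. \<epsilon> \<alpha> * (grad (\<psi> \<alpha>) (w x) \<bullet> (\<eta> *v q x)) * ?h (\<psi> \<alpha>))"
  proof -
    have "b \<bullet> (\<eta> *v q x) = (\<Sum>j\<in>UNIV. q x $ j * (\<eta> *v b) $ j)" for b
      unfolding eta_inner[of b "q x", symmetric] by (simp add: inner_vec_def mult.commute)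
    then show ?thesis unfolding eta_hess_nth by (simp only: mult.commute)
  qed
  finally have *: "(\<Sum>j\<in>UNIV. \<Sum>k\<in>UNIV. (?b j k - ?c j k) * Dx w x $ k * q x $ j)
    = (\<Sum>j\<in>UNIV. q x $ j * ?h (F j)) - (\<Sum>\<alpha>=1..L. \<epsilon> \<alpha> * (grad (\<psi> \<alpha>) (w x) \<bullet> (\<eta> *v q x)) * ?h (\<psi> \<alpha>))" .
  have t: "(\<Sum>k\<in>UNIV. (\<Sum>p\<in>UNIV. \<eta> $ i $ p * partial p (partial k (\<psi> \<alpha>)) (w x)) * Dx w x $ k) = ?h (\<psi> \<alpha>)" for \<alpha>
    by (simp add: eta_hess_nth)
  have "apply_with (P1_can \<eta> L \<epsilon> F \<psi>) v w q x $ i = (g (w x) *v Dx q x) $ i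
      + (\<Sum>j\<in>UNIV. \<Sum>k\<in>UNIV. (?b j k - ?c j k) * Dx w x $ k * q x $ j)
      + (\<Sum>\<alpha>=1..L. \<epsilon> \<alpha> * ?h (\<psi> \<alpha>) * v \<alpha> x)"
    by (simp add: apply_with_def P1_can_def t) (simp add: matrix_vector_mult_def)
  also have "\<dots> = (g (w x) *v Dx q x) $ i + ((\<Sum>j\<in>UNIV. q x $ j * ?h (F j))
      - (\<Sum>\<alpha>=1..L. (\<epsilon> \<alpha> * (grad (\<psi> \<alpha>) (w x) \<bullet> (\<eta> *v q x) - v \<alpha> x)) * ?h (\<psi> \<alpha>)))"
    unfolding * by (simp add: algebra_simps sum_subtractf sum.distrib)
  finally show "apply_with (P1_can \<eta> L \<epsilon> F \<psi>) v w q x $ i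
    = (\<eta> *v (hess_form (w x) (q x) (\<lambda>\<alpha>. grad (\<psi> \<alpha>) (w x) \<bullet> (\<eta> *v q x) - v \<alpha> x) *v Dx w x) + g (w x) *v Dx q x) $ i"
    by (simp add: hess_form_mult matrix_vector_mult_diff_distrib matrix_vector_mult_sum_right matrix_vector_mult_scaleR)
qed

end

section \<open>Consequences of the differential equations at a point\<close>

locale canonical_solution = canonical_pair U \<eta> L \<epsilon> F \<psi>
  for U :: "(real^'n::finite) set" and \<eta> L \<epsilon> F \<psi> +
  assumes comm: "\<And>Q1 Q2 u i j. Q1 \<in> range F \<union> \<psi> ` {1..L} \<Longrightarrow> Q2 \<in> range F \<union> \<psi> ` {1..L} \<Longrightarrow> u \<in> U \<Longrightarrow>
      (\<Sum>s\<in>UNIV. \<Sum>p\<in>UNIV. partial i (partial s Q1) u * \<eta> $ s $ p * partial p (partial j Q2) u)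
      = (\<Sum>s\<in>UNIV. \<Sum>p\<in>UNIV. partial i (partial s Q2) u * \<eta> $ s $ p * partial p (partial j Q1) u)"
    and symm: "\<And>Q u i j. Q \<in> range F \<union> \<psi> ` {1..L} \<Longrightarrow> u \<in> U \<Longrightarrow>
      (\<Sum>r\<in>UNIV. \<Sum>s\<in>UNIV. g u $ i $ s * \<eta> $ j $ r * partial r (partial s Q) u)
      = (\<Sum>r\<in>UNIV. \<Sum>s\<in>UNIV. g u $ j $ s * \<eta> $ i $ r * partial r (partial s Q) u)"
begin

lemma hess_commute:
  assumes "Q1 \<in> range F \<union> \<psi> ` {1..L}" "Q2 \<in> range F \<union> \<psi> ` {1..L}" "u \<in> U"
  shows "hess Q1 u *v (\<eta> *v (hess Q2 u *v a)) = hess Q2 u *v (\<eta> *v (hess Q1 u *v a))"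
proof -
  have "(hess A u ** \<eta> ** hess B u) $ i $ j
      = (\<Sum>s\<in>UNIV. \<Sum>p\<in>UNIV. partial i (partial s A) u * \<eta> $ s $ p * partial p (partial j B) u)" for A B i j
    by (subst sum.swap) (simp add: matrix_matrix_mult_def sum_distrib_right)
  then have "hess Q1 u ** \<eta> ** hess Q2 u = hess Q2 u ** \<eta> ** hess Q1 u"
    using comm[OF assms] by (simp add: vec_eq_iff)
  then show ?thesis by (simp add: matrix_vector_mul_assoc matrix_mul_assoc)
qed

lemma hess_form_commute:
  assumes "u \<in> U"
  shows "hess_form u q W *v (\<eta> *v (hess_form u q' W' *v a)) = hess_form u q' W' *v (\<eta> *v (hess_form u q W *v a))"
proof (rule hess_form_induct[where P = "\<lambda>M. M *v (\<eta> *v (hess_form u q' W' *v a)) = hess_form u q' W' *v (\<eta> *v (M *v a))"])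
  fix Q assume Q: "Q \<in> range F \<union> \<psi> ` {1..L}"
  show "hess Q u *v (\<eta> *v (hess_form u q' W' *v a)) = hess_form u q' W' *v (\<eta> *v (hess Q u *v a))"
    \<comment> \<open>A second induction, in the other form, reduces to two single Hessians.\<close>
    by (rule hess_form_induct[where P = "\<lambda>M. hess Q u *v (\<eta> *v (M *v a)) = M *v (\<eta> *v (hess Q u *v a))"])
      (simp_all add: hess_commute[OF Q _ assms] matrix_vector_mult_add_rdistrib matrix_vector_right_distrib
        scaleR_matrix_vector_assoc[symmetric] matrix_vector_mult_scaleR)
qed (simp_all add: matrix_vector_mult_add_rdistrib matrix_vector_right_distrib
    scaleR_matrix_vector_assoc[symmetric] matrix_vector_mult_scaleR)

text \<open>The second system of equations says that the matrix g (hess Q) \<eta> is symmetric; this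
  is its bilinear form, extended linearly to \<open>hess_form\<close>.\<close>

lemma hess_form_eta_g_symmetric:
  assumes "u \<in> U"
  shows "(hess_form u q W *v (\<eta> *v a)) \<bullet> (g u *v b) = (hess_form u q W *v (\<eta> *v b)) \<bullet> (g u *v a)"
proof (rule hess_form_induct[where P = "\<lambda>M. (M *v (\<eta> *v a)) \<bullet> (g u *v b) = (M *v (\<eta> *v b)) \<bullet> (g u *v a)"])
  fix Q assume Q: "Q \<in> range F \<union> \<psi> ` {1..L}"
  \<comment> \<open>The entries of g (hess Q) \<eta>, with indices arranged as in
    \<open>symm\<close>.\<close>
  define X where "X i j = (\<Sum>r\<in>UNIV. \<Sum>s\<in>UNIV. g u $ i $ s * \<eta> $ j $ r * partial r (partial s Q) u)" for i j
  have e: "(hess Q u *v (\<eta> *v a)) \<bullet> (g u *v b) = (\<Sum>i\<in>UNIV. \<Sum>j\<in>UNIV. X i j * b $ i * a $ j)" for a b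
  proof -
    have "(hess Q u *v (\<eta> *v a)) \<bullet> (g u *v b) = (g u *v (hess Q u *v (\<eta> *v a))) \<bullet> b"
      by (simp add: matrix_vector_inner_symmetric[OF g_symmetric])
    also have "\<dots> = ((g u ** hess Q u ** \<eta>) *v a) \<bullet> b"
      by (simp add: matrix_vector_mul_assoc matrix_mul_assoc)
    also have "\<dots> = (\<Sum>i\<in>UNIV. \<Sum>j\<in>UNIV. (g u ** hess Q u ** \<eta>) $ i $ j * b $ i * a $ j)"
      by (simp add: inner_vec_def matrix_vector_mult_def sum_distrib_left sum_distrib_right mult_ac)
    finally have 1: "(hess Q u *v (\<eta> *v a)) \<bullet> (g u *v b)
      = (\<Sum>i\<in>UNIV. \<Sum>j\<in>UNIV. (g u ** hess Q u ** \<eta>) $ i $ j * b $ i * a $ j)" .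
    have 2: "(g u ** hess Q u ** \<eta>) $ i $ j = X i j" for i j
    proof -
      have "(g u ** hess Q u ** \<eta>) $ i $ j = (\<Sum>r\<in>UNIV. \<Sum>s\<in>UNIV. g u $ i $ s * partial s (partial r Q) u * \<eta> $ r $ j)"
        by (simp add: matrix_matrix_mult_def sum_distrib_right)
      also have "\<dots> = X i j"
        unfolding X_def
        by (intro sum.cong refl) (simp add: partial_commute[OF U smooth_Q[OF Q] assms] eta_nth mult_ac)
      finally show ?thesis .
    qed
    show ?thesis unfolding 1 2 ..
  qed
  have "X i j = X j i" for i j unfolding X_def by (rule symm[OF Q assms])
  then show "(hess Q u *v (\<eta> *v a)) \<bullet> (g u *v b) = (hess Q u *v (\<eta> *v b)) \<bullet> (g u *v a)"
    unfolding e by (subst sum.swap) (simp add: mult_ac)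
qed (simp_all add: matrix_vector_mult_add_rdistrib inner_add_left scaleR_matrix_vector_assoc[symmetric])

text \<open>After expansion the terms cancel in pairs: among those with d, two terms with the same
  \<open>a_k\<close> agree by commutation; among those with g, two terms with the same
  \<open>S_k\<close> agree by \<open>hess_form_eta_g_symmetric\<close>.\<close>

lemma pointwise_jacobi:
  fixes q1 q2 q3 :: "real^'n" and W1 W2 W3 :: "nat \<Rightarrow> real"
  assumes u: "u \<in> U"
  defines "S1 \<equiv> hess_form u q1 W1" and "S2 \<equiv> hess_form u q2 W2" and "S3 \<equiv> hess_form u q3 W3"
  shows "(S1 *v (\<eta> *v a2) - S2 *v (\<eta> *v a1)) \<bullet> (\<eta> *v (S3 *v d) + g u *v a3)
    + (S2 *v (\<eta> *v a3) - S3 *v (\<eta> *v a2)) \<bullet> (\<eta> *v (S1 *v d) + g u *v a1)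
    + (S3 *v (\<eta> *v a1) - S1 *v (\<eta> *v a3)) \<bullet> (\<eta> *v (S2 *v d) + g u *v a2) = 0"
proof -
  have c: "(hess_form u q W *v b) \<bullet> (\<eta> *v (hess_form u q' W' *v d)) = (hess_form u q' W' *v b) \<bullet> (\<eta> *v (hess_form u q W *v d))" for q q' W W' b
    by (simp add: hess_form_inner[OF u] hess_form_commute[OF u])
  show ?thesis
    unfolding S1_def S2_def S3_def inner_diff_left inner_add_right
    using c[of q1 W1 "\<eta> *v a2" q3 W3] c[of q2 W2 "\<eta> *v a1" q3 W3] c[of q2 W2 "\<eta> *v a3" q1 W1]
      hess_form_eta_g_symmetric[OF u, of q1 W1 a2 a3] hess_form_eta_g_symmetric[OF u, of q2 W2 a1 a3] hess_form_eta_g_symmetric[OF u, of q3 W3 a1 a2]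
    by linarith
qed

end

section \<open>The bracket as a bilinear form without derivatives of the field\<close>

lemma smooth_on_matrix_vector_mult:
  fixes M :: "real^'n::finite^'m::finite"
  shows "open T \<Longrightarrow> smooth_on T f \<Longrightarrow> smooth_on T (\<lambda>x. M *v f x)"
  by (rule smooth_on_bounded_linear_compose[OF matrix_vector_mul_bounded_linear])

lemma has_real_derivative_inner:
  fixes a b :: "real \<Rightarrow> 'a::real_inner"
  assumes "(a has_vector_derivative a') (at s)" "(b has_vector_derivative b') (at s)"
  shows "((\<lambda>s. a s \<bullet> b s) has_real_derivative (a s \<bullet> b' + a' \<bullet> b s)) (at s)"
  using bounded_bilinear.has_vector_derivative[OF bounded_bilinear_inner assms]
  by (simp add: has_real_derivative_iff_has_vector_derivative)

lemma has_real_derivative_vec_nth: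
  "(q has_vector_derivative q') (at s) \<Longrightarrow> ((\<lambda>s. q s $ i) has_real_derivative q' $ i) (at s)"
  using bounded_linear.has_vector_derivative[OF bounded_linear_vec_nth]
  by (fastforce simp: has_real_derivative_iff_has_vector_derivative)

lemma field_space_smooth: "w \<in> field_space U \<Longrightarrow> smooth_on UNIV w"
  and field_space_mem: "w \<in> field_space U \<Longrightarrow> w x \<in> U"
  by (auto simp: field_space_def)

lemma smooth_on_compose_field:
  assumes "open U" "smooth_on U Q" "w \<in> field_space U"
  shows "smooth_on UNIV (\<lambda>x. Q (w x))"
proof -
  have "range w \<subseteq> U" using field_space_mem[OF assms(3)] by blast
  from smooth_on_compose[OF open_UNIV assms(1) this field_space_smooth[OF assms(3)] assms(2)] show ?thesis .
qed

lemma continuous_on_grad: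
  assumes "open U" "smooth_on U Q" "continuous_on A w" "w ` A \<subseteq> U"
  shows "continuous_on A (\<lambda>z. grad Q (w z))"
  by (rule continuous_on_compose2[OF smooth_on_imp_continuous_on[OF smooth_on_grad[OF assms(1,2)]] assms(3,4)])

lemma continuous_on_hess_mult:
  assumes "smooth_on U Q" "continuous_on A w" "w ` A \<subseteq> U" "continuous_on A v"
  shows "continuous_on A (\<lambda>z. hess Q (w z) *v v z)"
proof -
  have "continuous_on A (\<lambda>z. partial i (partial j Q) (w z))" for i j
    by (rule continuous_on_compose2[OF smooth_on_imp_continuous_on[OF smooth_on_partial[OF smooth_on_partial[OF assms(1)]]] assms(2,3)])
  then show ?thesis
    unfolding matrix_vector_mult_def hess_nth
    by (intro continuous_on_vec_lambda continuous_on_sum continuous_on_mult continuous_on_component assms(4))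
qed

section \<open>Nonlocal flux, canonical operator and bracket density\<close>

context canonical_pair
begin

definition flux :: "nat \<Rightarrow> 'n field \<Rightarrow> 'n field \<Rightarrow> real \<Rightarrow> real" where
  "flux \<alpha> w q x = grad (\<psi> \<alpha>) (w x) \<bullet> (\<eta> *v Dx q x)"

definition field_form :: "'n field \<Rightarrow> 'n field \<Rightarrow> real \<Rightarrow> real^'n^'n" where
  "field_form w q x = hess_form (w x) (q x) (\<lambda>\<alpha>. Dinv (flux \<alpha> w q) x)"

text \<open>\<open>P_1\<close> after the integration by parts in its tail. It agrees with the
  operator on covectors of bounded support, for which no integration constant is left over.\<close>

definition canonical_op :: "'n operator" where
  "canonical_op w q x = \<eta> *v (field_form w q x *v Dx w x) + g (w x) *v Dx q x"

text \<open>The local sum is antisymmetric in p and q at every point; the nonlocal sum is so only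
  after integration.\<close>

definition density :: "'n field \<Rightarrow> 'n field \<Rightarrow> 'n field \<Rightarrow> real \<Rightarrow> real" where
  "density w p q x = (\<Sum>i\<in>UNIV. p x $ i * (grad (F i) (w x) \<bullet> (\<eta> *v Dx q x)) - q x $ i * (grad (F i) (w x) \<bullet> (\<eta> *v Dx p x)))
     + (\<Sum>\<alpha>=1..L. \<epsilon> \<alpha> * (flux \<alpha> w p x * Dinv (flux \<alpha> w q) x))"

lemma psi_mem: "\<alpha> \<in> {1..L} \<Longrightarrow> \<psi> \<alpha> \<in> range F \<union> \<psi> ` {1..L}" and F_mem: "F i \<in> range F \<union> \<psi> ` {1..L}"
  by auto

lemma smooth_grad_field:
  "w \<in> field_space U \<Longrightarrow> smooth_on U Q \<Longrightarrow> smooth_on UNIV (\<lambda>x. grad Q (w x))"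
  by (rule smooth_on_compose_field[OF U smooth_on_grad[OF U]])

lemma smooth_hess_field:
  assumes w: "w \<in> field_space U" and Q: "smooth_on U Q"
  shows "smooth_on UNIV (\<lambda>x. hess Q (w x) *v Dx w x)"
proof -
  have "vector_derivative (\<lambda>x. grad Q (w x)) (at x) = hess Q (w x) *v Dx w x" for x
    by (rule vector_derivative_at)
      (rule grad_has_vector_derivative_along[where w = w, OF U Q field_space_mem[OF w]
        has_vector_derivative_Dx[OF field_space_smooth[OF w]]])
  then show ?thesis using smooth_on_vector_derivative[OF open_UNIV smooth_grad_field[OF w Q]] by simp
qed

lemma smooth_flux:
  assumes "w \<in> field_space U" "smooth_on UNIV q" "\<alpha> \<in> {1..L}"
  shows "smooth_on UNIV (flux \<alpha> w q)"
  unfolding flux_def[abs_def]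
  by (rule smooth_on_inner[OF open_UNIV smooth_grad_field[OF assms(1) psi[OF assms(3)]]
        smooth_on_matrix_vector_mult[OF open_UNIV smooth_on_Dx[OF assms(2)]]])

lemma supported_flux: "supported R q \<Longrightarrow> supported R (flux \<alpha> w q)"
  using supported_Dx[of R q] by (simp add: supported_def flux_def)

lemma smooth_Dinv_flux:
  assumes "w \<in> field_space U" "smooth_on UNIV q" "supported R q" "\<alpha> \<in> {1..L}"
  shows "smooth_on UNIV (Dinv (flux \<alpha> w q))"
  by (rule smooth_on_Dinv[OF supported_flux[OF assms(3)] smooth_flux[OF assms(1,2,4)]])

text \<open>The tail integrand is the derivative of a function of bounded support minus
  \<open>flux\<close>, and \<open>Dinv\<close> undoes that derivative exactly.\<close>

lemma Dinv_tail_integrand: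
  assumes w: "w \<in> field_space U" and q: "smooth_on UNIV q" "supported R q" and \<alpha>: "\<alpha> \<in> {1..L}"
  shows "Dinv (tail_integrand (P1_can \<eta> L \<epsilon> F \<psi>) \<alpha> w q) x
    = grad (\<psi> \<alpha>) (w x) \<bullet> (\<eta> *v q x) - Dinv (flux \<alpha> w q) x"
proof -
  let ?f = "\<lambda>x. grad (\<psi> \<alpha>) (w x) \<bullet> (\<eta> *v q x)"
  let ?f' = "\<lambda>x. flux \<alpha> w q x + (hess (\<psi> \<alpha>) (w x) *v Dx w x) \<bullet> (\<eta> *v q x)"
  have sm: "smooth_on UNIV ?f'"
    by (intro smooth_on_add smooth_on_inner smooth_flux smooth_hess_field smooth_on_matrix_vector_mult
        open_UNIV w q \<alpha> psi)
  have "Dinv (\<lambda>x. ?f' x - flux \<alpha> w q x) x = ?f x - Dinv (flux \<alpha> w q) x"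
  proof (rule Dinv_derivative_diff)
    show "supported R ?f" using q(2) by (simp add: supported_def)
    show "(?f has_real_derivative ?f' x) (at x)" for x
      unfolding flux_def
      by (rule has_real_derivative_inner[OF
            grad_has_vector_derivative_along[where w = w, OF U psi[OF \<alpha>] field_space_mem[OF w]
              has_vector_derivative_Dx[OF field_space_smooth[OF w]]]
            bounded_linear.has_vector_derivative[OF matrix_vector_mul_bounded_linear has_vector_derivative_Dx[OF q(1)]]])
    show "supported R ?f'" using q(2) supported_flux[OF q(2)] by (simp add: supported_def)
    show "supported R (flux \<alpha> w q)" by (rule supported_flux[OF q(2)])
  qed (rule smooth_on_imp_continuous_on, rule sm smooth_flux[OF w q(1) \<alpha>])+
  moreover have "tail_integrand (P1_can \<eta> L \<epsilon> F \<psi>) \<alpha> w q = (\<lambda>x. ?f' x - flux \<alpha> w q x)"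
    by (rule ext) (simp add: tail_integrand_P1)
  ultimately show ?thesis by simp
qed

lemma hess_form_cong: "(\<And>\<alpha>. \<alpha> \<in> {1..L} \<Longrightarrow> W \<alpha> = W' \<alpha>) \<Longrightarrow> hess_form u q W = hess_form u q W'"
  by (simp add: hess_form_def)

lemma operator_of_P1:
  assumes "w \<in> field_space U" "smooth_on UNIV q" "supported R q"
  shows "operator_of (P1_can \<eta> L \<epsilon> F \<psi>) w q x = canonical_op w q x"
proof -
  have "hess_form (w x) (q x) (\<lambda>\<alpha>. grad (\<psi> \<alpha>) (w x) \<bullet> (\<eta> *v q x) - Dinv (tail_integrand (P1_can \<eta> L \<epsilon> F \<psi>) \<alpha> w q) x) = field_form w q x"
    unfolding field_form_def by (rule hess_form_cong) (simp add: Dinv_tail_integrand[OF assms])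
  then show ?thesis unfolding operator_of_def apply_with_P1 canonical_op_def by simp
qed

lemma smooth_field_form_mult:
  assumes w: "w \<in> field_space U" and q: "smooth_on UNIV q" "supported R q"
  shows "smooth_on UNIV (\<lambda>x. field_form w q x *v Dx w x)"
  unfolding field_form_def hess_form_mult
  by (intro smooth_on_diff smooth_on_sum smooth_on_scaleR smooth_on_mult smooth_on_const smooth_on_vec_nth
      smooth_hess_field smooth_Dinv_flux[OF w q] open_UNIV w q F psi) assumption+

lemma smooth_canonical_op:
  assumes w: "w \<in> field_space U" and q: "smooth_on UNIV q" "supported R q"
  shows "smooth_on UNIV (canonical_op w q)"
  unfolding canonical_op_def[abs_def] g_mult
  by (intro smooth_on_add smooth_on_diff smooth_on_sum smooth_on_scaleR smooth_on_mult smooth_on_const smooth_on_vec_nth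
      smooth_on_vec_lambda smooth_on_inner smooth_on_matrix_vector_mult smooth_on_Dx smooth_grad_field
      smooth_field_form_mult[OF w q] open_UNIV w q F psi) assumption+

lemma smooth_density:
  assumes w: "w \<in> field_space U" and p: "smooth_on UNIV p" "supported R p" and q: "smooth_on UNIV q" "supported R q"
  shows "smooth_on UNIV (density w p q)"
  unfolding density_def[abs_def]
  by (intro smooth_on_add smooth_on_diff smooth_on_sum smooth_on_mult smooth_on_const smooth_on_vec_nth
      smooth_on_inner smooth_on_matrix_vector_mult smooth_on_Dx smooth_grad_field smooth_flux
      smooth_Dinv_flux[OF w q] open_UNIV w p q F psi) assumption+

lemma supported_density:
  assumes p: "supported R p" and q: "supported R q"
  shows "supported R (density w p q)"
  using p q supported_flux[OF p] by (simp add: supported_def density_def)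

lemma integrable_density:
  assumes "w \<in> field_space U" "smooth_on UNIV p" "supported R p" "smooth_on UNIV q" "supported R q"
  shows "density w p q integrable_on UNIV"
  by (rule integrable_supported[OF supported_density[OF assms(3,5)] smooth_on_imp_continuous_on[OF smooth_density[OF assms]]])

text \<open>The two integrands differ by the x-derivative of the pairing of \<eta> p with Z, which
  has bounded support because p does.\<close>

lemma integral_canonical_op:
  assumes w: "w \<in> field_space U" and p: "smooth_on UNIV p" "supported R p" and q: "smooth_on UNIV q" "supported R q"
  shows "integral UNIV (\<lambda>x. p x \<bullet> canonical_op w q x) = integral UNIV (density w p q)"
proof -
  \<comment> \<open>Z is chosen so that \<eta> Z' is all of \<open>canonical_op w q\<close> except
    the vector with components \<open>grad (F i) \<bullet> (\<eta> *v Dx q x)\<close>, which already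
    appears in \<open>density\<close>.\<close>
  define Z where "Z x = (\<Sum>i\<in>UNIV. q x $ i *\<^sub>R grad (F i) (w x))
    - (\<Sum>\<alpha>=1..L. (\<epsilon> \<alpha> * Dinv (flux \<alpha> w q) x) *\<^sub>R grad (\<psi> \<alpha>) (w x))" for x
  define Z' where "Z' x = field_form w q x *v Dx w x + ((\<Sum>i\<in>UNIV. Dx q x $ i *\<^sub>R grad (F i) (w x))
    - (\<Sum>\<alpha>=1..L. (\<epsilon> \<alpha> * flux \<alpha> w q x) *\<^sub>R grad (\<psi> \<alpha>) (w x)))" for x
  have Z: "(Z has_vector_derivative Z' x) (at x)" for x
  proof -
    have gr: "((\<lambda>x. grad Q (w x)) has_vector_derivative hess Q (w x) *v Dx w x) (at x)" if "smooth_on U Q" for Q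
      by (rule grad_has_vector_derivative_along[where w = w, OF U that field_space_mem[OF w]
            has_vector_derivative_Dx[OF field_space_smooth[OF w]]])
    have "(Z has_vector_derivative
        (\<Sum>i\<in>UNIV. q x $ i *\<^sub>R (hess (F i) (w x) *v Dx w x) + Dx q x $ i *\<^sub>R grad (F i) (w x))
      - (\<Sum>\<alpha>=1..L. (\<epsilon> \<alpha> * Dinv (flux \<alpha> w q) x) *\<^sub>R (hess (\<psi> \<alpha>) (w x) *v Dx w x)
          + (\<epsilon> \<alpha> * flux \<alpha> w q x) *\<^sub>R grad (\<psi> \<alpha>) (w x))) (at x)"
      unfolding Z_def[abs_def]
      by (intro has_vector_derivative_diff has_vector_derivative_sum has_vector_derivative_scaleR gr F psi
          has_real_derivative_vec_nth has_vector_derivative_Dx q DERIV_cmult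
          Dinv_has_real_derivative[OF supported_flux[OF q(2)]] smooth_on_imp_continuous_on smooth_flux w) assumption+
    then show ?thesis
      unfolding Z'_def field_form_def hess_form_mult by (simp add: sum.distrib algebra_simps)
  qed
  have P: "canonical_op w q x = \<eta> *v Z' x + (\<chi> i. grad (F i) (w x) \<bullet> (\<eta> *v Dx q x))" for x
    unfolding canonical_op_def g_mult Z'_def flux_def by (simp add: matrix_vector_right_distrib add.assoc)
  let ?h = "\<lambda>x. (\<eta> *v p x) \<bullet> Z x"
  have h: "(?h has_real_derivative p x \<bullet> canonical_op w q x - density w p q x) (at x)" for x
  proof -
    have "(?h has_real_derivative (\<eta> *v p x) \<bullet> Z' x + (\<eta> *v Dx p x) \<bullet> Z x) (at x)"
      by (rule has_real_derivative_inner[OF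
            bounded_linear.has_vector_derivative[OF matrix_vector_mul_bounded_linear has_vector_derivative_Dx[OF p(1)]] Z])
    moreover have "p x \<bullet> (\<chi> i. grad (F i) (w x) \<bullet> (\<eta> *v Dx q x)) = (\<Sum>i\<in>UNIV. p x $ i * (grad (F i) (w x) \<bullet> (\<eta> *v Dx q x)))"
      by (simp add: inner_vec_def)
    moreover have "(\<eta> *v Dx p x) \<bullet> Z x = (\<Sum>i\<in>UNIV. q x $ i * (grad (F i) (w x) \<bullet> (\<eta> *v Dx p x)))
        - (\<Sum>\<alpha>=1..L. \<epsilon> \<alpha> * (flux \<alpha> w p x * Dinv (flux \<alpha> w q) x))"
      unfolding Z_def flux_def by (simp add: inner_diff_right inner_sum_right inner_commute mult_ac)
    ultimately show ?thesis
      unfolding P density_def by (simp add: inner_add_right eta_inner sum_subtractf)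
  qed
  have "supported R ?h" using p(2) by (simp add: supported_def)
  from integral_derivative_supported[OF this h]
  have "integral UNIV (\<lambda>x. p x \<bullet> canonical_op w q x - density w p q x) = 0" .
  moreover have "(\<lambda>x. p x \<bullet> canonical_op w q x) integrable_on UNIV"
    by (rule integrable_supported[of R], use p(2) in \<open>simp add: supported_def\<close>)
      (intro smooth_on_imp_continuous_on smooth_on_inner open_UNIV p smooth_canonical_op[OF w q])
  ultimately show ?thesis using integral_diff[OF _ integrable_density[OF w p q]] by fastforce
qed

text \<open>Local terms cancel at every point, nonlocal ones by \<open>Dinv_skew\<close> for each
  \<alpha>.\<close>

lemma integral_density_skew:
  assumes w: "w \<in> field_space U" and p: "smooth_on UNIV p" "supported R p" and q: "smooth_on UNIV q" "supported R q"
  shows "integral UNIV (density w p q) = - integral UNIV (density w q p)"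
proof -
  let ?n = "\<lambda>\<alpha> x. flux \<alpha> w p x * Dinv (flux \<alpha> w q) x + flux \<alpha> w q x * Dinv (flux \<alpha> w p) x"
  have i: "(\<lambda>x. flux \<alpha> w p x * Dinv (flux \<alpha> w q) x) integrable_on UNIV"
    if "smooth_on UNIV p" "supported R p" "smooth_on UNIV q" "supported R q" "\<alpha> \<in> {1..L}" for p q \<alpha>
    by (rule integrable_supported[of R], use supported_flux[OF that(2)] in \<open>simp add: supported_def\<close>)
      (intro smooth_on_imp_continuous_on smooth_on_mult open_UNIV smooth_flux smooth_Dinv_flux[OF w that(3,4)] w that)
  have n: "integral UNIV (?n \<alpha>) = 0" "?n \<alpha> integrable_on UNIV" if "\<alpha> \<in> {1..L}" for \<alpha>
  proof -
    note c = smooth_on_imp_continuous_on[OF smooth_flux[OF w p(1) that]] smooth_on_imp_continuous_on[OF smooth_flux[OF w q(1) that]]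
    show "integral UNIV (?n \<alpha>) = 0"
      using integral_add[OF i[OF p q that] i[OF q p that]]
        Dinv_skew[OF supported_flux[OF p(2)] c(1) supported_flux[OF q(2)] c(2)] by simp
    show "?n \<alpha> integrable_on UNIV" by (rule integrable_add[OF i[OF p q that] i[OF q p that]])
  qed
  have "integral UNIV (density w p q) + integral UNIV (density w q p) = integral UNIV (\<lambda>x. density w p q x + density w q p x)"
    by (rule integral_add[symmetric]; rule integrable_density; rule w p q)
  also have "(\<lambda>x. density w p q x + density w q p x) = (\<lambda>x. \<Sum>\<alpha>=1..L. \<epsilon> \<alpha> * ?n \<alpha> x)"
    by (rule ext) (simp add: density_def sum_subtractf sum.distrib distrib_left)
  also have "integral UNIV \<dots> = (\<Sum>\<alpha>=1..L. integral UNIV (\<lambda>x. \<epsilon> \<alpha> * ?n \<alpha> x))"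
    by (rule Henstock_Kurzweil_Integration.integral_sum[OF finite_atLeastAtMost], rule integrable_on_mult_right, rule n(2))
  also have "\<dots> = 0" using n(1) by simp
  finally show ?thesis by simp
qed

end

section \<open>Variation of the bracket\<close>

lemma Dinv_add:
  assumes f: "supported R f" "continuous_on UNIV f" and g: "supported R g" "continuous_on UNIV g"
  shows "Dinv (\<lambda>x. f x + g x) x = Dinv f x + Dinv g x"
proof -
  define b where "b = max R \<bar>x\<bar>"
  have b: "R \<le> b" "-b \<le> x" "x \<le> b" by (auto simp: b_def)
  have i: "h integrable_on {l..u}" if "continuous_on UNIV h" for h :: "real \<Rightarrow> real" and l u
    by (rule integrable_continuous_real[OF continuous_on_subset[OF that]]) simp
  have "supported R (\<lambda>x. f x + g x)" "continuous_on UNIV (\<lambda>x. f x + g x)"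
    using f g by (auto simp: supported_def intro: continuous_on_add)
  from Dinv_eq[OF this b] show ?thesis
    using Dinv_eq[OF f b] Dinv_eq[OF g b] by (simp add: integral_add[OF i[OF f(2)] i[OF g(2)]] add_divide_distrib)
qed

context smooth_curve
begin

lemma continuous_on_param:
  assumes "continuous_on ({-\<delta><..<\<delta>} \<times> UNIV) (\<lambda>(s, x). h s x)" "B \<subseteq> {-\<delta><..<\<delta>} \<times> UNIV"
  shows "continuous_on B (\<lambda>z. h (fst z) (snd z))"
  using continuous_on_subset[OF assms] by (simp add: case_prod_beta')

lemmas continuous_on_q = continuous_on_param[OF smooth_on_imp_continuous_on[OF smooth]]
  and continuous_on_dq = continuous_on_param[OF smooth_on_imp_continuous_on[OF smooth_dq]]
  and continuous_on_Dx = continuous_on_param[OF smooth_on_imp_continuous_on[OF smooth_Dx]]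
  and continuous_on_Dx_dq = continuous_on_param[OF smooth_on_imp_continuous_on[OF smooth_Dx_dq]]

end

context canonical_pair
begin

lemma continuous_on_eta: "continuous_on A f \<Longrightarrow> continuous_on A (\<lambda>z. \<eta> *v f z)"
  by (rule bounded_linear.continuous_on[OF matrix_vector_mul_bounded_linear])

lemma continuous_on_field_form_mult:
  assumes w: "w \<in> field_space U" and p: "smooth_on UNIV p" "supported R p" and q: "smooth_on UNIV q"
  shows "continuous_on UNIV (\<lambda>x. field_form w p x *v (\<eta> *v Dx q x))"
  unfolding field_form_def hess_form_mult
  by (intro continuous_on_diff continuous_on_sum continuous_on_scaleR continuous_on_component continuous_on_mult
      continuous_on_const continuous_on_hess_mult[OF F] continuous_on_hess_mult[OF psi] continuous_on_eta
      continuous_on_Dinv[OF supported_flux[OF p(2)] smooth_on_imp_continuous_on[OF smooth_flux[OF w p(1)]]]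
      smooth_on_imp_continuous_on p q smooth_on_Dx field_space_smooth[OF w])
    (use field_space_mem[OF w] in auto)

end

section \<open>Differentiation along the fields u + s \<xi>\<close>

locale canonical_variation = canonical_pair U \<eta> L \<epsilon> F \<psi>
  for U :: "(real^'n::finite) set" and \<eta> L \<epsilon> F \<psi> +
  fixes u \<xi> :: "'n field" and \<delta> R :: real
  assumes \<xi>: "smooth_on UNIV \<xi>"
    and pos: "\<delta> > 0"
    and near: "\<bar>s\<bar> < \<delta> \<Longrightarrow> (\<lambda>x. u x + s *\<^sub>R \<xi> x) \<in> field_space U"
begin

definition w :: "real \<Rightarrow> 'n field" where "w s x = u x + s *\<^sub>R \<xi> x"

lemma w_field: "\<bar>s\<bar> < \<delta> \<Longrightarrow> w s \<in> field_space U"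
  using near unfolding w_def[abs_def] .

lemma w_0: "w 0 = u" by (simp add: w_def[abs_def])

lemma u_field: "u \<in> field_space U" using w_field[of 0] pos by (simp add: w_0)

lemma w_derivative: "((\<lambda>s. w s x) has_vector_derivative \<xi> x) (at s)"
  unfolding w_def by (auto intro!: derivative_eq_intros)

lemma grad_derivative:
  "\<bar>s\<bar> < \<delta> \<Longrightarrow> smooth_on U Q \<Longrightarrow>
    ((\<lambda>s. grad Q (w s x)) has_vector_derivative hess Q (w s x) *v \<xi> x) (at s)"
  by (rule grad_has_vector_derivative_along[where w = "\<lambda>s. w s x", OF U _ field_space_mem[OF w_field] w_derivative])

lemma continuous_on_w:
  assumes "B \<subseteq> {-\<delta><..<\<delta>} \<times> UNIV" shows "continuous_on B (\<lambda>z. w (fst z) (snd z))"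
proof -
  have u: "continuous_on UNIV u" by (rule smooth_on_imp_continuous_on[OF field_space_smooth[OF u_field]])
  show ?thesis
    unfolding w_def
    by (intro continuous_intros continuous_on_compose2[OF u] continuous_on_compose2[OF smooth_on_imp_continuous_on[OF \<xi>]]) auto
qed

lemma w_image:
  assumes "B \<subseteq> {-\<delta><..<\<delta>} \<times> UNIV" shows "(\<lambda>z. w (fst z) (snd z)) ` B \<subseteq> U"
proof clarify
  fix s x assume "(s, x) \<in> B"
  then have "\<bar>s\<bar> < \<delta>" using assms by (auto simp: abs_less_iff)
  then show "w (fst (s, x)) (snd (s, x)) \<in> U" using field_space_mem[OF w_field] by simp
qed

lemma continuous_on_grad_w:
  assumes "smooth_on U Q" "B \<subseteq> {-\<delta><..<\<delta>} \<times> UNIV"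
  shows "continuous_on B (\<lambda>z. grad Q (w (fst z) (snd z)))"
  by (rule continuous_on_grad[OF U assms(1) continuous_on_w[OF assms(2)] w_image[OF assms(2)]])

lemma continuous_on_hess_w:
  assumes "smooth_on U Q" "B \<subseteq> {-\<delta><..<\<delta>} \<times> UNIV"
  shows "continuous_on B (\<lambda>z. hess Q (w (fst z) (snd z)) *v \<xi> (snd z))"
  by (rule continuous_on_hess_mult[OF assms(1) continuous_on_w[OF assms(2)] w_image[OF assms(2)]],
      rule continuous_on_compose2[OF smooth_on_imp_continuous_on[OF \<xi>] continuous_on_snd[OF continuous_on_id]]) simp

text \<open>The first summand comes from the moving covector. The second, from the moving field,
  contains \<xi> itself but not its derivative.\<close>

definition dflux :: "nat \<Rightarrow> (real \<Rightarrow> real \<Rightarrow> real^'n) \<Rightarrow> real \<Rightarrow> real \<Rightarrow> real" where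
  "dflux \<alpha> q s x = grad (\<psi> \<alpha>) (w s x) \<bullet> (\<eta> *v Dx (smooth_curve.dq q s) x)
     + (hess (\<psi> \<alpha>) (w s x) *v \<xi> x) \<bullet> (\<eta> *v Dx (q s) x)"

context
  fixes q :: "real \<Rightarrow> real \<Rightarrow> real^'n" assumes q: "smooth_curve q \<delta> R"
begin

interpretation q: smooth_curve q \<delta> R by (rule q)

lemma eta_Dx_derivative:
  "\<bar>s\<bar> < \<delta> \<Longrightarrow> ((\<lambda>s. \<eta> *v Dx (q s) x) has_vector_derivative \<eta> *v Dx (q.dq s) x) (at s)"
  by (rule bounded_linear.has_vector_derivative[OF matrix_vector_mul_bounded_linear q.Dx_has_vector_derivative_param])

lemma flux_derivative:
  assumes "\<bar>s\<bar> < \<delta>" "\<alpha> \<in> {1..L}"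
  shows "((\<lambda>s. flux \<alpha> (w s) (q s) x) has_real_derivative dflux \<alpha> q s x) (at s)"
  unfolding flux_def dflux_def
  by (rule has_real_derivative_inner[OF grad_derivative[OF assms(1) psi[OF assms(2)]] eta_Dx_derivative[OF assms(1)]])

lemma continuous_on_flux:
  assumes "B \<subseteq> {-\<delta><..<\<delta>} \<times> UNIV" "\<alpha> \<in> {1..L}"
  shows "continuous_on B (\<lambda>z. flux \<alpha> (w (fst z)) (q (fst z)) (snd z))"
  unfolding flux_def
  by (intro continuous_on_inner continuous_on_grad_w continuous_on_eta q.continuous_on_Dx psi assms)

lemma continuous_on_dflux:
  assumes "B \<subseteq> {-\<delta><..<\<delta>} \<times> UNIV" "\<alpha> \<in> {1..L}"
  shows "continuous_on B (\<lambda>z. dflux \<alpha> q (fst z) (snd z))"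
  unfolding dflux_def
  by (intro continuous_on_add continuous_on_inner continuous_on_grad_w continuous_on_hess_w continuous_on_eta
      q.continuous_on_Dx q.continuous_on_Dx_dq psi assms)

lemma supported_flux_curve: "\<bar>s\<bar> < \<delta> \<Longrightarrow> supported R (flux \<alpha> (w s) (q s))"
  by (rule supported_flux[OF q.supp])

lemma supported_dflux: "\<bar>s\<bar> < \<delta> \<Longrightarrow> supported R (dflux \<alpha> q s)"
  using supported_Dx[OF q.supp] supported_Dx[OF q.supp_dq] by (simp add: supported_def dflux_def)

lemma continuous_on_flux_slice: "\<bar>s\<bar> < \<delta> \<Longrightarrow> \<alpha> \<in> {1..L} \<Longrightarrow> continuous_on UNIV (flux \<alpha> (w s) (q s))"
  by (rule smooth_on_imp_continuous_on[OF smooth_flux[OF w_field q.smooth_slice]])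

lemma Dinv_flux_derivative:
  assumes "\<bar>s\<bar> < \<delta>" "\<alpha> \<in> {1..L}" "\<bar>x\<bar> \<le> R"
  shows "((\<lambda>s. Dinv (flux \<alpha> (w s) (q s)) x) has_real_derivative Dinv (dflux \<alpha> q s) x) (at s)"
proof (rule Dinv_param_has_real_derivative[OF assms(1,3), where h' = "dflux \<alpha> q"])
  show "continuous_on ({-\<delta><..<\<delta>} \<times> UNIV) (\<lambda>(s, x). dflux \<alpha> q s x)"
    unfolding case_prod_beta' by (rule continuous_on_dflux[OF subset_refl assms(2)])
qed (use assms in \<open>auto intro: flux_derivative continuous_on_flux_slice supported_flux_curve supported_dflux\<close>)

lemma continuous_on_Dinv_flux:
  assumes "\<alpha> \<in> {1..L}"
  shows "continuous_on ({-\<delta><..<\<delta>} \<times> {-R..R}) (\<lambda>z. Dinv (flux \<alpha> (w (fst z)) (q (fst z))) (snd z))"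
proof -
  have "continuous_on ({-\<delta><..<\<delta>} \<times> {-R..R}) (\<lambda>(s, x). Dinv (flux \<alpha> (w s) (q s)) x)"
    by (rule continuous_on_Dinv_param)
      (use continuous_on_flux[OF subset_refl assms] supported_flux_curve in \<open>auto simp: case_prod_beta' abs_less_iff\<close>)
  then show ?thesis by (simp add: case_prod_beta')
qed

lemma continuous_on_Dinv_dflux:
  assumes "\<alpha> \<in> {1..L}"
  shows "continuous_on ({-\<delta><..<\<delta>} \<times> {-R..R}) (\<lambda>z. Dinv (dflux \<alpha> q (fst z)) (snd z))"
proof -
  have "continuous_on ({-\<delta><..<\<delta>} \<times> {-R..R}) (\<lambda>(s, x). Dinv (dflux \<alpha> q s) x)"
    by (rule continuous_on_Dinv_param)
      (use continuous_on_dflux[OF subset_refl assms] supported_dflux in \<open>auto simp: case_prod_beta' abs_less_iff\<close>)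
  then show ?thesis by (simp add: case_prod_beta')
qed

end

definition cross :: "(real \<Rightarrow> real \<Rightarrow> real^'n) \<Rightarrow> (real \<Rightarrow> real \<Rightarrow> real^'n) \<Rightarrow> 'n \<Rightarrow> real \<Rightarrow> real \<Rightarrow> real" where
  "cross p q i s x = p s x $ i * (grad (F i) (w s x) \<bullet> (\<eta> *v Dx (q s) x))"

definition dcross :: "(real \<Rightarrow> real \<Rightarrow> real^'n) \<Rightarrow> (real \<Rightarrow> real \<Rightarrow> real^'n) \<Rightarrow> 'n \<Rightarrow> real \<Rightarrow> real \<Rightarrow> real" where
  "dcross p q i s x = p s x $ i * (grad (F i) (w s x) \<bullet> (\<eta> *v Dx (smooth_curve.dq q s) x)
       + (hess (F i) (w s x) *v \<xi> x) \<bullet> (\<eta> *v Dx (q s) x))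
     + smooth_curve.dq p s x $ i * (grad (F i) (w s x) \<bullet> (\<eta> *v Dx (q s) x))"

context
  fixes p q :: "real \<Rightarrow> real \<Rightarrow> real^'n" assumes p: "smooth_curve p \<delta> R" and q: "smooth_curve q \<delta> R"
begin

interpretation p: smooth_curve p \<delta> R by (rule p)
interpretation q: smooth_curve q \<delta> R by (rule q)

lemma cross_derivative:
  assumes "\<bar>s\<bar> < \<delta>"
  shows "((\<lambda>s. cross p q i s x) has_real_derivative dcross p q i s x) (at s)"
  unfolding cross_def dcross_def
  by (rule DERIV_mult'[OF has_real_derivative_vec_nth[OF p.has_vector_derivative_param[OF assms]]
        has_real_derivative_inner[OF grad_derivative[OF assms F] eta_Dx_derivative[OF q assms]]])

lemma continuous_on_dcross:
  assumes "B \<subseteq> {-\<delta><..<\<delta>} \<times> UNIV"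
  shows "continuous_on B (\<lambda>z. dcross p q i (fst z) (snd z))"
  unfolding dcross_def
  by (intro continuous_on_add continuous_on_mult continuous_on_component continuous_on_inner continuous_on_grad_w
      continuous_on_hess_w continuous_on_eta p.continuous_on_q p.continuous_on_dq q.continuous_on_Dx
      q.continuous_on_Dx_dq F assms)

end

definition ddensity :: "(real \<Rightarrow> real \<Rightarrow> real^'n) \<Rightarrow> (real \<Rightarrow> real \<Rightarrow> real^'n) \<Rightarrow> real \<Rightarrow> real \<Rightarrow> real" where
  "ddensity p q s x = (\<Sum>i\<in>UNIV. dcross p q i s x - dcross q p i s x)
     + (\<Sum>\<alpha>=1..L. \<epsilon> \<alpha> * (flux \<alpha> (w s) (p s) x * Dinv (dflux \<alpha> q s) x
          + dflux \<alpha> p s x * Dinv (flux \<alpha> (w s) (q s)) x))"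

lemma density_eq: "density (w s) (p s) (q s) x = (\<Sum>i\<in>UNIV. cross p q i s x - cross q p i s x)
     + (\<Sum>\<alpha>=1..L. \<epsilon> \<alpha> * (flux \<alpha> (w s) (p s) x * Dinv (flux \<alpha> (w s) (q s)) x))"
  by (simp add: density_def cross_def)

lemma integral_density_derivative_aux:
  assumes p: "smooth_curve p \<delta> R" and q: "smooth_curve q \<delta> R"
  shows "((\<lambda>s. integral UNIV (density (w s) (p s) (q s))) has_real_derivative integral UNIV (ddensity p q 0)) (at 0)"
proof (rule leibniz_rule_supported[where R = R and k = "\<lambda>s. density (w s) (p s) (q s)" and k' = "ddensity p q" and \<delta> = \<delta>])
  interpret p: smooth_curve p \<delta> R by (rule p)
  interpret q: smooth_curve q \<delta> R by (rule q)
  show "\<bar>0\<bar> < \<delta>" using pos by simp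
  show "((\<lambda>s. density (w s) (p s) (q s) x) has_real_derivative ddensity p q s x) (at s)" if "\<bar>s\<bar> < \<delta>" "\<bar>x\<bar> \<le> R" for s x
    unfolding density_eq ddensity_def
    by (intro DERIV_add DERIV_sum DERIV_diff DERIV_cmult DERIV_mult' cross_derivative p q flux_derivative
        Dinv_flux_derivative that)
  show "continuous_on {-R..R} (density (w s) (p s) (q s))" if "\<bar>s\<bar> < \<delta>" for s
    by (rule continuous_on_subset[OF smooth_on_imp_continuous_on[OF smooth_density[OF w_field[OF that]
          p.smooth_slice[OF that] p.supp[OF that] q.smooth_slice[OF that] q.supp[OF that]]]]) simp
  show "supported R (density (w s) (p s) (q s))" if "\<bar>s\<bar> < \<delta>" for s
    by (rule supported_density[OF p.supp[OF that] q.supp[OF that]])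
  show "supported R (ddensity p q 0)"
    using p.supp[of 0] q.supp[of 0] p.supp_dq[of 0] q.supp_dq[of 0] supported_Dx[of R "p 0"] supported_Dx[of R "q 0"]
      supported_flux_curve[OF p, of 0] supported_dflux[OF p, of 0] pos
    by (simp add: supported_def ddensity_def dcross_def)
  show "continuous_on ({-\<delta><..<\<delta>} \<times> {-R..R}) (\<lambda>(s, x). ddensity p q s x)"
    unfolding case_prod_beta' ddensity_def
    by (intro continuous_on_add continuous_on_sum continuous_on_diff continuous_on_mult continuous_on_const
        continuous_on_dcross p q continuous_on_flux continuous_on_dflux continuous_on_Dinv_flux continuous_on_Dinv_dflux)
      auto
qed

text \<open>Varying the two covectors gives the first two terms. Varying the field leaves
  \<open>Dinv\<close> acting on expressions in \<xi>; skew-adjointness moves it to the other factor,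
  after which \<xi> stands outside every integral operator and symmetry of the Hessians exposes it
  as the test vector.\<close>

lemma integral_density_derivative:
  assumes p: "smooth_curve p \<delta> R" and q: "smooth_curve q \<delta> R"
  shows "((\<lambda>s. integral UNIV (density (w s) (p s) (q s))) has_real_derivative
      integral UNIV (density u (smooth_curve.dq p 0) (q 0)) + integral UNIV (density u (p 0) (smooth_curve.dq q 0))
      + integral UNIV (\<lambda>x. (field_form u (p 0) x *v (\<eta> *v Dx (q 0) x) - field_form u (q 0) x *v (\<eta> *v Dx (p 0) x)) \<bullet> \<xi> x)) (at 0)"
proof -
  interpret p: smooth_curve p \<delta> R by (rule p)
  interpret q: smooth_curve q \<delta> R by (rule q)
  have 0: "\<bar>0\<bar> < \<delta>" using pos by simp
  note pp = p.smooth_slice[OF 0] p.supp[OF 0] and qq = q.smooth_slice[OF 0] q.supp[OF 0]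
    and dp = p.smooth_dq_slice[OF 0] p.supp_dq[OF 0] and dq = q.smooth_dq_slice[OF 0] q.supp_dq[OF 0]
  \<comment> \<open>The part of \<open>dflux\<close> that comes from moving the field.\<close>
  define h where "h \<alpha> q x = (hess (\<psi> \<alpha>) (u x) *v \<xi> x) \<bullet> (\<eta> *v Dx q x)" for \<alpha> and q :: "'n field" and x
  define r where "r x = (field_form u (p 0) x *v (\<eta> *v Dx (q 0) x) - field_form u (q 0) x *v (\<eta> *v Dx (p 0) x)) \<bullet> \<xi> x" for x
  \<comment> \<open>What has to be added when \<open>Dinv\<close> is moved from
    \<open>h \<alpha> (q 0)\<close> to the flux of \<open>p 0\<close>; its integral is 0 by
    \<open>Dinv_skew\<close>.\<close>
  define n where "n \<alpha> x = flux \<alpha> u (p 0) x * Dinv (h \<alpha> (q 0)) x + h \<alpha> (q 0) x * Dinv (flux \<alpha> u (p 0)) x" for \<alpha> x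
  have ch: "continuous_on UNIV (h \<alpha> q)" if "smooth_on UNIV q" "\<alpha> \<in> {1..L}" for \<alpha> q
    unfolding h_def[abs_def]
    by (intro continuous_on_inner continuous_on_hess_mult[OF psi[OF that(2)]] continuous_on_eta
        smooth_on_imp_continuous_on \<xi> smooth_on_Dx field_space_smooth[OF u_field] that)
      (use field_space_mem[OF u_field] in auto)
  have sh: "supported R (h \<alpha> q)" if "supported R q" for \<alpha> q
    using supported_Dx[OF that] by (simp add: supported_def h_def)
  have cf: "continuous_on UNIV (flux \<alpha> u q)" if "smooth_on UNIV q" "\<alpha> \<in> {1..L}" for \<alpha> q
    by (rule smooth_on_imp_continuous_on[OF smooth_flux[OF u_field that]])
  have split: "Dinv (dflux \<alpha> q 0) x = Dinv (flux \<alpha> u (q.dq 0)) x + Dinv (h \<alpha> (q 0)) x" if "\<alpha> \<in> {1..L}" for \<alpha> x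
  proof -
    have "dflux \<alpha> q 0 = (\<lambda>x. flux \<alpha> u (q.dq 0) x + h \<alpha> (q 0) x)"
      by (rule ext) (simp add: dflux_def flux_def h_def w_0)
    then show ?thesis
      by (simp only: Dinv_add[OF supported_flux[OF dq(2)] cf[OF dq(1) that] sh[OF qq(2)] ch[OF qq(1) that]])
  qed
  have flip: "(hess Q (u x) *v a) \<bullet> \<xi> x = (hess Q (u x) *v \<xi> x) \<bullet> a" if "Q \<in> range F \<union> \<psi> ` {1..L}" for Q x a
    using hess_inner[where a = a and b = "\<xi> x", OF that field_space_mem[OF u_field, of x]]
    by (simp add: inner_commute)
  have rS: "(field_form u p x *v (\<eta> *v Dx q x)) \<bullet> \<xi> x = (\<Sum>i\<in>UNIV. p x $ i * ((hess (F i) (u x) *v \<xi> x) \<bullet> (\<eta> *v Dx q x)))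
      - (\<Sum>\<alpha>=1..L. \<epsilon> \<alpha> * (Dinv (flux \<alpha> u p) x * h \<alpha> q x))" for p q x
    unfolding field_form_def hess_form_mult h_def
    by (simp add: inner_diff_left inner_sum_left flip[OF F_mem] flip[OF psi_mem] mult.assoc)
  have "ddensity p q 0 x = density u (p.dq 0) (q 0) x + density u (p 0) (q.dq 0) x + r x + (\<Sum>\<alpha>=1..L. \<epsilon> \<alpha> * n \<alpha> x)" for x
  proof -
    have 1: "(\<Sum>i\<in>UNIV. dcross p q i 0 x - dcross q p i 0 x)
       = (\<Sum>i\<in>UNIV. p.dq 0 x $ i * (grad (F i) (u x) \<bullet> (\<eta> *v Dx (q 0) x)) - q 0 x $ i * (grad (F i) (u x) \<bullet> (\<eta> *v Dx (p.dq 0) x)))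
       + (\<Sum>i\<in>UNIV. p 0 x $ i * (grad (F i) (u x) \<bullet> (\<eta> *v Dx (q.dq 0) x)) - q.dq 0 x $ i * (grad (F i) (u x) \<bullet> (\<eta> *v Dx (p 0) x)))
       + ((\<Sum>i\<in>UNIV. p 0 x $ i * ((hess (F i) (u x) *v \<xi> x) \<bullet> (\<eta> *v Dx (q 0) x)))
         - (\<Sum>i\<in>UNIV. q 0 x $ i * ((hess (F i) (u x) *v \<xi> x) \<bullet> (\<eta> *v Dx (p 0) x))))"
      unfolding dcross_def w_0 sum.distrib[symmetric] sum_subtractf[symmetric]
      by (intro sum.cong refl) (simp add: algebra_simps)
    have 2: "flux \<alpha> u (p 0) x * Dinv (dflux \<alpha> q 0) x + dflux \<alpha> p 0 x * Dinv (flux \<alpha> u (q 0)) x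
       = flux \<alpha> u (p.dq 0) x * Dinv (flux \<alpha> u (q 0)) x + flux \<alpha> u (p 0) x * Dinv (flux \<alpha> u (q.dq 0)) x
         + (Dinv (flux \<alpha> u (q 0)) x * h \<alpha> (p 0) x - Dinv (flux \<alpha> u (p 0)) x * h \<alpha> (q 0) x) + n \<alpha> x"
      if "\<alpha> \<in> {1..L}" for \<alpha>
      unfolding split[OF that] n_def dflux_def flux_def h_def w_0 by (simp add: algebra_simps)
    have 3: "(\<Sum>\<alpha>=1..L. \<epsilon> \<alpha> * (flux \<alpha> u (p 0) x * Dinv (dflux \<alpha> q 0) x + dflux \<alpha> p 0 x * Dinv (flux \<alpha> u (q 0)) x))
       = (\<Sum>\<alpha>=1..L. \<epsilon> \<alpha> * (flux \<alpha> u (p.dq 0) x * Dinv (flux \<alpha> u (q 0)) x))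
       + (\<Sum>\<alpha>=1..L. \<epsilon> \<alpha> * (flux \<alpha> u (p 0) x * Dinv (flux \<alpha> u (q.dq 0)) x))
       + ((\<Sum>\<alpha>=1..L. \<epsilon> \<alpha> * (Dinv (flux \<alpha> u (q 0)) x * h \<alpha> (p 0) x))
         - (\<Sum>\<alpha>=1..L. \<epsilon> \<alpha> * (Dinv (flux \<alpha> u (p 0)) x * h \<alpha> (q 0) x)))
       + (\<Sum>\<alpha>=1..L. \<epsilon> \<alpha> * n \<alpha> x)"
      unfolding sum.distrib[symmetric] sum_subtractf[symmetric]
      by (rule sum.cong[OF refl]) (simp only: 2 distrib_left right_diff_distrib)
    show ?thesis
      unfolding ddensity_def density_def r_def inner_diff_left rS w_0 1 3 by linarith
  qed
  then have eq: "ddensity p q 0 = (\<lambda>x. density u (p.dq 0) (q 0) x + density u (p 0) (q.dq 0) x + r x + (\<Sum>\<alpha>=1..L. \<epsilon> \<alpha> * n \<alpha> x))"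
    by (rule ext)
  have n: "integral UNIV (n \<alpha>) = 0" "n \<alpha> integrable_on UNIV" if \<alpha>: "\<alpha> \<in> {1..L}" for \<alpha>
  proof -
    note f = supported_flux[OF pp(2)] cf[OF pp(1) \<alpha>] and k = sh[OF qq(2)] ch[OF qq(1) \<alpha>]
    have i: "(\<lambda>x. a x * Dinv b x) integrable_on UNIV"
      if "supported R a" "continuous_on UNIV a" "supported R b" "continuous_on UNIV b" for a b
      by (rule integrable_supported[of R])
        (use that in \<open>auto simp: supported_def intro!: continuous_on_mult continuous_on_Dinv[of R]\<close>)
    show "integral UNIV (n \<alpha>) = 0"
      unfolding n_def[abs_def] using integral_add[OF i[OF f k] i[OF k f]] Dinv_skew[OF f k] by simp
    show "n \<alpha> integrable_on UNIV"
      unfolding n_def[abs_def] by (rule integrable_add[OF i[OF f k] i[OF k f]])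
  qed
  have ns: "integral UNIV (\<lambda>x. \<Sum>\<alpha>=1..L. \<epsilon> \<alpha> * n \<alpha> x) = 0" "(\<lambda>x. \<Sum>\<alpha>=1..L. \<epsilon> \<alpha> * n \<alpha> x) integrable_on UNIV"
  proof -
    have "integral UNIV (\<lambda>x. \<Sum>\<alpha>=1..L. \<epsilon> \<alpha> * n \<alpha> x) = (\<Sum>\<alpha>=1..L. integral UNIV (\<lambda>x. \<epsilon> \<alpha> * n \<alpha> x))"
      by (rule Henstock_Kurzweil_Integration.integral_sum[OF finite_atLeastAtMost], rule integrable_on_mult_right, rule n(2))
    then show "integral UNIV (\<lambda>x. \<Sum>\<alpha>=1..L. \<epsilon> \<alpha> * n \<alpha> x) = 0" using n(1) by simp
    show "(\<lambda>x. \<Sum>\<alpha>=1..L. \<epsilon> \<alpha> * n \<alpha> x) integrable_on UNIV"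
      by (rule Henstock_Kurzweil_Integration.integrable_sum[OF finite_atLeastAtMost], rule integrable_on_mult_right, rule n(2))
  qed
  have ir: "r integrable_on UNIV"
  proof (rule integrable_supported)
    show "supported R r"
      using supported_Dx[OF pp(2)] supported_Dx[OF qq(2)] by (simp add: supported_def r_def)
    show "continuous_on UNIV r"
      unfolding r_def[abs_def]
      by (intro continuous_on_inner continuous_on_diff smooth_on_imp_continuous_on[OF \<xi>]
          continuous_on_field_form_mult[OF u_field pp qq(1)] continuous_on_field_form_mult[OF u_field qq pp(1)])
  qed
  note ib = integrable_density[OF u_field dp qq] integrable_density[OF u_field pp dq]
  have "integral UNIV (ddensity p q 0)
      = integral UNIV (density u (p.dq 0) (q 0)) + integral UNIV (density u (p 0) (q.dq 0)) + integral UNIV r"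
    unfolding eq
    by (simp only: integral_add[OF integrable_add[OF integrable_add[OF ib] ir] ns(2)]
        integral_add[OF integrable_add[OF ib] ir] integral_add[OF ib] ns(1) add_0_right)
  then show ?thesis using integral_density_derivative_aux[OF p q] unfolding r_def[abs_def] by simp
qed

end

section \<open>The Jacobi identity\<close>

lemma smooth_curve_mono: "smooth_curve q \<delta> R \<Longrightarrow> 0 < \<delta>' \<Longrightarrow> \<delta>' \<le> \<delta> \<Longrightarrow> smooth_curve q \<delta>' R"
  unfolding smooth_curve_def by (auto elim: smooth_on_subset)

text \<open>Smoothness in x alone is obtained from a constant curve of fields, that is, from the
  zero variation.\<close>

lemma smooth_functional_smooth_variational_derivative:
  assumes "open U" "smooth_functional U I" "u \<in> field_space U"
  shows "smooth_on UNIV (variational_derivative I u)"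
proof -
  obtain R where R: "\<And>u. u \<in> field_space U \<Longrightarrow> supported R (variational_derivative I u)"
    using smooth_functional_supportedE[OF assms(2)] by blast
  have "(\<lambda>x. 0) \<in> (variations :: (real \<Rightarrow> real^'a) set)"
    by (rule variationsI[of _ 0]) (auto simp: supported_def)
  from smooth_functional_curve[OF assms this R] obtain \<delta>
    where "smooth_curve (\<lambda>s. variational_derivative I (\<lambda>y. u y + s *\<^sub>R 0)) \<delta> R" by blast
  then interpret c: smooth_curve "\<lambda>s. variational_derivative I (\<lambda>y. u y + s *\<^sub>R 0)" \<delta> R .
  show ?thesis using c.smooth_slice[of 0] c.pos by simp
qed

lemma second_variation_smooth_supported:
  assumes "open U" "smooth_functional U I" "u \<in> field_space U" "\<xi> \<in> variations"
    and R: "\<And>u. u \<in> field_space U \<Longrightarrow> supported R (variational_derivative I u)"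
  shows "smooth_on UNIV (second_variation I u \<xi>)" "supported R (second_variation I u \<xi>)"
proof -
  from smooth_functional_curve[OF assms] obtain \<delta>
    where "smooth_curve (\<lambda>s. variational_derivative I (\<lambda>y. u y + s *\<^sub>R \<xi> y)) \<delta> R" by blast
  then interpret c: smooth_curve "\<lambda>s. variational_derivative I (\<lambda>y. u y + s *\<^sub>R \<xi> y)" \<delta> R .
  have "c.dq 0 = second_variation I u \<xi>" by (rule ext) (simp add: c.dq_def second_variation_def)
  then show "smooth_on UNIV (second_variation I u \<xi>)" "supported R (second_variation I u \<xi>)"
    using c.smooth_dq_slice[of 0] c.supp_dq[of 0] c.pos by simp_all
qed

text \<open>P is any operator that agrees with \<open>canonical_op\<close> on smooth covectors of
  bounded support. This admits the combination a \<open>P_1\<close> + b \<open>P_2\<close>, which is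
  not written as \<open>operator_of\<close> a single record.\<close>

locale canonical_operator = canonical_pair U \<eta> L \<epsilon> F \<psi>
  for U :: "(real^'n::finite) set" and \<eta> L \<epsilon> F \<psi> +
  fixes P :: "'n operator"
  assumes P: "w \<in> field_space U \<Longrightarrow> smooth_on UNIV q \<Longrightarrow> supported R q \<Longrightarrow> P w q x = canonical_op w q x"
begin

lemma bracket_eq:
  assumes w: "w \<in> field_space U"
    and I: "smooth_functional U I" "supported R (variational_derivative I w)"
    and J: "smooth_functional U J" "supported R (variational_derivative J w)"
  shows "bracket P I J w = integral UNIV (density w (variational_derivative I w) (variational_derivative J w))"
proof -
  note sI = smooth_functional_smooth_variational_derivative[OF U I(1) w] I(2)
  note sJ = smooth_functional_smooth_variational_derivative[OF U J(1) w] J(2)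
  show ?thesis
    unfolding bracket_def P[OF w sJ] by (rule integral_canonical_op[OF w sI sJ])
qed

end

section \<open>Cut-off Hamiltonian vector fields and the gradient of a bracket\<close>

locale cut_off = canonical_operator U \<eta> L \<epsilon> F \<psi> P
  for U :: "(real^'n::finite) set" and \<eta> L \<epsilon> F \<psi> P +
  fixes u :: "'n field" and R :: real and cut :: "real \<Rightarrow> real"
  assumes u: "u \<in> field_space U"
    and cut: "smooth_on UNIV cut" "\<bar>x\<bar> \<le> R \<Longrightarrow> cut x = 1" "\<bar>x\<bar> > R + 1 \<Longrightarrow> cut x = 0"
begin

abbreviation "V \<equiv> \<lambda>I. variational_derivative I u"

definition good :: "'n functional \<Rightarrow> bool" where
  "good I \<longleftrightarrow> smooth_functional U I \<and> (\<forall>u\<in>field_space U. supported R (variational_derivative I u))"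

lemma goodD:
  assumes "good I"
  shows "smooth_functional U I" "\<And>u. u \<in> field_space U \<Longrightarrow> supported R (variational_derivative I u)"
    "smooth_on UNIV (V I)" "supported R (V I)"
  using assms u smooth_functional_smooth_variational_derivative[OF U _ u] by (auto simp: good_def)

text \<open>The Hamiltonian vector field of I turned into an admissible variation; by
  \<open>inner_X\<close> covectors supported within R pair with it as with the original.\<close>

definition X :: "'n functional \<Rightarrow> 'n field" where "X I x = cut x *\<^sub>R canonical_op u (V I) x"

lemma X_variation: assumes "good I" shows "X I \<in> variations"
proof (rule variationsI)
  show "smooth_on UNIV (X I)"
    unfolding X_def[abs_def] by (intro smooth_on_scaleR open_UNIV cut smooth_canonical_op[OF u goodD(3,4)[OF assms]])
  show "supported (R + 1) (X I)" using cut(3) by (simp add: supported_def X_def)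
qed

lemma inner_X: "supported R f \<Longrightarrow> f x \<bullet> X I x = f x \<bullet> canonical_op u (V I) x"
  using cut(2)[of x] supportedD[of R f x] by (cases "\<bar>x\<bar> \<le> R") (auto simp: X_def)

definition r :: "'n functional \<Rightarrow> 'n functional \<Rightarrow> 'n field" where
  "r I J x = field_form u (V I) x *v (\<eta> *v Dx (V J) x) - field_form u (V J) x *v (\<eta> *v Dx (V I) x)"

text \<open>As for a finite-dimensional Poisson bracket: the Hessians of I and J contracted with the
  opposite Hamiltonian vector fields, plus \<open>r\<close>, the derivative of the operator itself
  with both covectors held fixed.\<close>

definition gradient :: "'n functional \<Rightarrow> 'n functional \<Rightarrow> 'n field" where
  "gradient I J x = second_variation I u (X J) x - second_variation J u (X I) x + r I J x"

lemma continuous_on_r: "good I \<Longrightarrow> good J \<Longrightarrow> continuous_on UNIV (r I J)"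
  unfolding r_def[abs_def]
  by (intro continuous_on_diff continuous_on_field_form_mult[OF u goodD(3,4)] goodD(3))

lemma supported_r: "good I \<Longrightarrow> good J \<Longrightarrow> supported R (r I J)"
  using supported_Dx[OF goodD(4)] by (simp add: supported_def r_def)

lemma second_variation:
  assumes "good I" "\<xi> \<in> variations"
  shows "smooth_on UNIV (second_variation I u \<xi>)" "supported R (second_variation I u \<xi>)"
    "continuous_on UNIV (second_variation I u \<xi>)"
  using second_variation_smooth_supported[OF U goodD(1) u assms(2) goodD(2), of I] assms(1)
    smooth_on_imp_continuous_on by blast+

lemma integrable_inner:
  assumes "supported R f" "continuous_on UNIV f" "continuous_on UNIV (h :: 'n field)"
  shows "(\<lambda>x. f x \<bullet> h x) integrable_on UNIV"
  by (rule integrable_supported[of R]) (use assms in \<open>auto simp: supported_def intro!: continuous_on_inner\<close>)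

lemma integral_gradient:
  assumes I: "good I" and J: "good J" and h: "continuous_on UNIV (h :: 'n field)"
  shows "integral UNIV (\<lambda>x. gradient I J x \<bullet> h x) = integral UNIV (\<lambda>x. second_variation I u (X J) x \<bullet> h x)
    - integral UNIV (\<lambda>x. second_variation J u (X I) x \<bullet> h x) + integral UNIV (\<lambda>x. r I J x \<bullet> h x)"
proof -
  note i = integrable_inner[OF second_variation(2,3)[OF I X_variation[OF J]] h]
    integrable_inner[OF second_variation(2,3)[OF J X_variation[OF I]] h]
    integrable_inner[OF supported_r[OF I J] continuous_on_r[OF I J] h]
  show ?thesis
    unfolding gradient_def inner_add_left inner_diff_left
    by (simp add: integral_add[OF integrable_diff[OF i(1,2)] i(3)] integral_diff[OF i(1,2)])
qed

text \<open>Symmetry of the second variation brings \<xi> inside, where the expression is exactly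
  the change of the bracket caused by the varying gradient of I.\<close>

lemma integral_second_variation_X:
  assumes I: "good I" and J: "good J" and \<xi>: "\<xi> \<in> variations"
  shows "integral UNIV (\<lambda>x. second_variation I u (X J) x \<bullet> \<xi> x)
    = integral UNIV (density u (second_variation I u \<xi>) (V J))"
proof -
  note s = second_variation[OF I \<xi>]
  have "integral UNIV (\<lambda>x. second_variation I u (X J) x \<bullet> \<xi> x)
      = integral UNIV (\<lambda>x. second_variation I u \<xi> x \<bullet> X J x)"
    by (rule second_variation_symmetric[OF U goodD(1)[OF I] u X_variation[OF J] \<xi>])
  also have "\<dots> = integral UNIV (\<lambda>x. second_variation I u \<xi> x \<bullet> canonical_op u (V J) x)"
    by (simp add: inner_X[OF s(2)])
  also have "\<dots> = integral UNIV (density u (second_variation I u \<xi>) (V J))"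
    by (rule integral_canonical_op[OF u s(1,2) goodD(3,4)[OF J]])
  finally show ?thesis .
qed

lemma bracket_has_variational_derivative:
  assumes I: "good I" and J: "good J"
  shows "has_variational_derivative (bracket P I J) u (gradient I J)"
  unfolding has_variational_derivative_def
proof (intro conjI ballI)
  show "continuous_on UNIV (gradient I J)"
    unfolding gradient_def[abs_def]
    by (intro continuous_on_add continuous_on_diff second_variation X_variation continuous_on_r I J)
  fix \<xi> :: "'n field" assume \<xi>: "\<xi> \<in> variations"
  obtain \<delta>1 where \<delta>1: "\<And>s. \<bar>s\<bar> < \<delta>1 \<Longrightarrow> (\<lambda>x. u x + s *\<^sub>R \<xi> x) \<in> field_space U"
    "smooth_curve (\<lambda>s. variational_derivative I (\<lambda>y. u y + s *\<^sub>R \<xi> y)) \<delta>1 R"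
    by (rule smooth_functional_curve[OF U goodD(1)[OF I] u \<xi> goodD(2)[OF I]]) (assumption, erule that[rotated], simp)
  obtain \<delta>2 where \<delta>2: "smooth_curve (\<lambda>s. variational_derivative J (\<lambda>y. u y + s *\<^sub>R \<xi> y)) \<delta>2 R"
    by (rule smooth_functional_curve[OF U goodD(1)[OF J] u \<xi> goodD(2)[OF J]]) (assumption, erule that)
  define \<delta> where "\<delta> = min \<delta>1 \<delta>2"
  have \<delta>: "\<delta> > 0" "\<delta> \<le> \<delta>1" "\<delta> \<le> \<delta>2"
    using smooth_curve.pos[OF \<delta>1(2)] smooth_curve.pos[OF \<delta>2] by (auto simp: \<delta>_def)
  interpret v: canonical_variation U \<eta> L \<epsilon> F \<psi> u \<xi> \<delta> R
    by unfold_locales (use variations_smooth[OF \<xi>] \<delta> \<delta>1(1) in auto)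
  let ?p = "\<lambda>s. variational_derivative I (\<lambda>y. u y + s *\<^sub>R \<xi> y)"
  let ?q = "\<lambda>s. variational_derivative J (\<lambda>y. u y + s *\<^sub>R \<xi> y)"
  have p: "smooth_curve ?p \<delta> R" and q: "smooth_curve ?q \<delta> R"
    using smooth_curve_mono \<delta>1(2) \<delta>2 \<delta> by blast+
  have dp: "smooth_curve.dq ?p 0 = second_variation I u \<xi>"
    by (rule ext) (simp add: smooth_curve.dq_def[OF p] second_variation_def)
  have dq: "smooth_curve.dq ?q 0 = second_variation J u \<xi>"
    by (rule ext) (simp add: smooth_curve.dq_def[OF q] second_variation_def)
  have 0: "(\<lambda>y. u y + 0 *\<^sub>R \<xi> y) = u" by simp
  \<comment> \<open>The varying gradient of J sits in the second slot of \<open>density\<close>;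
    skew-symmetry moves it to the first and creates the minus sign in
    \<open>gradient\<close>.\<close>
  have "integral UNIV (density u (second_variation I u \<xi>) (V J)) + integral UNIV (density u (V I) (second_variation J u \<xi>))
      + integral UNIV (\<lambda>x. r I J x \<bullet> \<xi> x) = integral UNIV (\<lambda>x. gradient I J x \<bullet> \<xi> x)"
    unfolding integral_gradient[OF I J smooth_on_imp_continuous_on[OF variations_smooth[OF \<xi>]]]
      integral_second_variation_X[OF I J \<xi>] integral_second_variation_X[OF J I \<xi>]
      integral_density_skew[OF u goodD(3,4)[OF I] second_variation(1,2)[OF J \<xi>]]
    by simp
  then have "((\<lambda>s. integral UNIV (density (v.w s) (?p s) (?q s))) has_real_derivative integral UNIV (\<lambda>x. gradient I J x \<bullet> \<xi> x)) (at 0)"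
    using v.integral_density_derivative[OF p q] unfolding dp dq 0 r_def by simp
  then show "((\<lambda>s. bracket P I J (\<lambda>x. u x + s *\<^sub>R \<xi> x)) has_real_derivative integral UNIV (\<lambda>x. gradient I J x \<bullet> \<xi> x)) (at 0)"
  proof (rule has_field_derivative_transform_within_open[of _ _ _ "{-\<delta><..<\<delta>}"])
    fix s assume "s \<in> {-\<delta><..<\<delta>}"
    then have "\<bar>s\<bar> < \<delta>" by auto
    from v.w_field[OF this] have w: "v.w s \<in> field_space U" .
    show "integral UNIV (density (v.w s) (?p s) (?q s)) = bracket P I J (\<lambda>x. u x + s *\<^sub>R \<xi> x)"
      using bracket_eq[OF w goodD(1)[OF I] goodD(2)[OF I w] goodD(1)[OF J] goodD(2)[OF J w]]
      unfolding v.w_def[abs_def] by simp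
  qed (use \<delta> in auto)
qed

text \<open>The second variations are supported within R, so the cut-off may be put back into their
  partner. Both arguments of each Hessian are then variations, as its symmetry requires.\<close>

lemma bracket_bracket:
  assumes I: "good I" and J: "good J" and K: "good K"
  shows "bracket P (bracket P I J) K u = integral UNIV (\<lambda>x. second_variation I u (X J) x \<bullet> X K x)
    - integral UNIV (\<lambda>x. second_variation J u (X I) x \<bullet> X K x) + integral UNIV (\<lambda>x. r I J x \<bullet> canonical_op u (V K) x)"
proof -
  have c: "continuous_on UNIV (canonical_op u (V K))"
    by (rule smooth_on_imp_continuous_on[OF smooth_canonical_op[OF u goodD(3,4)[OF K]]])
  have "bracket P (bracket P I J) K u = integral UNIV (\<lambda>x. gradient I J x \<bullet> canonical_op u (V K) x)"
    unfolding bracket_def[of P "bracket P I J"]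
      variational_derivative_eq[OF bracket_has_variational_derivative[OF I J]] P[OF u goodD(3,4)[OF K]] ..
  then show ?thesis
    unfolding integral_gradient[OF I J c] inner_X[OF second_variation(2)[OF I X_variation[OF J]]]
      inner_X[OF second_variation(2)[OF J X_variation[OF I]]] .
qed

end

section \<open>The cyclic sum\<close>

locale canonical_solution_operator = canonical_solution U \<eta> L \<epsilon> F \<psi> + canonical_operator U \<eta> L \<epsilon> F \<psi> P
  for U :: "(real^'n::finite) set" and \<eta> L \<epsilon> F \<psi> P
begin

lemma jacobi_identity:
  assumes IJK: "smooth_functional U I" "smooth_functional U J" "smooth_functional U K" and u: "u \<in> field_space U"
  shows "bracket P (bracket P I J) K u + bracket P (bracket P J K) I u + bracket P (bracket P K I) J u = 0"
    and "\<exists>p. has_variational_derivative (bracket P I J) u p"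
    and "bracket P I J u = - bracket P J I u"
proof -
  obtain R1 where R1: "\<And>u. u \<in> field_space U \<Longrightarrow> supported R1 (variational_derivative I u)"
    using smooth_functional_supportedE[OF IJK(1)] by blast
  obtain R2 where R2: "\<And>u. u \<in> field_space U \<Longrightarrow> supported R2 (variational_derivative J u)"
    using smooth_functional_supportedE[OF IJK(2)] by blast
  obtain R3 where R3: "\<And>u. u \<in> field_space U \<Longrightarrow> supported R3 (variational_derivative K u)"
    using smooth_functional_supportedE[OF IJK(3)] by blast
  \<comment> \<open>One radius for all three functionals, so that a single cut-off serves every
    pairing.\<close>
  define R where "R = max R1 (max R2 R3)"
  obtain cut :: "real \<Rightarrow> real" where cut: "smooth_on UNIV cut" "\<And>x. \<bar>x\<bar> \<le> R \<Longrightarrow> cut x = 1" "\<And>x. \<bar>x\<bar> > R + 1 \<Longrightarrow> cut x = 0"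
    using exists_cutoff[of R] by blast
  interpret c: cut_off U \<eta> L \<epsilon> F \<psi> P u R cut
    by unfold_locales (use u cut in auto)
  have le: "R1 \<le> R" "R2 \<le> R" "R3 \<le> R" by (auto simp: R_def)
  have I: "c.good I" and J: "c.good J" and K: "c.good K"
    using IJK supported_mono[OF R1 le(1)] supported_mono[OF R2 le(2)] supported_mono[OF R3 le(3)]
    by (simp_all add: c.good_def)
  note sI = c.goodD(3,4)[OF I] and sJ = c.goodD(3,4)[OF J] and sK = c.goodD(3,4)[OF K]
  show "\<exists>p. has_variational_derivative (bracket P I J) u p"
    using c.bracket_has_variational_derivative[OF I J] by blast
  show "bracket P I J u = - bracket P J I u"
    using bracket_eq[OF u IJK(1) sI(2) IJK(2) sJ(2)] bracket_eq[OF u IJK(2) sJ(2) IJK(1) sI(2)]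
      integral_density_skew[OF u sI sJ] by simp
  have i: "(\<lambda>x. c.r I J x \<bullet> canonical_op u (c.V K) x) integrable_on UNIV" if "c.good I" "c.good J" "c.good K" for I J K
    by (rule c.integrable_inner[OF c.supported_r[OF that(1,2)] c.continuous_on_r[OF that(1,2)]
          smooth_on_imp_continuous_on[OF smooth_canonical_op[OF u c.goodD(3,4)[OF that(3)]]]])
  have "integral UNIV (\<lambda>x. c.r I J x \<bullet> canonical_op u (c.V K) x) + integral UNIV (\<lambda>x. c.r J K x \<bullet> canonical_op u (c.V I) x)
      + integral UNIV (\<lambda>x. c.r K I x \<bullet> canonical_op u (c.V J) x)
    = integral UNIV (\<lambda>x. c.r I J x \<bullet> canonical_op u (c.V K) x + c.r J K x \<bullet> canonical_op u (c.V I) x + c.r K I x \<bullet> canonical_op u (c.V J) x)"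
    by (simp add: integral_add integrable_add i I J K)
  also have "(\<lambda>x. c.r I J x \<bullet> canonical_op u (c.V K) x + c.r J K x \<bullet> canonical_op u (c.V I) x + c.r K I x \<bullet> canonical_op u (c.V J) x) = (\<lambda>x. 0)"
    unfolding c.r_def canonical_op_def field_form_def by (rule ext) (rule pointwise_jacobi[OF field_space_mem[OF u]])
  finally have r: "integral UNIV (\<lambda>x. c.r I J x \<bullet> canonical_op u (c.V K) x) + integral UNIV (\<lambda>x. c.r J K x \<bullet> canonical_op u (c.V I) x)
      + integral UNIV (\<lambda>x. c.r K I x \<bullet> canonical_op u (c.V J) x) = 0" by simp
  \<comment> \<open>Each functional contributes its Hessian to two of the three double brackets,
    with opposite signs and the two vector fields exchanged; symmetry cancels these pairs.\<close>
  have sym: "integral UNIV (\<lambda>x. second_variation A u (c.X B) x \<bullet> c.X C x)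
      = integral UNIV (\<lambda>x. second_variation A u (c.X C) x \<bullet> c.X B x)" if "c.good A" "c.good B" "c.good C" for A B C
    by (rule second_variation_symmetric[OF U c.goodD(1)[OF that(1)] u c.X_variation[OF that(2)] c.X_variation[OF that(3)]])
  show "bracket P (bracket P I J) K u + bracket P (bracket P J K) I u + bracket P (bracket P K I) J u = 0"
    unfolding c.bracket_bracket[OF I J K] c.bracket_bracket[OF J K I] c.bracket_bracket[OF K I J]
    using r sym[OF I J K] sym[OF J K I] sym[OF K I J] by linarith
qed

lemma hamiltonian_P: "hamiltonian U P"
  unfolding hamiltonian_def using jacobi_identity by blast

end

section \<open>The pencil and the Hamiltonian representations\<close>

lemma has_derivative_grad:
  assumes "open U" "smooth_on U Q" "u \<in> U"
  shows "(Q has_derivative (\<lambda>v. grad Q u \<bullet> v)) (at u)"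
proof -
  note D = smooth_on_has_derivative[OF assms]
  have "frechet_derivative Q (at u) = (\<lambda>v. grad Q u \<bullet> v)"
    by (rule ext) (rule frechet_derivative_eq_grad[OF D])
  then show ?thesis using D by simp
qed

lemma grad_eqI:
  assumes "(h has_derivative (\<lambda>v. G \<bullet> v)) (at u)"
  shows "grad h u = G"
  unfolding vec_eq_iff grad_nth partial_def frechet_derivative_at[OF assms, symmetric]
  by (simp add: inner_axis)

text \<open>The increment of h vanishes off the support of \<xi>, so the integral converges and may
  be differentiated over a compact interval.\<close>

lemma density_functional_has_variational_derivative:
  assumes U: "open U" and h: "smooth_on U h" and u: "u \<in> field_space U"
  shows "has_variational_derivative (density_functional h u) u (\<lambda>x. grad h (u x))"
  unfolding has_variational_derivative_def
proof (intro conjI ballI)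
  have cu: "continuous_on UNIV u" by (rule smooth_on_imp_continuous_on[OF field_space_smooth[OF u]])
  show "continuous_on UNIV (\<lambda>x. grad h (u x))"
    by (rule continuous_on_grad[OF U h cu]) (use field_space_mem[OF u] in auto)
  fix \<xi> :: "real \<Rightarrow> real^'a" assume \<xi>: "\<xi> \<in> variations"
  have c\<xi>: "continuous_on UNIV \<xi>" by (rule smooth_on_imp_continuous_on[OF variations_smooth[OF \<xi>]])
  obtain R where R: "supported R \<xi>" by (rule variations_supportedE[OF \<xi>])
  obtain \<delta> where \<delta>: "\<delta> > 0"
    "\<And>s t. \<bar>s\<bar> < \<delta> \<Longrightarrow> \<bar>t\<bar> < \<delta> \<Longrightarrow> (\<lambda>x. u x + s *\<^sub>R \<xi> x + t *\<^sub>R \<xi> x) \<in> field_space U"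
    using field_space_perturb[OF U u \<xi> \<xi>] by blast
  have w: "(\<lambda>x. u x + s *\<^sub>R \<xi> x) \<in> field_space U" if "\<bar>s\<bar> < \<delta>" for s
    using \<delta>(2)[OF that, of 0] \<delta>(1) by simp
  have wm: "u x + s *\<^sub>R \<xi> x \<in> U" if "\<bar>s\<bar> < \<delta>" for s x
    using field_space_mem[OF w[OF that], of x] .
  have ch: "continuous_on UNIV (\<lambda>x. h (w x))" if "w \<in> field_space U" for w
    by (rule smooth_on_imp_continuous_on[OF smooth_on_compose_field[OF U h that]])
  have "((\<lambda>s. integral UNIV (\<lambda>x. h (u x + s *\<^sub>R \<xi> x) - h (u x))) has_real_derivative
      integral UNIV (\<lambda>x. grad h (u x + 0 *\<^sub>R \<xi> x) \<bullet> \<xi> x)) (at 0)"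
  proof (rule leibniz_rule_supported[where R = R and k' = "\<lambda>s x. grad h (u x + s *\<^sub>R \<xi> x) \<bullet> \<xi> x" and \<delta> = \<delta>])
    show "\<bar>0\<bar> < \<delta>" using \<delta> by simp
    show "((\<lambda>s. h (u x + s *\<^sub>R \<xi> x) - h (u x)) has_real_derivative grad h (u x + s *\<^sub>R \<xi> x) \<bullet> \<xi> x) (at s)"
      if "\<bar>s\<bar> < \<delta>" for s x
    proof -
      have "((\<lambda>s. u x + s *\<^sub>R \<xi> x) has_vector_derivative \<xi> x) (at s)"
        by (auto intro!: derivative_eq_intros)
      from DERIV_diff[OF has_real_derivative_along[where w = "\<lambda>s. u x + s *\<^sub>R \<xi> x", OF U h wm[OF that] this] DERIV_const[of "h (u x)"]]
      show ?thesis by simp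
    qed
    show "continuous_on {-R..R} (\<lambda>x. h (u x + s *\<^sub>R \<xi> x) - h (u x))" if "\<bar>s\<bar> < \<delta>" for s
      by (rule continuous_on_subset[OF continuous_on_diff[OF ch[OF w[OF that]] ch[OF u]]]) simp
    show "continuous_on ({-\<delta><..<\<delta>} \<times> {-R..R}) (\<lambda>(s, x). grad h (u x + s *\<^sub>R \<xi> x) \<bullet> \<xi> x)"
      unfolding case_prod_beta'
      by (intro continuous_on_inner continuous_on_grad[OF U h] continuous_intros
          continuous_on_compose2[OF cu] continuous_on_compose2[OF c\<xi>])
        (use wm in \<open>auto simp: abs_less_iff\<close>)
  qed (use R in \<open>auto simp: supported_def\<close>)
  then show "((\<lambda>\<epsilon>. density_functional h u (\<lambda>x. u x + \<epsilon> *\<^sub>R \<xi> x)) has_real_derivative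
      integral UNIV (\<lambda>x. grad h (u x) \<bullet> \<xi> x)) (at 0)"
    by (simp add: density_functional_def)
qed

lemma matrix_inv_mult:
  fixes A :: "real^'n::finite^'n"
  assumes "invertible A"
  shows "A ** matrix_inv A = mat 1" "matrix_inv A ** A = mat 1"
  using someI_ex[OF assms[unfolded invertible_def]] by (simp_all add: matrix_inv_def)

lemma transpose_matrix_inv:
  fixes A :: "real^'n::finite^'n"
  assumes "invertible A" "transpose A = A"
  shows "transpose (matrix_inv A) = matrix_inv A"
proof -
  have "transpose (matrix_inv A) ** A = mat 1"
    using arg_cong[OF matrix_inv_mult(1)[OF assms(1)], of transpose] assms(2)
    by (simp add: matrix_transpose_mul transpose_mat)
  then have "transpose (matrix_inv A) ** (A ** matrix_inv A) = matrix_inv A"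
    by (simp add: matrix_mul_assoc)
  then show ?thesis by (simp add: matrix_inv_mult(1)[OF assms(1)])
qed

lemma operator_of_P2: "operator_of (P2_can \<eta>) w q x = \<eta> *v Dx q x"
  and apply_with_P2: "apply_with (P2_can \<eta>) v w q x = \<eta> *v Dx q x"
  by (simp_all add: operator_of_def apply_with_def P2_can_def matrix_vector_mult_def)

section \<open>The pencil as a canonical operator\<close>

context canonical_solution
begin

context
  fixes a b :: real
begin

text \<open>The pencil \<open>a P\<^sub>1 + b P\<^sub>2\<close> is again a canonical operator, for \<open>a F\<^sup>i + b u\<^sup>i / 2\<close>, \<open>\<psi>\<^sup>\<alpha>\<close> and
  \<open>a \<epsilon>\<^sub>\<alpha>\<close>.\<close>

definition pencil :: "'n \<Rightarrow> real^'n \<Rightarrow> real" where "pencil i u = a * F i u + b / 2 * u $ i"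

lemma smooth_pencil_F: "smooth_on U (pencil i)"
  unfolding pencil_def[abs_def]
  by (intro smooth_on_add smooth_on_mult smooth_on_const smooth_on_vec_nth smooth_on_id U F)

lemma grad_pencil_F: "u \<in> U \<Longrightarrow> grad (pencil i) u = a *\<^sub>R grad (F i) u + (b / 2) *\<^sub>R axis i 1"
proof (rule grad_eqI)
  assume u: "u \<in> U"
  have "((\<lambda>u. a * F i u + b / 2 * u $ i) has_derivative (\<lambda>v. a * (grad (F i) u \<bullet> v) + b / 2 * v $ i)) (at u)"
    by (intro has_derivative_add has_derivative_mult_right has_derivative_grad[OF U F u]
        bounded_linear_imp_has_derivative bounded_linear_vec_nth)
  then show "(pencil i has_derivative (\<lambda>v. (a *\<^sub>R grad (F i) u + (b / 2) *\<^sub>R axis i 1) \<bullet> v)) (at u)"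
    unfolding pencil_def[abs_def] by (simp add: inner_add_left inner_axis')
qed

lemma partial_pencil_F: "u \<in> U \<Longrightarrow> partial k (pencil i) u = a * partial k (F i) u + (if k = i then b / 2 else 0)"
  using arg_cong[OF grad_pencil_F, of u "\<lambda>v. v $ k" i] by (simp add: axis_def)

lemma hess_pencil_F: assumes u: "u \<in> U" shows "hess (pencil i) u = a *\<^sub>R hess (F i) u"
proof -
  have "partial s (partial k (pencil i)) u = a * partial s (partial k (F i)) u" for s k
  proof -
    have D: "((\<lambda>u. a * partial k (F i) u + (if k = i then b / 2 else 0)) has_derivative
        (\<lambda>v. a * (grad (partial k (F i)) u \<bullet> v) + 0)) (at u)"
      by (intro has_derivative_add has_derivative_mult_right has_derivative_grad[OF U smooth_on_partial[OF F] u]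
          has_derivative_const)
    have "(partial k (pencil i) has_derivative (\<lambda>v. a * (grad (partial k (F i)) u \<bullet> v) + 0)) (at u)"
      by (rule has_derivative_transform_within_open[OF D U u]) (simp add: partial_pencil_F)
    then have "(partial k (pencil i) has_derivative (\<lambda>v. (a *\<^sub>R grad (partial k (F i)) u) \<bullet> v)) (at u)" by simp
    from arg_cong[OF grad_eqI[OF this], of "\<lambda>v. v $ s"] show ?thesis by simp
  qed
  then show ?thesis by (simp add: vec_eq_iff)
qed

text \<open>Each of the two transposed F terms of \<open>g_can\<close> contributes b/2 times \<eta>,
  whence the factor in \<open>pencil\<close>. The scalar a is absorbed by \<epsilon>, not by \<psi>,
  since the latter would need a square root of a.\<close>

lemma g_pencil:
  assumes u: "u \<in> U"
  shows "g_can \<eta> L (\<lambda>\<alpha>. a * \<epsilon> \<alpha>) pencil \<psi> u = a *\<^sub>R g u + b *\<^sub>R \<eta>"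
proof -
  interpret p: canonical_pair U \<eta> L "\<lambda>\<alpha>. a * \<epsilon> \<alpha>" pencil \<psi>
    by unfold_locales (use U eta smooth_pencil_F psi in auto)
  have e: "(\<eta> *v axis j 1) $ i = \<eta> $ i $ j" for i j
    by (simp add: matrix_vector_mult_def axis_def if_distrib cong: if_cong)
  show ?thesis
    unfolding vec_eq_iff p.g_nth vector_add_component vector_scaleR_component g_nth grad_pencil_F[OF u]
    by (simp add: matrix_vector_right_distrib matrix_vector_mult_scaleR e eta_nth[of _ _] sum_distrib_left algebra_simps)
qed

text \<open>The added terms are linear and have zero Hessian, so each Hessian of the new family is a
  constant multiple of an old one; F and \<psi> need no separate treatment afterwards.\<close>

lemma hess_pencil:
  assumes "Q \<in> range pencil \<union> \<psi> ` {1..L}"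
  shows "\<exists>c. \<exists>Q0 \<in> range F \<union> \<psi> ` {1..L}. \<forall>u\<in>U. hess Q u = c *\<^sub>R hess Q0 u"
proof -
  from assms consider i where "Q = pencil i" | "Q \<in> \<psi> ` {1..L}" by blast
  then show ?thesis
  proof cases
    case 1
    then show ?thesis using hess_pencil_F F_mem by blast
  next
    case 2
    then show ?thesis by (intro exI[of _ 1] bexI[of _ Q]) auto
  qed
qed

lemma partial_partial_pencil:
  assumes "\<forall>u\<in>U. hess Q u = c *\<^sub>R hess Q0 u" "u \<in> U"
  shows "partial i (partial j Q) u = c * partial i (partial j Q0) u"
  using arg_cong[OF assms(1)[rule_format, OF assms(2)], of "\<lambda>M. M $ i $ j"] by simp

text \<open>The commutation equations are bilinear in the Hessians and survive rescaling. In the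
  other equations the metric is shifted by b \<eta>, and \<eta> (hess Q) \<eta> is symmetric on its
  own.\<close>

lemma canonical_solution_pencil: "canonical_solution U \<eta> L (\<lambda>\<alpha>. a * \<epsilon> \<alpha>) pencil \<psi>"
proof unfold_locales
  show "open U" "transpose \<eta> = \<eta>" "\<And>i. smooth_on U (pencil i)" "\<And>\<alpha>. \<alpha> \<in> {1..L} \<Longrightarrow> smooth_on U (\<psi> \<alpha>)"
    by (rule U eta smooth_pencil_F psi; assumption?)+
next
  fix Q1 Q2 u i j
  assume Q: "Q1 \<in> range pencil \<union> \<psi> ` {1..L}" "Q2 \<in> range pencil \<union> \<psi> ` {1..L}" and u: "u \<in> U"
  obtain c1 R1 where 1: "R1 \<in> range F \<union> \<psi> ` {1..L}" "\<forall>u\<in>U. hess Q1 u = c1 *\<^sub>R hess R1 u"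
    using hess_pencil[OF Q(1)] by blast
  obtain c2 R2 where 2: "R2 \<in> range F \<union> \<psi> ` {1..L}" "\<forall>u\<in>U. hess Q2 u = c2 *\<^sub>R hess R2 u"
    using hess_pencil[OF Q(2)] by blast
  have e: "(\<Sum>s\<in>UNIV. \<Sum>p\<in>UNIV. c * A s * \<eta> $ s $ p * (d * B p)) = (c * d) * (\<Sum>s\<in>UNIV. \<Sum>p\<in>UNIV. A s * \<eta> $ s $ p * B p)"
    for c d A B by (simp add: sum_distrib_left mult_ac)
  show "(\<Sum>s\<in>UNIV. \<Sum>p\<in>UNIV. partial i (partial s Q1) u * \<eta> $ s $ p * partial p (partial j Q2) u)
      = (\<Sum>s\<in>UNIV. \<Sum>p\<in>UNIV. partial i (partial s Q2) u * \<eta> $ s $ p * partial p (partial j Q1) u)"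
    unfolding partial_partial_pencil[OF 1(2) u] partial_partial_pencil[OF 2(2) u] e comm[OF 1(1) 2(1) u] by (simp only: mult.commute)
next
  fix Q u i j
  assume Q: "Q \<in> range pencil \<union> \<psi> ` {1..L}" and u: "u \<in> U"
  obtain c Q0 where Q0: "Q0 \<in> range F \<union> \<psi> ` {1..L}" "\<forall>u\<in>U. hess Q u = c *\<^sub>R hess Q0 u"
    using hess_pencil[OF Q] by blast
  let ?X = "\<lambda>i j. \<Sum>r\<in>UNIV. \<Sum>s\<in>UNIV. g u $ i $ s * \<eta> $ j $ r * partial r (partial s Q0) u"
  let ?Y = "\<lambda>i j. \<Sum>r\<in>UNIV. \<Sum>s\<in>UNIV. \<eta> $ i $ s * \<eta> $ j $ r * partial r (partial s Q0) u"
  have e: "(\<Sum>r\<in>UNIV. \<Sum>s\<in>UNIV. g_can \<eta> L (\<lambda>\<alpha>. a * \<epsilon> \<alpha>) pencil \<psi> u $ i $ s * \<eta> $ j $ r * partial r (partial s Q) u)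
      = c * a * ?X i j + c * b * ?Y i j" for i j
    unfolding g_pencil[OF u] partial_partial_pencil[OF Q0(2) u] by (simp add: algebra_simps sum.distrib sum_distrib_left)
  have Y: "?Y i j = ?Y j i"
    by (subst sum.swap) (simp add: partial_commute[OF U smooth_Q[OF Q0(1)] u] mult_ac)
  show "(\<Sum>r\<in>UNIV. \<Sum>s\<in>UNIV. g_can \<eta> L (\<lambda>\<alpha>. a * \<epsilon> \<alpha>) pencil \<psi> u $ i $ s * \<eta> $ j $ r * partial r (partial s Q) u)
      = (\<Sum>r\<in>UNIV. \<Sum>s\<in>UNIV. g_can \<eta> L (\<lambda>\<alpha>. a * \<epsilon> \<alpha>) pencil \<psi> u $ j $ s * \<eta> $ i $ r * partial r (partial s Q) u)"
    unfolding e symm[OF Q0(1) u, of i j] Y ..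
qed

lemma hamiltonian_pencil:
  "hamiltonian U (\<lambda>u q x. a *\<^sub>R operator_of (P1_can \<eta> L \<epsilon> F \<psi>) u q x + b *\<^sub>R operator_of (P2_can \<eta>) u q x)"
    (is "hamiltonian U ?P")
proof -
  interpret p: canonical_solution U \<eta> L "\<lambda>\<alpha>. a * \<epsilon> \<alpha>" pencil \<psi> by (rule canonical_solution_pencil)
  interpret p: canonical_solution_operator U \<eta> L "\<lambda>\<alpha>. a * \<epsilon> \<alpha>" pencil \<psi> ?P
  proof unfold_locales
    fix w q :: "'n field" and R x
    assume w: "w \<in> field_space U" and q: "smooth_on UNIV q" "supported R q"
    note wx = field_space_mem[OF w, of x]
    \<comment> \<open>The flux depends on \<psi> and \<eta> only and is the same for the pencil; the
      factor a comes from the Hessians of F and from \<epsilon>.\<close>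
    have "p.field_form w q x = a *\<^sub>R field_form w q x"
      unfolding p.field_form_def p.hess_form_def field_form_def hess_form_def hess_pencil_F[OF wx]
      by (simp add: scaleR_right_diff_distrib scaleR_sum_right mult_ac)
    then show "?P w q x = p.canonical_op w q x"
      unfolding operator_of_P1[OF w q] operator_of_P2 p.canonical_op_def canonical_op_def g_pencil[OF wx]
      by (simp add: matrix_vector_mult_add_rdistrib scaleR_matrix_vector_assoc[symmetric]
          matrix_vector_mult_scaleR scaleR_right_distrib)
  qed
  show ?thesis by (rule p.hamiltonian_P)
qed

end

end

section \<open>The two Hamiltonian representations\<close>

locale canonical_system = canonical_pair U \<eta> L \<epsilon> F \<psi>
  for U :: "(real^'n::finite) set" and \<eta> L \<epsilon> F \<psi> +
  assumes inv: "invertible \<eta>"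
begin

abbreviation "E \<equiv> matrix_inv \<eta>"

lemma eta_E: "\<eta> *v (E *v v) = v"
  by (simp add: matrix_vector_mul_assoc matrix_inv_mult(1)[OF inv])

lemma E_inner: "(E *v v) \<bullet> z = v \<bullet> (E *v z)"
  by (rule matrix_vector_inner_symmetric[OF transpose_matrix_inv[OF inv eta]])

definition velocity :: "real^'n \<Rightarrow> real^'n" where
  "velocity u = (\<chi> i. F i u + (\<Sum>s\<in>UNIV. \<Sum>j\<in>UNIV. \<Sum>r\<in>UNIV. \<eta> $ i $ s * E $ j $ r * partial s (F j) u * u $ r)
       - (\<Sum>s\<in>UNIV. \<eta> $ i $ s * (\<Sum>\<alpha>=1..L. \<epsilon> \<alpha> * partial s (\<psi> \<alpha>) u * \<psi> \<alpha> u)))"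

lemma velocity_eq: "velocity u = (\<chi> i. F i u)
  + \<eta> *v ((\<Sum>j\<in>UNIV. (E *v u) $ j *\<^sub>R grad (F j) u) - (\<Sum>\<alpha>=1..L. (\<epsilon> \<alpha> * \<psi> \<alpha> u) *\<^sub>R grad (\<psi> \<alpha>) u))"
  unfolding vec_eq_iff velocity_def
  by (simp add: eta_mult_nth matrix_vector_mult_def[of E] right_diff_distrib sum_subtractf sum_distrib_left sum_distrib_right mult_ac)

text \<open>The gradient of \<open>H_1\<close> is q = E u, hence \<eta> q = u, and the tail
  integrand becomes the derivative of the Legendre-type expression
  \<open>u \<bullet> grad \<psi> - \<psi>\<close>.\<close>

lemma representation_P1:
  "hamiltonian_representation U velocity (P1_can \<eta> L \<epsilon> F \<psi>)
    (\<lambda>u. 1 / 2 * (\<Sum>j\<in>UNIV. \<Sum>l\<in>UNIV. E $ j $ l * u $ j * u $ l))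
    (\<lambda>\<alpha> u. (\<Sum>r\<in>UNIV. u $ r * partial r (\<psi> \<alpha>) u) - \<psi> \<alpha> u)"
  unfolding hamiltonian_representation_def
proof
  fix u assume u: "u \<in> field_space U"
  let ?h = "\<lambda>u :: real^'n. 1 / 2 * (\<Sum>j\<in>UNIV. \<Sum>l\<in>UNIV. E $ j $ l * u $ j * u $ l)"
  let ?f = "\<lambda>\<alpha> u. (\<Sum>r\<in>UNIV. u $ r * partial r (\<psi> \<alpha>) u) - \<psi> \<alpha> u"
  let ?q = "\<lambda>x. E *v u x"
  have h: "?h = (\<lambda>u. 1 / 2 * (u \<bullet> (E *v u)))"
    by (rule ext) (simp add: inner_vec_def matrix_vector_mult_def sum_distrib_left mult_ac)
  have sh: "smooth_on U ?h"
    unfolding h by (intro smooth_on_mult smooth_on_inner smooth_on_matrix_vector_mult smooth_on_const smooth_on_id U)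
  have gh: "grad ?h v = E *v v" for v
  proof (rule grad_eqI)
    have "((\<lambda>u. 1 / 2 * (u \<bullet> (E *v u))) has_derivative (\<lambda>z. 1 / 2 * (v \<bullet> (E *v z) + z \<bullet> (E *v v)))) (at v)"
      by (intro has_derivative_mult_right has_derivative_inner has_derivative_ident
          bounded_linear_imp_has_derivative matrix_vector_mul_bounded_linear)
    then show "(?h has_derivative (\<lambda>z. (E *v v) \<bullet> z)) (at v)"
      unfolding h by (simp add: E_inner inner_commute[of _ "E *v v"])
  qed
  have su: "smooth_on UNIV u" by (rule field_space_smooth[OF u])
  note ux = field_space_mem[OF u]
  have du: "(u has_vector_derivative Dx u x) (at x)" for x by (rule has_vector_derivative_Dx[OF su])
  have dq: "(?q has_vector_derivative E *v Dx u x) (at x)" for x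
    by (rule bounded_linear.has_vector_derivative[OF matrix_vector_mul_bounded_linear du])
  have Dq: "Dx ?q x = E *v Dx u x" for x
    unfolding Dx_def[of ?q] by (rule vector_derivative_at[OF dq])
  have dQ: "((\<lambda>x. Q (u x)) has_real_derivative grad Q (u x) \<bullet> Dx u x) (at x)"
    and dG: "((\<lambda>x. grad Q (u x)) has_vector_derivative hess Q (u x) *v Dx u x) (at x)"
    if "smooth_on U Q" for Q x
    using has_real_derivative_along[where w = u, OF U that ux du] grad_has_vector_derivative_along[where w = u, OF U that ux du]
    by blast+
  have f: "?f \<alpha> v = v \<bullet> grad (\<psi> \<alpha>) v - \<psi> \<alpha> v" for \<alpha> v by (simp add: inner_vec_def)
  show "\<exists>q. has_variational_derivative (density_functional ?h u) u q \<and>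
        (\<forall>x. q differentiable (at x)) \<and>
        (\<forall>\<alpha>\<in>{1..tails (P1_can \<eta> L \<epsilon> F \<psi>)}. \<forall>x.
           ((\<lambda>y. ?f \<alpha> (u y)) has_real_derivative tail_integrand (P1_can \<eta> L \<epsilon> F \<psi>) \<alpha> u q x) (at x)) \<and>
        (\<forall>x. ((\<lambda>y. velocity (u y)) has_vector_derivative
               apply_with (P1_can \<eta> L \<epsilon> F \<psi>) (\<lambda>\<alpha> y. ?f \<alpha> (u y)) u q x) (at x))"
  proof (intro exI[of _ ?q] conjI allI ballI)
    show "has_variational_derivative (density_functional ?h u) u ?q"
      using density_functional_has_variational_derivative[OF U sh u] unfolding gh .
    show "?q differentiable (at x)" for x using dq has_vector_derivative_def differentiableI by blast
    show "((\<lambda>y. ?f \<alpha> (u y)) has_real_derivative tail_integrand (P1_can \<eta> L \<epsilon> F \<psi>) \<alpha> u ?q x) (at x)"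
      if "\<alpha> \<in> {1..tails (P1_can \<eta> L \<epsilon> F \<psi>)}" for \<alpha> x
    proof -
      have \<alpha>: "\<alpha> \<in> {1..L}" using that by (simp add: P1_can_def)
      have "((\<lambda>y. u y \<bullet> grad (\<psi> \<alpha>) (u y) - \<psi> \<alpha> (u y)) has_real_derivative
          (u x \<bullet> (hess (\<psi> \<alpha>) (u x) *v Dx u x) + Dx u x \<bullet> grad (\<psi> \<alpha>) (u x)) - grad (\<psi> \<alpha>) (u x) \<bullet> Dx u x) (at x)"
        by (intro DERIV_diff has_real_derivative_inner du dG dQ psi \<alpha>)
      then show ?thesis unfolding f tail_integrand_P1 eta_E by (simp add: inner_commute)
    qed
    fix x
    \<comment> \<open>With this antiderivative the coefficient of the Hessian of \<psi> collapses to
      \<psi> itself, which is the coefficient occurring in the derivative of the velocity.\<close>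
    have W: "hess_form (u x) (?q x) (\<lambda>\<alpha>. grad (\<psi> \<alpha>) (u x) \<bullet> (\<eta> *v ?q x) - ?f \<alpha> (u x)) = hess_form (u x) (?q x) (\<lambda>\<alpha>. \<psi> \<alpha> (u x))"
      unfolding eta_E f by (simp add: inner_commute)
    have "((\<lambda>y. velocity (u y)) has_vector_derivative (\<chi> i. grad (F i) (u x) \<bullet> Dx u x)
        + \<eta> *v ((\<Sum>j\<in>UNIV. ?q x $ j *\<^sub>R (hess (F j) (u x) *v Dx u x) + (E *v Dx u x) $ j *\<^sub>R grad (F j) (u x))
          - (\<Sum>\<alpha>=1..L. (\<epsilon> \<alpha> * \<psi> \<alpha> (u x)) *\<^sub>R (hess (\<psi> \<alpha>) (u x) *v Dx u x)
              + (\<epsilon> \<alpha> * (grad (\<psi> \<alpha>) (u x) \<bullet> Dx u x)) *\<^sub>R grad (\<psi> \<alpha>) (u x)))) (at x)"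
      unfolding velocity_eq
    proof (rule has_vector_derivative_add)
      show "((\<lambda>y. \<chi> i. F i (u y)) has_vector_derivative (\<chi> i. grad (F i) (u x) \<bullet> Dx u x)) (at x)"
        by (rule has_vector_derivative_vecI) (simp add: dQ[OF F])
    qed (rule bounded_linear.has_vector_derivative[OF matrix_vector_mul_bounded_linear],
        intro has_vector_derivative_diff has_vector_derivative_sum has_vector_derivative_scaleR dG dQ F psi
          has_real_derivative_vec_nth dq DERIV_cmult, assumption+)
    then show "((\<lambda>y. velocity (u y)) has_vector_derivative
        apply_with (P1_can \<eta> L \<epsilon> F \<psi>) (\<lambda>\<alpha> y. ?f \<alpha> (u y)) u ?q x) (at x)"
      unfolding apply_with_P1 W
      unfolding g_mult Dq eta_E hess_form_mult
      by (simp add: sum.distrib matrix_vector_right_distrib matrix_vector_mult_diff_distrib algebra_simps)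
  qed
qed

text \<open>The velocity potential is \<eta> times the gradient of the density of
  \<open>H_2\<close>: E cancels \<eta> in the bare F term, and the factor 1/2 is absorbed by
  differentiating the square of \<psi>.\<close>

lemma representation_P2:
  "hamiltonian_representation U velocity (P2_can \<eta>)
    (\<lambda>u. (\<Sum>j\<in>UNIV. \<Sum>k\<in>UNIV. E $ j $ k * F k u * u $ j) - 1 / 2 * (\<Sum>\<alpha>=1..L. \<epsilon> \<alpha> * (\<psi> \<alpha> u)\<^sup>2)) f"
  unfolding hamiltonian_representation_def
proof
  fix u assume u: "u \<in> field_space U"
  let ?h = "\<lambda>u. (\<Sum>j\<in>UNIV. \<Sum>k\<in>UNIV. E $ j $ k * F k u * u $ j) - 1 / 2 * (\<Sum>\<alpha>=1..L. \<epsilon> \<alpha> * (\<psi> \<alpha> u)\<^sup>2)"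
  have Esym: "E $ j $ k = E $ k $ j" for j k
    using arg_cong[OF transpose_matrix_inv[OF inv eta], of "\<lambda>M. M $ k $ j"] by (simp add: transpose_def)
  have h: "?h = (\<lambda>u. (\<Sum>k\<in>UNIV. F k u * (E *v u) $ k) - 1 / 2 * (\<Sum>\<alpha>=1..L. \<epsilon> \<alpha> * (\<psi> \<alpha> u * \<psi> \<alpha> u)))"
  proof (rule ext)
    fix u
    have "(\<Sum>j\<in>UNIV. \<Sum>k\<in>UNIV. E $ j $ k * F k u * u $ j) = (\<Sum>k\<in>UNIV. \<Sum>j\<in>UNIV. F k u * (E $ k $ j * u $ j))"
      by (subst sum.swap) (simp add: Esym[of _ _] mult_ac)
    then show "?h u = (\<Sum>k\<in>UNIV. F k u * (E *v u) $ k) - 1 / 2 * (\<Sum>\<alpha>=1..L. \<epsilon> \<alpha> * (\<psi> \<alpha> u * \<psi> \<alpha> u))"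
      by (simp add: matrix_vector_mult_def sum_distrib_left power2_eq_square)
  qed
  have sh: "smooth_on U ?h"
    unfolding h by (intro smooth_on_diff smooth_on_sum smooth_on_mult smooth_on_matrix_vector_mult smooth_on_vec_nth
        smooth_on_const smooth_on_id U F psi) assumption+
  have gh: "grad ?h v = (\<Sum>k\<in>UNIV. (E *v v) $ k *\<^sub>R grad (F k) v) + E *v (\<chi> k. F k v)
      - (\<Sum>\<alpha>=1..L. (\<epsilon> \<alpha> * \<psi> \<alpha> v) *\<^sub>R grad (\<psi> \<alpha>) v)" if v: "v \<in> U" for v
  proof (rule grad_eqI)
    have "(?h has_derivative (\<lambda>z. (\<Sum>k\<in>UNIV. F k v * (E *v z) $ k + grad (F k) v \<bullet> z * (E *v v) $ k)
        - 1 / 2 * (\<Sum>\<alpha>=1..L. \<epsilon> \<alpha> * (\<psi> \<alpha> v * (grad (\<psi> \<alpha>) v \<bullet> z) + (grad (\<psi> \<alpha>) v \<bullet> z) * \<psi> \<alpha> v)))) (at v)"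
      unfolding h
      by (intro has_derivative_diff has_derivative_sum has_derivative_mult has_derivative_mult_right
          has_derivative_grad[OF U _ v] F psi bounded_linear_imp_has_derivative
          bounded_linear_compose[OF bounded_linear_vec_nth matrix_vector_mul_bounded_linear]) assumption+
    moreover have "(E *v (\<chi> k. F k v)) \<bullet> z = (\<Sum>k\<in>UNIV. F k v * (E *v z) $ k)" for z
      unfolding E_inner by (simp add: inner_vec_def)
    ultimately show "(?h has_derivative (\<lambda>z. ((\<Sum>k\<in>UNIV. (E *v v) $ k *\<^sub>R grad (F k) v) + E *v (\<chi> k. F k v)
      - (\<Sum>\<alpha>=1..L. (\<epsilon> \<alpha> * \<psi> \<alpha> v) *\<^sub>R grad (\<psi> \<alpha>) v)) \<bullet> z)) (at v)"
      by (simp add: inner_diff_left inner_add_left inner_sum_left sum.distrib sum_distrib_left algebra_simps)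
  qed
  have V: "velocity v = \<eta> *v grad ?h v" if "v \<in> U" for v
    unfolding velocity_eq gh[OF that]
    by (simp add: matrix_vector_right_distrib matrix_vector_mult_diff_distrib eta_E)
  let ?q = "\<lambda>x. grad ?h (u x)"
  have dq: "(?q has_vector_derivative Dx ?q x) (at x)" for x
    by (rule has_vector_derivative_Dx[OF smooth_grad_field[OF u sh]])
  show "\<exists>q. has_variational_derivative (density_functional ?h u) u q \<and>
        (\<forall>x. q differentiable (at x)) \<and>
        (\<forall>\<alpha>\<in>{1..tails (P2_can \<eta>)}. \<forall>x.
           ((\<lambda>y. f \<alpha> (u y)) has_real_derivative tail_integrand (P2_can \<eta>) \<alpha> u q x) (at x)) \<and>
        (\<forall>x. ((\<lambda>y. velocity (u y)) has_vector_derivative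
               apply_with (P2_can \<eta>) (\<lambda>\<alpha> y. f \<alpha> (u y)) u q x) (at x))"
  proof (intro exI[of _ ?q] conjI allI ballI)
    show "has_variational_derivative (density_functional ?h u) u ?q"
      by (rule density_functional_has_variational_derivative[OF U sh u])
    show "?q differentiable (at x)" for x using dq has_vector_derivative_def differentiableI by blast
    \<comment> \<open>\<open>tails (P2_can \<eta>)\<close> is 0, so the range of \<alpha> is
      empty.\<close>
    show "((\<lambda>y. f \<alpha> (u y)) has_real_derivative tail_integrand (P2_can \<eta>) \<alpha> u ?q x) (at x)"
      if "\<alpha> \<in> {1..tails (P2_can \<eta>)}" for \<alpha> x
      using that by (simp add: P2_can_def)
    show "((\<lambda>y. velocity (u y)) has_vector_derivative apply_with (P2_can \<eta>) (\<lambda>\<alpha> y. f \<alpha> (u y)) u ?q x) (at x)" for x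
      unfolding apply_with_P2 V[OF field_space_mem[OF u]]
      by (rule bounded_linear.has_vector_derivative[OF matrix_vector_mul_bounded_linear dq])
  qed
qed

end

theorem mainTheorem8:
  fixes U :: "(real^'n::finite) set"
    and \<eta> :: "real^'n^'n"
    and L :: nat
    and \<epsilon> :: "nat \<Rightarrow> real"
    and F :: "'n \<Rightarrow> real^'n \<Rightarrow> real"
    and \<psi> :: "nat \<Rightarrow> real^'n \<Rightarrow> real"
  assumes "open U" and "connected U"
    and "transpose \<eta> = \<eta>" and "invertible \<eta>"
    and "\<And>i. smooth_on U (F i)"
    and "\<And>\<alpha>. \<alpha> \<in> {1..L} \<Longrightarrow> smooth_on U (\<psi> \<alpha>)"
    and "\<And>Q1 Q2 u i j. Q1 \<in> range F \<union> \<psi> ` {1..L} \<Longrightarrow> Q2 \<in> range F \<union> \<psi> ` {1..L} \<Longrightarrow> u \<in> U \<Longrightarrow>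
      (\<Sum>s\<in>UNIV. \<Sum>p\<in>UNIV. partial i (partial s Q1) u * \<eta> $ s $ p * partial p (partial j Q2) u)
      = (\<Sum>s\<in>UNIV. \<Sum>p\<in>UNIV. partial i (partial s Q2) u * \<eta> $ s $ p * partial p (partial j Q1) u)"
    and "\<And>Q u i j. Q \<in> range F \<union> \<psi> ` {1..L} \<Longrightarrow> u \<in> U \<Longrightarrow>
      (\<Sum>r\<in>UNIV. \<Sum>s\<in>UNIV.
         g_can \<eta> L \<epsilon> F \<psi> u $ i $ s * \<eta> $ j $ r * partial r (partial s Q) u)
      = (\<Sum>r\<in>UNIV. \<Sum>s\<in>UNIV.
         g_can \<eta> L \<epsilon> F \<psi> u $ j $ s * \<eta> $ i $ r * partial r (partial s Q) u)"
  shows "bi_hamiltonian U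
    (\<lambda>u. \<chi> i. F i u
       + (\<Sum>s\<in>UNIV. \<Sum>j\<in>UNIV. \<Sum>r\<in>UNIV.
            \<eta> $ i $ s * matrix_inv \<eta> $ j $ r * partial s (F j) u * u $ r)
       - (\<Sum>s\<in>UNIV. \<eta> $ i $ s * (\<Sum>\<alpha>=1..L. \<epsilon> \<alpha> * partial s (\<psi> \<alpha>) u * \<psi> \<alpha> u)))
    (P1_can \<eta> L \<epsilon> F \<psi>)
    (\<lambda>u. 1 / 2 * (\<Sum>j\<in>UNIV. \<Sum>l\<in>UNIV. matrix_inv \<eta> $ j $ l * u $ j * u $ l))
    (\<lambda>\<alpha> u. (\<Sum>r\<in>UNIV. u $ r * partial r (\<psi> \<alpha>) u) - \<psi> \<alpha> u)
    (P2_can \<eta>)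
    (\<lambda>u. (\<Sum>j\<in>UNIV. \<Sum>k\<in>UNIV. matrix_inv \<eta> $ j $ k * F k u * u $ j)
       - 1 / 2 * (\<Sum>\<alpha>=1..L. \<epsilon> \<alpha> * (\<psi> \<alpha> u)\<^sup>2))
    (\<lambda>_ _. 0)"
proof -
  interpret c: canonical_solution U \<eta> L \<epsilon> F \<psi>
    by unfold_locales (fact assms)+
  interpret s: canonical_system U \<eta> L \<epsilon> F \<psi>
    by unfold_locales (fact assms)
  \<comment> \<open>The members (1, 0) and (0, 1) of the pencil are the two operators themselves, so
    the pencil lemma gives both Hamiltonian properties together with compatibility.\<close>
  show ?thesis
    unfolding bi_hamiltonian_def compatible_def s.velocity_def[abs_def, symmetric]
    using c.hamiltonian_pencil[of 1 0] c.hamiltonian_pencil[of 0 1] c.hamiltonian_pencil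
      s.representation_P1 s.representation_P2
    by simp
qed

end
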